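(* For every co-prime pair $(m,n)$ of positive integers with $m\le4$, $Q_{m,n}=\mathbf N_{m,n}$ as operators on $\Lambda$.
   Context: Work over $\mathbb{Q}(q,t)$; $\Lambda$ is the algebra of symmetric functions in $X=x_1+x_2+\cdots$, with plethystic notation ($p_k[E]$ = $E$ with all variables including $q,t$ raised to the $k$-th power; $F[E]$ substitutes $p_k\mapsto p_k[E]$) and $\Omega[E]=\exp(\sum_{k\ge1}p_k[E]/k)$, so $\Omega[-uM]=\frac{(1-u)(1-qtu)}{(1-tu)(1-qu)}$ with $M=(1-t)(1-q)$. For $k\in\mathbb{Z}$, $D_kF=F[X+\tfrac Mz]\Omega[-zX]|_{z^k}$ (coefficient of $z^k$). $[A,B]=AB-BA$. Split: for co-prime $m,n>1$, $(a,b)$ is the unique pair with $1\le a\le m-1$, $1\le b\le n-1$, $mb+1=na$, and $\mathrm{Split}(m,n)=(a,b)+(m-a,n-b)$; $\mathrm{Split}(1,n)=(1,n-1)+(0,1)$, $\mathrm{Split}(m,1)=(1,0)+(m-1,1)$. For co-prime nonnegative $(m,n)\ne(0,0)$: $Q_{1,0}=D_0$, $Q_{0,1}=-\underline{e}_1$ (multiplication by $e_1$), $Q_{m,n}=\frac1M[Q_{c,d},Q_{a,b}]$ for $m,n\ge1$ with $\mathrm{Split}(m,n)=(a,b)+(c,d)$. Negut operator: for positive integers $u,v$, $e_i(u,v)=\lfloor iv/u\rfloor-\lfloor(i-1)v/u\rfloor$ and $\mathbf N_{u,v}F[X]=F[X+\sum_{i=1}^u\tfrac M{z_i}]\prod_{i=1}^u\Omega[-z_iX]\prod_{i=1}^uz_i^{-e_i(u,v)}\prod_{i=1}^{u-1}\frac1{1-qtz_i/z_{i+1}}\prod_{1\le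 i<j\le u}\Omega[-\tfrac{z_i}{z_j}M]\Big|_{z_1^0\cdots z_u^0}$, with factors in $z_i/z_j$ ($i<j$) expanded as power series in those ratios and $|_{z_1^0\cdots z_u^0}$ the constant term. *)

theory Defs
  imports
    Complex_Main
    "HOL-Computational_Algebra.Computational_Algebra"
    "HOL-Library.Poly_Mapping"
    "HOL-Number_Theory.Cong"
begin

text \<open>
  An exponent vector \<open>a :: nat \<Rightarrow>\<^sub>0 int\<close> stands for the monomial \<open>z\<^sup>a\<close>. The series
  considered are those involving finitely many of the variables and whose exponents have all partial
  sums \<open>a\<^sub>0 + \<dots> + a\<^sub>j\<close> bounded from below. Both \<open>z\<^sub>i\<close> and the ratios \<open>z\<^sub>i / z\<^sub>j\<close> with \<open>i < j\<close> have
  nonnegative partial sums, so that power series in the \<open>z\<^sub>i\<close> and in these ratios are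
  covered (while series in \<open>z\<^sub>j / z\<^sub>i\<close> are not), and every coefficient of a product is a finite sum.
\<close>

definition exp_psum :: "(nat \<Rightarrow>\<^sub>0 int) \<Rightarrow> nat \<Rightarrow> int" where
  "exp_psum a j = (\<Sum>i\<le>j. Poly_Mapping.lookup a i)"

definition exp_bounded :: "nat \<Rightarrow> int \<Rightarrow> (nat \<Rightarrow>\<^sub>0 int) \<Rightarrow> bool" where
  "exp_bounded N d a \<longleftrightarrow> Poly_Mapping.keys a \<subseteq> {..<N} \<and> (\<forall>j. - d \<le> exp_psum a j)"

typedef (overloaded) 'a zser =
  "{f :: (nat \<Rightarrow>\<^sub>0 int) \<Rightarrow> 'a :: zero. \<exists>N d. \<forall>a. f a \<noteq> 0 \<longrightarrow> exp_bounded N d a}"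
  morphisms zcoeff Abs_zser
  by (rule exI[of _ "\<lambda>_. 0"]) simp

setup_lifting type_definition_zser
lifting_forget poly_mapping.lifting

lemma exp_psum_zero [simp]: "exp_psum 0 j = 0"
  by (simp add: exp_psum_def)

lemma exp_psum_add [simp]: "exp_psum (a + b) j = exp_psum a j + exp_psum b j"
  by (simp add: exp_psum_def lookup_add sum.distrib)

lemma exp_psum_diff [simp]: "exp_psum (a - b) j = exp_psum a j - exp_psum b j"
  by (simp add: exp_psum_def lookup_minus sum_subtractf)

lemma exp_bounded_mono: "exp_bounded N d a \<Longrightarrow> N \<le> N' \<Longrightarrow> d \<le> d' \<Longrightarrow> exp_bounded N' d' a"
  unfolding exp_bounded_def by (auto dest: spec intro: order_trans[of "- d'" "- d"])

lemma exp_bounded_add: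
  "exp_bounded N d a \<Longrightarrow> exp_bounded N d' b \<Longrightarrow> exp_bounded N (d + d') (a + b)"
proof -
  assume 1: "exp_bounded N d a" and 2: "exp_bounded N d' b"
  have "Poly_Mapping.keys (a + b) \<subseteq> {..<N}"
    using 1 2 keys_add[of a b] by (auto simp: exp_bounded_def)
  moreover have "- (d + d') \<le> exp_psum (a + b) j" for j
    using 1 2 by (simp add: exp_bounded_def) (smt (verit))
  ultimately show ?thesis by (simp add: exp_bounded_def)
qed

lemma exp_bounded_single: "\<exists>N d. exp_bounded N d a"
proof -
  define N where "N = Suc (Max (insert 0 (Poly_Mapping.keys a)))"
  have k: "Poly_Mapping.keys a \<subseteq> {..<N}"
    by (auto simp: N_def less_Suc_eq_le)
  define d where "d = (\<Sum>i<N. \<bar>Poly_Mapping.lookup a i\<bar>)"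
  have "- d \<le> exp_psum a j" for j
  proof -
    have "exp_psum a j = (\<Sum>i\<in>{..j} \<inter> {..<N}. Poly_Mapping.lookup a i)"
      unfolding exp_psum_def using k
      by (intro sum.mono_neutral_right) (auto simp: in_keys_iff)
    also have "\<bar>\<dots>\<bar> \<le> (\<Sum>i\<in>{..j} \<inter> {..<N}. \<bar>Poly_Mapping.lookup a i\<bar>)" by (rule sum_abs)
    also have "\<dots> \<le> d" unfolding d_def by (intro sum_mono2) auto
    finally show ?thesis by linarith
  qed
  with k show ?thesis by (auto simp: exp_bounded_def)
qed

lemma lookup_conv_exp_psum:
  "Poly_Mapping.lookup a i = exp_psum a i - (if i = 0 then 0 else exp_psum a (i - 1))"
  by (cases i) (simp_all add: exp_psum_def)

lemma finite_exp_box: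
  "finite {a. exp_bounded N d a \<and> (\<forall>j. exp_psum a j \<le> e j)}" (is "finite ?A")
proof (rule finite_imageD)
  let ?r = "\<lambda>a. restrict (exp_psum a) {..<N}"
  have "?r ` ?A \<subseteq> PiE {..<N} (\<lambda>j. {- d..e j})"
    unfolding exp_bounded_def by (auto simp: PiE_iff extensional_def split: if_splits)
  moreover have "finite (PiE {..<N} (\<lambda>j. {- d..e j}))"
    by (intro finite_PiE) auto
  ultimately show "finite (?r ` ?A)" by (rule finite_subset)
  show "inj_on ?r ?A"
  proof (rule inj_onI)
    fix a b assume a: "a \<in> ?A" and b: "b \<in> ?A" and eq: "?r a = ?r b"
    have eq': "exp_psum a j = exp_psum b j" if "j < N" for j
      using fun_cong[OF eq, of j] that by simp
    show "a = b"
    proof (rule poly_mapping_eqI)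
      fix i show "Poly_Mapping.lookup a i = Poly_Mapping.lookup b i"
      proof (cases "i < N")
        case True then show ?thesis by (simp add: lookup_conv_exp_psum eq')
      next
        case False then show ?thesis using a b
          by (metis (no_types, lifting) exp_bounded_def in_keys_iff lessThan_iff mem_Collect_eq subsetD)
      qed
    qed
  qed
qed

lemma zcoeff_boundedE:
  obtains N d where "\<And>a. zcoeff f a \<noteq> 0 \<Longrightarrow> exp_bounded N d a"
  using zcoeff[of f] by auto

lemma zcoeff_boundedE2:
  obtains N d where "\<And>a. zcoeff f a \<noteq> 0 \<Longrightarrow> exp_bounded N d a"
    "\<And>a. zcoeff g a \<noteq> 0 \<Longrightarrow> exp_bounded N d a"
proof -
  obtain N d where 1: "\<And>a. zcoeff f a \<noteq> 0 \<Longrightarrow> exp_bounded N d a" by (rule zcoeff_boundedE) blast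
  obtain N' d' where 2: "\<And>a. zcoeff g a \<noteq> 0 \<Longrightarrow> exp_bounded N' d' a" by (rule zcoeff_boundedE) blast
  show ?thesis
    by (rule that[of "max N N'" "max d d'"]) (auto intro: exp_bounded_mono dest!: 1 2)
qed

lemma zser_eqI: "(\<And>c. zcoeff f c = zcoeff g c) \<Longrightarrow> f = g"
  by (simp add: zcoeff_inject[symmetric] fun_eq_iff)

lemma finite_zser_conv:
  fixes f g :: "'a :: comm_ring_1 zser"
  shows "finite {a. zcoeff f a * zcoeff g (c - a) \<noteq> 0}"
proof -
  obtain N d where b: "\<And>a. zcoeff f a \<noteq> 0 \<Longrightarrow> exp_bounded N d a"
    "\<And>a. zcoeff g a \<noteq> 0 \<Longrightarrow> exp_bounded N d a" by (rule zcoeff_boundedE2) blast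
  have "{a. zcoeff f a * zcoeff g (c - a) \<noteq> 0} \<subseteq>
      {a. exp_bounded N d a \<and> (\<forall>j. exp_psum a j \<le> exp_psum c j + d)}"
  proof safe
    fix a j assume nz: "zcoeff f a * zcoeff g (c - a) \<noteq> 0"
    then have "zcoeff f a \<noteq> 0" "zcoeff g (c - a) \<noteq> 0" by auto
    from b(1)[OF this(1)] b(2)[OF this(2)]
    show "exp_bounded N d a" "exp_psum a j \<le> exp_psum c j + d"
      by (auto simp: exp_bounded_def algebra_simps minus_le_iff)
  qed
  then show ?thesis using finite_exp_box by (rule finite_subset)
qed

lift_definition zmon :: "(nat \<Rightarrow>\<^sub>0 int) \<Rightarrow> 'a :: zero \<Rightarrow> 'a zser"
  is "\<lambda>a x c. if c = a then x else 0"
proof -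
  fix a :: "nat \<Rightarrow>\<^sub>0 int" and x :: 'a
  show "\<exists>N d. \<forall>c. (if c = a then x else 0) \<noteq> 0 \<longrightarrow> exp_bounded N d c"
    using exp_bounded_single[of a] by auto
qed

lift_definition zser_mult :: "'a :: comm_ring_1 zser \<Rightarrow> 'a zser \<Rightarrow> 'a zser"
  is "\<lambda>f g c. Sum_any (\<lambda>a. f a * g (c - a))"
proof -
  fix f g :: "(nat \<Rightarrow>\<^sub>0 int) \<Rightarrow> 'a"
  assume "\<exists>N d. \<forall>a. f a \<noteq> 0 \<longrightarrow> exp_bounded N d a" "\<exists>N d. \<forall>a. g a \<noteq> 0 \<longrightarrow> exp_bounded N d a"
  then obtain N d N' d' where b: "\<And>a. f a \<noteq> 0 \<Longrightarrow> exp_bounded N d a"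
    "\<And>a. g a \<noteq> 0 \<Longrightarrow> exp_bounded N' d' a" by auto
  show "\<exists>N d. \<forall>c. Sum_any (\<lambda>a. f a * g (c - a)) \<noteq> 0 \<longrightarrow> exp_bounded N d c"
  proof (intro exI allI impI)
    fix c assume "Sum_any (\<lambda>a. f a * g (c - a)) \<noteq> 0"
    then obtain a where "f a * g (c - a) \<noteq> 0" by (rule Sum_any.not_neutral_obtains_not_neutral)
    then have "f a \<noteq> 0" "g (c - a) \<noteq> 0" by auto
    then have "exp_bounded (max N N') d a" "exp_bounded (max N N') d' (c - a)"
      by (auto intro: exp_bounded_mono dest!: b)
    from exp_bounded_add[OF this] show "exp_bounded (max N N') (d + d') c" by simp
  qed
qed

lemma zser_mult_commute: "zser_mult f g = zser_mult g f"
proof (rule zser_eqI)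
  fix c :: "nat \<Rightarrow>\<^sub>0 int"
  have "bij (\<lambda>a. c - a)"
    by (rule bijI) (auto intro!: injI surjI[of _ "\<lambda>a. c - a"])
  then have "Sum_any (\<lambda>a. zcoeff f a * zcoeff g (c - a)) = Sum_any (\<lambda>a. zcoeff g a * zcoeff f (c - a))"
    by (rule Sum_any.reindex_cong) (auto simp: fun_eq_iff mult.commute)
  then show "zcoeff (zser_mult f g) c = zcoeff (zser_mult g f) c" by (simp add: zser_mult.rep_eq)
qed

lemma zser_mult_assoc: "zser_mult (zser_mult f g) h = zser_mult f (zser_mult g h)"
proof (rule zser_eqI)
  fix c :: "nat \<Rightarrow>\<^sub>0 int"
  obtain N d where 1: "\<And>a. zcoeff f a \<noteq> 0 \<Longrightarrow> exp_bounded N d a"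
    "\<And>a. zcoeff g a \<noteq> 0 \<Longrightarrow> exp_bounded N d a" by (rule zcoeff_boundedE2) blast
  obtain N' d' where 2: "\<And>a. zcoeff h a \<noteq> 0 \<Longrightarrow> exp_bounded N' d' a" by (rule zcoeff_boundedE) blast
  define L e where "L = max N N'" and "e = max 0 (max d d')"
  have b: "\<And>a. zcoeff f a \<noteq> 0 \<Longrightarrow> exp_bounded L e a" "\<And>a. zcoeff g a \<noteq> 0 \<Longrightarrow> exp_bounded L e a"
    "\<And>a. zcoeff h a \<noteq> 0 \<Longrightarrow> exp_bounded L e a"
    by (auto intro: exp_bounded_mono simp: L_def e_def dest!: 1 2)
  have e0: "e \<ge> 0" by (simp add: e_def)
  define B where "B = {a. exp_bounded L (e + e) a \<and> (\<forall>j. exp_psum a j \<le> exp_psum c j + (e + e))}"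
  have fB: "finite B" unfolding B_def by (rule finite_exp_box)
  let ?T = "\<lambda>a x. zcoeff f a * zcoeff g (x - a) * zcoeff h (c - x)"
  have nz: "a \<in> B" "x \<in> B" if "?T a x \<noteq> 0" for a x
  proof -
    have "zcoeff f a \<noteq> 0" "zcoeff g (x - a) \<noteq> 0" "zcoeff h (c - x) \<noteq> 0" using that by auto
    then have bb: "exp_bounded L e a" "exp_bounded L e (x - a)" "exp_bounded L e (c - x)"
      by (auto dest!: b)
    have x: "exp_bounded L (e + e) x" using exp_bounded_add[OF bb(1,2)] by simp
    have p: "- e \<le> exp_psum a j" "- e \<le> exp_psum x j - exp_psum a j"
      "- e \<le> exp_psum c j - exp_psum x j" for j
      using bb by (auto simp: exp_bounded_def)
    have a: "exp_bounded L (e + e) a" by (rule exp_bounded_mono[OF bb(1)]) (use e0 in auto)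
    show "a \<in> B" unfolding B_def
    proof (safe intro!: a)
      fix j show "exp_psum a j \<le> exp_psum c j + (e + e)" using p(2,3)[of j] by linarith
    qed
    show "x \<in> B" unfolding B_def
    proof (safe intro!: x)
      fix j show "exp_psum x j \<le> exp_psum c j + (e + e)" using p(3)[of j] e0 by linarith
    qed
  qed
  have "zcoeff (zser_mult (zser_mult f g) h) c =
      Sum_any (\<lambda>x. Sum_any (\<lambda>a. zcoeff f a * zcoeff g (x - a)) * zcoeff h (c - x))"
    by (simp add: zser_mult.rep_eq)
  also have "\<dots> = Sum_any (\<lambda>x. Sum_any (\<lambda>a. ?T a x))"
    by (intro Sum_any.cong Sum_any_left_distrib finite_zser_conv)
  also have "\<dots> = Sum_any (\<lambda>a. Sum_any (\<lambda>x. ?T a x))"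
    by (rule Sum_any.swap[of "B \<times> B"]) (use fB nz in auto)
  also have "\<dots> = Sum_any (\<lambda>a. zcoeff f a * Sum_any (\<lambda>b. zcoeff g b * zcoeff h (c - a - b)))"
  proof (rule Sum_any.cong)
    fix a :: "nat \<Rightarrow>\<^sub>0 int"
    have "bij (\<lambda>x. x - a)"
      by (rule bijI) (auto intro!: injI surjI[of _ "\<lambda>x. x + a"])
    then have "Sum_any (\<lambda>b. zcoeff f a * (zcoeff g b * zcoeff h (c - a - b))) = Sum_any (\<lambda>x. ?T a x)"
      by (rule Sum_any.reindex_cong) (auto simp: fun_eq_iff mult.assoc)
    then show "Sum_any (\<lambda>x. ?T a x) = zcoeff f a * Sum_any (\<lambda>b. zcoeff g b * zcoeff h (c - a - b))"
      by (simp add: Sum_any_right_distrib[OF finite_zser_conv])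
  qed
  also have "\<dots> = zcoeff (zser_mult f (zser_mult g h)) c" by (simp add: zser_mult.rep_eq)
  finally show "zcoeff (zser_mult (zser_mult f g) h) c = zcoeff (zser_mult f (zser_mult g h)) c" .
qed

lemma zser_mult_one: "zser_mult (zmon 0 1) f = f"
proof (rule zser_eqI)
  fix c :: "nat \<Rightarrow>\<^sub>0 int"
  have "(\<lambda>a. zcoeff (zmon 0 1) a * zcoeff f (c - a)) = (\<lambda>a. if a = 0 then zcoeff f (c - a) else 0)"
    by (auto simp: fun_eq_iff zmon.rep_eq)
  then show "zcoeff (zser_mult (zmon 0 1) f) c = zcoeff f c"
    unfolding zser_mult.rep_eq by (simp only: Sum_any.delta diff_zero)
qed

instantiation zser :: (comm_ring_1) comm_ring_1
begin

definition zero_zser :: "'a zser" where "0 = zmon 0 0"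
definition one_zser :: "'a zser" where "1 = zmon 0 1"

lift_definition plus_zser :: "'a zser \<Rightarrow> 'a zser \<Rightarrow> 'a zser" is "\<lambda>f g c. f c + g c"
proof -
  fix f g :: "(nat \<Rightarrow>\<^sub>0 int) \<Rightarrow> 'a"
  assume "\<exists>N d. \<forall>a. f a \<noteq> 0 \<longrightarrow> exp_bounded N d a" "\<exists>N d. \<forall>a. g a \<noteq> 0 \<longrightarrow> exp_bounded N d a"
  then obtain N d N' d' where b: "\<And>a. f a \<noteq> 0 \<Longrightarrow> exp_bounded N d a"
    "\<And>a. g a \<noteq> 0 \<Longrightarrow> exp_bounded N' d' a" by auto
  show "\<exists>N d. \<forall>a. f a + g a \<noteq> 0 \<longrightarrow> exp_bounded N d a"
  proof (intro exI allI impI)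
    fix a assume "f a + g a \<noteq> 0"
    then have "f a \<noteq> 0 \<or> g a \<noteq> 0" by auto
    then show "exp_bounded (max N N') (max d d') a"
      by (auto intro: exp_bounded_mono dest!: b)
  qed
qed

lift_definition uminus_zser :: "'a zser \<Rightarrow> 'a zser" is "\<lambda>f c. - f c" by simp

definition minus_zser :: "'a zser \<Rightarrow> 'a zser \<Rightarrow> 'a zser" where "minus_zser f g = f + - g"

definition times_zser :: "'a zser \<Rightarrow> 'a zser \<Rightarrow> 'a zser" where "times_zser = zser_mult"

lemma zser_mult_distrib:
  "zser_mult (f + g) h = zser_mult f h + zser_mult g (h :: 'a zser)"
proof (rule zser_eqI)
  fix c :: "nat \<Rightarrow>\<^sub>0 int"
  have "zcoeff (zser_mult (f + g) h) c =
      Sum_any (\<lambda>a. zcoeff f a * zcoeff h (c - a) + zcoeff g a * zcoeff h (c - a))"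
    unfolding zser_mult.rep_eq by (rule Sum_any.cong) (simp only: plus_zser.rep_eq distrib_right)
  also have "\<dots> = Sum_any (\<lambda>a. zcoeff f a * zcoeff h (c - a)) + Sum_any (\<lambda>a. zcoeff g a * zcoeff h (c - a))"
    by (rule Sum_any.distrib[OF finite_zser_conv finite_zser_conv])
  also have "\<dots> = zcoeff (zser_mult f h + zser_mult g h) c"
    by (simp only: plus_zser.rep_eq zser_mult.rep_eq)
  finally show "zcoeff (zser_mult (f + g) h) c = zcoeff (zser_mult f h + zser_mult g h) c" .
qed

lemma zcoeff_zero [simp]: "zcoeff 0 c = (0 :: 'a)"
  by (simp add: zero_zser_def zmon.rep_eq)

lemma zcoeff_one: "zcoeff 1 c = (if c = 0 then 1 else 0 :: 'a)"
  by (simp add: one_zser_def zmon.rep_eq)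

instance
proof
  fix f g h :: "'a zser"
  show "f * g * h = f * (g * h)" by (simp add: times_zser_def zser_mult_assoc)
  show "f * g = g * f" by (simp add: times_zser_def zser_mult_commute)
  show "1 * f = f" by (simp add: times_zser_def one_zser_def zser_mult_one)
  show "(f + g) * h = f * h + g * h" by (simp add: times_zser_def zser_mult_distrib)
  show "f + g + h = f + (g + h)" by (rule zser_eqI) (simp add: plus_zser.rep_eq add.assoc)
  show "f + g = g + f" by (rule zser_eqI) (simp add: plus_zser.rep_eq add.commute)
  show "0 + f = f" by (rule zser_eqI) (simp add: plus_zser.rep_eq)
  show "- f + f = 0" by (rule zser_eqI) (simp add: plus_zser.rep_eq uminus_zser.rep_eq)
  show "f - g = f + - g" by (rule minus_zser_def)
  show "(0 :: 'a zser) \<noteq> 1"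
    using zcoeff_one[of 0] by (metis zcoeff_zero zero_neq_one)
qed

end

definition zvar_pow :: "nat \<Rightarrow> int \<Rightarrow> 'a :: comm_ring_1 zser" where
  "zvar_pow i k = zmon (Poly_Mapping.single i k) 1"

text \<open>
  Coefficientwise sum of a sequence of series. It is meaningful only if every coefficient of
  the sum receives finitely many contributions and the exponents of all \<open>f n\<close> are jointly bounded.
\<close>

definition zsum :: "(nat \<Rightarrow> 'a :: comm_ring_1 zser) \<Rightarrow> 'a zser" where
  "zsum f = Abs_zser (\<lambda>c. Sum_any (\<lambda>n. zcoeff (f n) c))"

lemma zcoeff_zsum:
  assumes "\<And>n a. zcoeff (f n) a \<noteq> 0 \<Longrightarrow> exp_bounded N d a"
  shows "zcoeff (zsum f) c = Sum_any (\<lambda>n. zcoeff (f n) c)"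
  unfolding zsum_def
proof (subst Abs_zser_inverse)
  show "(\<lambda>c. Sum_any (\<lambda>n. zcoeff (f n) c)) \<in> {f. \<exists>N d. \<forall>a. f a \<noteq> 0 \<longrightarrow> exp_bounded N d a}"
    unfolding mem_Collect_eq
  proof (rule exI[of _ N], rule exI[of _ d], intro allI impI)
    fix a assume "Sum_any (\<lambda>n. zcoeff (f n) a) \<noteq> 0"
    then obtain n where "zcoeff (f n) a \<noteq> 0" by (rule Sum_any.not_neutral_obtains_not_neutral)
    then show "exp_bounded N d a" by (rule assms)
  qed
qed simp

definition zgeom :: "'a :: comm_ring_1 zser \<Rightarrow> 'a zser" where
  "zgeom E = zsum (\<lambda>n. E ^ n)"

text \<open>The field of rational functions in \<open>q\<close> (inner variable) and \<open>t\<close> (outer variable).\<close>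

type_synonym Qqt = "rat poly poly fract"

definition qq :: Qqt where "qq = Fract [:[:0, 1:]:] 1"
definition tt :: Qqt where "tt = Fract [:0, 1:] 1"

definition MM :: Qqt where "MM = (1 - tt) * (1 - qq)"

text \<open>
  Symmetric functions over \<open>\<rat>(q,t)\<close> are written as polynomials in the power sums, which are
  algebraically independent generators: the variable with index \<open>i\<close> is \<open>p\<^bsub>i+1\<^esub>\<close>.
  In particular \<open>X = p\<^sub>1 = e\<^sub>1\<close>.
\<close>

type_synonym symfun = "(nat \<Rightarrow>\<^sub>0 nat) \<Rightarrow>\<^sub>0 Qqt"

definition scal :: "Qqt \<Rightarrow> symfun" where
  "scal c = Poly_Mapping.single 0 c"

definition psum :: "nat \<Rightarrow> symfun" where
  "psum k = Poly_Mapping.single (Poly_Mapping.single (k - 1) 1) 1"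

definition XX :: symfun where "XX = psum 1"
definition e1 :: symfun where "e1 = psum 1"

definition eval_psum :: "(Qqt \<Rightarrow> 'b) \<Rightarrow> (nat \<Rightarrow> 'b) \<Rightarrow> symfun \<Rightarrow> 'b :: comm_ring_1" where
  "eval_psum \<phi> g F =
     (\<Sum>m\<in>Poly_Mapping.keys F. \<phi> (Poly_Mapping.lookup F m) * (\<Prod>i\<in>Poly_Mapping.keys m. g (Suc i) ^ Poly_Mapping.lookup m i))"

text \<open>
  The operations \<open>E \<mapsto> p\<^sub>k[E]\<close>, \<open>k \<ge> 1\<close>, raising all variables to the \<open>k\<close>-th power, on
  \<open>\<rat>[q,t]\<close>, on \<open>\<rat>(q,t)\<close>, on symmetric functions (where \<open>p\<^sub>j \<mapsto> p\<^bsub>kj\<^esub>\<close>), and on series in the \<open>z\<^sub>i\<close>.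
\<close>

definition adams_poly :: "nat \<Rightarrow> rat poly poly \<Rightarrow> rat poly poly" where
  "adams_poly k f = pcompose (map_poly (\<lambda>c. pcompose c (monom 1 k)) f) (monom 1 k)"

definition adams_Qqt :: "nat \<Rightarrow> Qqt \<Rightarrow> Qqt" where
  "adams_Qqt k x =
     (THE y. \<exists>a b. b \<noteq> 0 \<and> x = Fract a b \<and> y = Fract (adams_poly k a) (adams_poly k b))"

lemma map_poly_mult_hom:
  fixes \<phi> :: "'a :: comm_ring_1 \<Rightarrow> 'b :: comm_ring_1"
  assumes "\<phi> 0 = 0" "\<And>x y. \<phi> (x + y) = \<phi> x + \<phi> y" "\<And>x y. \<phi> (x * y) = \<phi> x * \<phi> y"
  shows "map_poly \<phi> (f * g) = map_poly \<phi> f * map_poly \<phi> g"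
proof (rule poly_eqI)
  fix n
  have s: "\<phi> (sum h A) = (\<Sum>i\<in>A. \<phi> (h i))" if "finite A" for h and A :: "nat set"
    using that by (induction A rule: finite_induct) (simp_all add: assms)
  show "coeff (map_poly \<phi> (f * g)) n = coeff (map_poly \<phi> f * map_poly \<phi> g) n"
    by (simp add: coeff_map_poly assms coeff_mult s)
qed

lemma adams_poly_mult: "adams_poly k (f * g) = adams_poly k f * adams_poly k g"
  unfolding adams_poly_def
  by (subst map_poly_mult_hom) (simp_all add: pcompose_add pcompose_mult)

lemma adams_poly_eq_0: "k > 0 \<Longrightarrow> adams_poly k f = 0 \<Longrightarrow> f = 0"
  unfolding adams_poly_def
proof (rule poly_eqI)
  fix n
  assume k: "k > 0" and "pcompose (map_poly (\<lambda>c. pcompose c (monom 1 k)) f) (monom 1 k) = 0"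
  then have "map_poly (\<lambda>c. pcompose c (monom 1 k)) f = 0"
    by (subst (asm) pcompose_eq_0_iff) (auto simp: degree_monom_eq)
  then have "pcompose (coeff f n) (monom 1 k) = 0"
    by (metis coeff_0 coeff_map_poly pcompose_0)
  then show "coeff f n = coeff 0 n"
    using k by (subst (asm) pcompose_eq_0_iff) (auto simp: degree_monom_eq)
qed

lemma adams_Qqt_Fract:
  assumes "k > 0" "b \<noteq> 0"
  shows "adams_Qqt k (Fract a b) = Fract (adams_poly k a) (adams_poly k b)"
  unfolding adams_Qqt_def
proof (rule the_equality)
  show "\<exists>a' b'. b' \<noteq> 0 \<and> Fract a b = Fract a' b' \<and>
     Fract (adams_poly k a) (adams_poly k b) = Fract (adams_poly k a') (adams_poly k b')"
    using assms by blast
next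
  fix y
  assume "\<exists>a' b'. b' \<noteq> 0 \<and> Fract a b = Fract a' b' \<and> y = Fract (adams_poly k a') (adams_poly k b')"
  then obtain a' b' where b': "b' \<noteq> 0" and eq: "Fract a b = Fract a' b'"
    and y: "y = Fract (adams_poly k a') (adams_poly k b')" by blast
  have "a * b' = a' * b" using eq b' assms by (simp add: eq_fract)
  then have "adams_poly k a * adams_poly k b' = adams_poly k a' * adams_poly k b"
    by (metis adams_poly_mult)
  moreover have "adams_poly k b \<noteq> 0" "adams_poly k b' \<noteq> 0"
    using adams_poly_eq_0 assms b' by blast+
  ultimately show "y = Fract (adams_poly k a) (adams_poly k b)"
    by (simp add: y eq_fract)
qed

definition adams_sym :: "nat \<Rightarrow> symfun \<Rightarrow> symfun" where
  "adams_sym k = eval_psum (\<lambda>c. scal (adams_Qqt k c)) (\<lambda>j. psum (k * j))"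

lemma adams_sym_0 [simp]: "adams_sym k 0 = 0"
  by (simp add: adams_sym_def eval_psum_def)

lift_definition adams :: "nat \<Rightarrow> symfun zser \<Rightarrow> symfun zser"
  is "\<lambda>k f c. if k > 0 \<and> (\<forall>i. int k dvd Poly_Mapping.lookup c i)
        then adams_sym k (f (Poly_Mapping.map (\<lambda>x. x div int k) c)) else 0"
proof -
  fix k and f :: "(nat \<Rightarrow>\<^sub>0 int) \<Rightarrow> symfun"
  assume "\<exists>N d. \<forall>a. f a \<noteq> 0 \<longrightarrow> exp_bounded N d a"
  then obtain N d where b: "\<And>a. f a \<noteq> 0 \<Longrightarrow> exp_bounded N d a" by blast
  show "\<exists>N d. \<forall>c. (if k > 0 \<and> (\<forall>i. int k dvd Poly_Mapping.lookup c i)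
        then adams_sym k (f (Poly_Mapping.map (\<lambda>x. x div int k) c)) else 0) \<noteq> 0
      \<longrightarrow> exp_bounded N d c"
  proof (intro exI allI impI)
    fix c :: "nat \<Rightarrow>\<^sub>0 int"
    let ?a = "Poly_Mapping.map (\<lambda>x. x div int k) c"
    assume "(if k > 0 \<and> (\<forall>i. int k dvd Poly_Mapping.lookup c i) then adams_sym k (f ?a) else 0) \<noteq> 0"
    then have k: "k > 0" and dvd: "\<And>i. int k dvd Poly_Mapping.lookup c i" and "f ?a \<noteq> 0"
      by (metis (no_types, lifting) adams_sym_0)+
    from b[OF this(3)] have a: "exp_bounded N d ?a" .
    have l: "Poly_Mapping.lookup c i = int k * Poly_Mapping.lookup ?a i" for i
      using dvd[of i] by (simp add: map.rep_eq when_def)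
    have "Poly_Mapping.keys c \<subseteq> Poly_Mapping.keys ?a"
      using l by (auto simp: in_keys_iff)
    moreover have "- (int k * d) \<le> exp_psum c j" for j
    proof -
      have "exp_psum c j = int k * exp_psum ?a j"
        unfolding exp_psum_def sum_distrib_left by (rule sum.cong) (simp_all add: l)
      moreover have "int k * (- d) \<le> int k * exp_psum ?a j"
        using a by (intro mult_left_mono) (auto simp: exp_bounded_def)
      ultimately show ?thesis by simp
    qed
    ultimately show "exp_bounded N (int k * d) c"
      using a by (auto simp: exp_bounded_def)
  qed
qed

text \<open>\<open>F[E]\<close>: only the power sums in \<open>F\<close> are replaced, its coefficients in \<open>\<rat>(q,t)\<close> are kept.\<close>

definition pleth :: "symfun \<Rightarrow> symfun zser \<Rightarrow> symfun zser" where
  "pleth F E = eval_psum (\<lambda>c. zmon 0 (scal c)) (\<lambda>k. adams k E) F"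

text \<open>
  \<open>\<Omega>[E] = exp (\<Sum>k\<ge>1. p\<^sub>k[E] / k)\<close>. All sums involved are meaningful for those \<open>E\<close> whose
  exponents are nonzero with nonnegative partial sums, such as \<open>-z\<^sub>i X\<close> and \<open>-(z\<^sub>i / z\<^sub>j) M\<close>, \<open>i < j\<close>.
\<close>

definition zexp :: "symfun zser \<Rightarrow> symfun zser" where
  "zexp G = zsum (\<lambda>n. zmon 0 (scal (1 / fact n)) * G ^ n)"

definition Omega :: "symfun zser \<Rightarrow> symfun zser" where
  "Omega E = zexp (zsum (\<lambda>j. zmon 0 (scal (1 / of_nat (Suc j))) * adams (Suc j) E))"

abbreviation zX :: "symfun zser" where "zX \<equiv> zmon 0 XX"
abbreviation zM :: "symfun zser" where "zM \<equiv> zmon 0 (scal MM)"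

text \<open>The variable \<open>z\<close> in the definition of \<open>D\<^sub>k\<close> is taken to be \<open>z\<^sub>1\<close>.\<close>

definition D_op :: "int \<Rightarrow> symfun \<Rightarrow> symfun" where
  "D_op k F =
     zcoeff (pleth F (zX + zM * zvar_pow 1 (- 1)) * Omega (- (zvar_pow 1 1 * zX)))
       (Poly_Mapping.single 1 k)"

definition negut_exp :: "nat \<Rightarrow> nat \<Rightarrow> nat \<Rightarrow> int" where
  "negut_exp u v i = \<lfloor>of_nat (i * v) / of_nat u :: rat\<rfloor> - \<lfloor>of_nat ((i - 1) * v) / of_nat u :: rat\<rfloor>"

definition N_op :: "nat \<Rightarrow> nat \<Rightarrow> symfun \<Rightarrow> symfun" where
  "N_op u v F =
     zcoeff
      (pleth F (zX + (\<Sum>i=1..u. zM * zvar_pow i (- 1)))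
        * (\<Prod>i=1..u. Omega (- (zvar_pow i 1 * zX)))
        * (\<Prod>i=1..u. zvar_pow i (- negut_exp u v i))
        * (\<Prod>i=1..u - 1. zgeom (zmon 0 (scal (qq * tt)) * (zvar_pow i 1 * zvar_pow (i + 1) (- 1))))
        * (\<Prod>(i, j)\<in>{(i, j). 1 \<le> i \<and> i < j \<and> j \<le> u}.
             Omega (- (zvar_pow i 1 * zvar_pow j (- 1) * zM))))
      0"

text \<open>
  The first summand \<open>(a, b)\<close> of \<open>Split(m, n)\<close>; the second one is \<open>(m - a, n - b)\<close>.
\<close>

definition split_fst :: "nat \<Rightarrow> nat \<Rightarrow> nat \<times> nat" where
  "split_fst m n =
     (if m = 1 then (1, n - 1)
      else if n = 1 then (1, 0)
      else (THE (a, b). 1 \<le> a \<and> a \<le> m - 1 \<and> 1 \<le> b \<and> b \<le> n - 1 \<and> m * b + 1 = n * a))"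

lemma split_ex1:
  fixes m n :: nat
  assumes "coprime m n" "m > 1" "n > 1"
  shows "\<exists>!(a, b). 1 \<le> a \<and> a \<le> m - 1 \<and> 1 \<le> b \<and> b \<le> n - 1 \<and> m * b + 1 = n * a"
proof -
  obtain x where x: "[n * x = 1] (mod m)"
    using cong_solve_coprime_nat[of n m] assms(1) by (auto simp: coprime_commute)
  define a where "a = x mod m"
  have am: "a < m" using assms(2) by (simp add: a_def)
  have na: "n * a mod m = 1"
    using x assms(2) by (simp add: a_def cong_def mod_mult_right_eq)
  have a0: "a > 0" using na by (cases "a = 0") auto
  define b where "b = n * a div m"
  have eq: "m * b + 1 = n * a"
    using na mult_div_mod_eq[of m "n * a"] by (simp add: b_def)
  have "m * b < m * n"
  proof -
    have "m * b < n * a" using eq by linarith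
    also have "\<dots> < n * m" using am assms(3) by simp
    finally show ?thesis by (simp add: mult.commute)
  qed
  then have bn: "b < n" by simp
  have "n * a > 1" using a0 assms(3) mult_le_mono2[of 1 a n] by linarith
  then have b0: "b > 0" using eq by (cases "b = 0") auto
  have uniq: "a' = a \<and> b' = b"
    if "1 \<le> a'" "a' \<le> m - 1" "m * b' + 1 = n * a'" for a' b'
  proof -
    have "[n * a' = n * a] (mod m)"
      unfolding eq[symmetric] that(3)[symmetric] cong_def by (metis mod_mult_self4)
    then have "[a' = a] (mod m)"
      using assms(1) by (simp add: cong_mult_lcancel_nat coprime_commute)
    then have "a' = a" using that am assms(2) by (auto simp: cong_def)
    with eq that(3) have "m * b' + 1 = m * b + 1" by metis
    with assms(2) \<open>a' = a\<close> show ?thesis by auto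
  qed
  show ?thesis
  proof (rule ex1I[of _ "(a, b)"])
    show "case (a, b) of (a, b) \<Rightarrow> 1 \<le> a \<and> a \<le> m - 1 \<and> 1 \<le> b \<and> b \<le> n - 1 \<and> m * b + 1 = n * a"
      unfolding prod.case using eq am a0 bn b0 by linarith
  next
    fix y :: "nat \<times> nat"
    assume "case y of (a, b) \<Rightarrow> 1 \<le> a \<and> a \<le> m - 1 \<and> 1 \<le> b \<and> b \<le> n - 1 \<and> m * b + 1 = n * a"
    then show "y = (a, b)" using uniq[of "fst y" "snd y"] by (simp add: case_prod_unfold prod_eq_iff)
  qed
qed

lemma split_fst_bounds:
  assumes "coprime m n" "m > 0" "n > 0" "split_fst m n = (a, b)"
  shows "a + b < m + n" "(m - a) + (n - b) < m + n"
proof -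
  have "a + b < m + n \<and> (m - a) + (n - b) < m + n"
  proof (cases "m = 1 \<or> n = 1")
    case True
    then show ?thesis using assms by (auto simp: split_fst_def split: if_splits)
  next
    case False
    then have "m > 1" "n > 1" using assms by auto
    from theI'[OF split_ex1[OF assms(1) this]] assms(4) False
    show ?thesis by (auto simp: split_fst_def)
  qed
  then show "a + b < m + n" "(m - a) + (n - b) < m + n" by auto
qed

definition op_commutator :: "(symfun \<Rightarrow> symfun) \<Rightarrow> (symfun \<Rightarrow> symfun) \<Rightarrow> symfun \<Rightarrow> symfun" where
  "op_commutator A B F = A (B F) - B (A F)"

text \<open>Only coprime arguments are meaningful; for these, \<open>n = 0\<close> forces \<open>m = 1\<close> and vice versa.\<close>

function Q_op :: "nat \<Rightarrow> nat \<Rightarrow> symfun \<Rightarrow> symfun" where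
  "Q_op m n =
     (if \<not> coprime m n then undefined
      else if n = 0 then D_op 0
      else if m = 0 then (\<lambda>F. - (e1 * F))
      else let (a, b) = split_fst m n
           in (\<lambda>F. scal (1 / MM) * op_commutator (Q_op (m - a) (n - b)) (Q_op a b) F))"
  by pat_completeness auto
termination
proof (relation "measure (\<lambda>(m, n). m + n)")
  fix m n :: nat and x a b
  assume "\<not> \<not> coprime m n" "n \<noteq> 0" "m \<noteq> 0" "x = split_fst m n" "(a, b) = x"
  then have "coprime m n" "m > 0" "n > 0" "split_fst m n = (a, b)" by auto
  from split_fst_bounds[OF this]
  show "((m - a, n - b), m, n) \<in> measure (\<lambda>(m, n). m + n)"
    "((a, b), m, n) \<in> measure (\<lambda>(m, n). m + n)" by simp_all
qed simp

declare Q_op.simps [simp del]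

end

theory Submission
  imports Defs
begin

text \<open>
  Composing the operators \<open>D\<^sub>k\<close> gives
  \<open>D\<^bsub>a\<^sub>m\<^esub> \<dots> D\<^bsub>a\<^sub>1\<^esub> F = F[X + \<Sum> M/z\<^sub>i] \<Prod> \<Omega>[-z\<^sub>i X] \<Prod>\<^bsub>i<j\<^esub> \<Omega>[-M z\<^sub>i/z\<^sub>j]\<close>
  at \<open>z\<^sub>1\<^bsup>a\<^sub>1\<^esup> \<dots> z\<^sub>m\<^bsup>a\<^sub>m\<^esup>\<close>, so that composing \<open>N\<^bsub>m,n\<^esub>\<close> with some \<open>D\<^sub>k\<close> from either side is again
  such a constant term, in one more variable. For \<open>m \<le> 4\<close> the recursion for \<open>Q\<^bsub>m,n\<^esub>\<close> only
  involves commutators \<open>[N\<^bsub>m-1,(m-1)k+1\<^esub>, D\<^sub>k]\<close> with \<open>n = mk + 1\<close> and \<open>[D\<^bsub>k+1\<^esub>, N\<^bsub>m-1,(m-1)k+m-2\<^esub>]\<close> with \<open>n = mk + m - 1\<close>.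
  Subtracting \<open>M N\<^bsub>m,n\<^esub>\<close> leaves a constant term whose numerator is a combination of the
  quadratics \<open>(1 - qx)(1 - tx)\<close> in the adjacent ratios \<open>x = z\<^sub>i/z\<^bsub>i+1\<^esub>\<close>. In each summand one denominator
  cancels, and what remains is antisymmetric in \<open>z\<^sub>i\<close> and \<open>z\<^bsub>i+1\<^esub>\<close>, hence has constant term zero.
\<close>

section \<open>Series in one monomial\<close>

text \<open>The bound m <= 4 enters because every unit modulo m is then 1 or -1. In both cases one
  summand of Split(m,n) has first entry 1, and the second entry of the other is again 1 or -1 modulo
  its first. For (5,2) the summands are (3,1) and (2,1), and neither belongs to a
  \<open>D_op\<close>. The obstacle to the antisymmetry argument is that exchanging two variables
  turns power series in z_i/z_j into series in z_j/z_i, which do not exist in this ring. Renaming is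
  therefore a relation, not an operation, and the denominator in z_i/z_j has to be cancelled as an
  identity of series before symmetry can be invoked at all. The quadratics are the denominators of
  Omega[-xM], and at x = 1 they give M = 1 - (q+t) + qt. Its numerator factor 1 - qtx cancels the
  factor 1/(1 - qtx) of N for adjacent variables; the remaining ones belong to non-adjacent
  variables and have to take part in the numerator identities.\<close>

abbreviation lk :: "('a \<Rightarrow>\<^sub>0 'b::zero) \<Rightarrow> 'a \<Rightarrow> 'b" where "lk \<equiv> Poly_Mapping.lookup"
abbreviation sg :: "'a \<Rightarrow> 'b \<Rightarrow> 'a \<Rightarrow>\<^sub>0 'b::zero" where "sg \<equiv> Poly_Mapping.single"

lemma zcoeff_times: "zcoeff (f * g) c = Sum_any (\<lambda>a. zcoeff f a * zcoeff g (c - a))"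
  by (simp add: times_zser_def zser_mult.rep_eq)

lemma zcoeff_zmon_times: "zcoeff (zmon a x * g) c = x * zcoeff g (c - a)"
proof -
  have "(\<lambda>b. zcoeff (zmon a x) b * zcoeff g (c - b)) = (\<lambda>b. if b = a then x * zcoeff g (c - b) else 0)"
    by (auto simp: fun_eq_iff zmon.rep_eq)
  then show ?thesis unfolding zcoeff_times by (simp only: Sum_any.delta)
qed

lemma zmon_mult: "zmon a x * zmon b y = zmon (a + b) (x * y)"
  by (rule zser_eqI) (auto simp: zcoeff_zmon_times zmon.rep_eq algebra_simps)

lemma zmon_0 [simp]: "zmon a 0 = 0"
  by (rule zser_eqI) (auto simp: zmon.rep_eq)

lemma zmon_0_1 [simp]: "zmon 0 1 = 1"
  by (simp add: one_zser_def)

lemma zmon_add: "zmon a (x + y) = zmon a x + zmon a y"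
  by (rule zser_eqI) (auto simp: zmon.rep_eq plus_zser.rep_eq)

lemma zmon_uminus: "zmon a (- x) = - zmon a x"
  by (rule zser_eqI) (auto simp: zmon.rep_eq uminus_zser.rep_eq)

lemma zmon_diff: "zmon a (x - y) = zmon a x - zmon a y"
  by (metis diff_conv_add_uminus zmon_add zmon_uminus)

lemma zmon_power: "zmon a x ^ n = zmon (of_nat n * a) (x ^ n)"
  by (induction n) (simp_all add: zmon_mult algebra_simps)

lemma zcoeff_diff: "zcoeff (f - g) c = zcoeff f c - zcoeff g c"
  by (simp only: minus_zser_def plus_zser.rep_eq uminus_zser.rep_eq) simp

lemma zcoeff_sum: "zcoeff (sum f A) c = (\<Sum>x\<in>A. zcoeff (f x) c)"
  by (induction A rule: infinite_finite_induct) (simp_all add: plus_zser.rep_eq)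

lemma lookup_of_nat_times: "lk (of_nat n * a) i = int n * lk (a :: nat \<Rightarrow>\<^sub>0 int) i"
  by (induction n) (simp_all add: lookup_add algebra_simps)

lemma exp_psum_of_nat_times: "exp_psum (of_nat n * a) j = int n * exp_psum a j"
  unfolding exp_psum_def lookup_of_nat_times by (rule sum_distrib_left[symmetric])

text \<open>Exponents that may be substituted for the variable of a formal power series: being
  nonzero keeps the multiples of \<open>a\<close> distinct, and nonnegative partial sums give all
  multiples one common bound.\<close>

definition upward :: "(nat \<Rightarrow>\<^sub>0 int) \<Rightarrow> bool" where
  "upward a \<longleftrightarrow> a \<noteq> 0 \<and> (\<forall>j. 0 \<le> exp_psum a j)"

lemma of_nat_times_eq_iff:
  assumes "a \<noteq> (0 :: nat \<Rightarrow>\<^sub>0 int)"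
  shows "of_nat n * a = of_nat m * a \<longleftrightarrow> n = m"
proof
  assume eq: "of_nat n * a = of_nat m * a"
  obtain i where "lk a i \<noteq> 0"
    using assms by (metis lookup_zero poly_mapping_eqI)
  with arg_cong[OF eq, of "\<lambda>c. lk c i"] show "n = m"
    by (simp add: lookup_of_nat_times)
qed simp

lemma upward_bounded:
  assumes "upward a"
  obtains N where "\<And>n. exp_bounded N 0 (of_nat n * a)"
proof -
  obtain N d where "exp_bounded N d a" using exp_bounded_single by blast
  then have "exp_bounded N 0 (of_nat n * a)" for n
    using assms unfolding exp_bounded_def upward_def
    by (auto simp: exp_psum_of_nat_times in_keys_iff lookup_of_nat_times)
  then show ?thesis by (rule that)
qed

text \<open>Substitution of the monomial z^a for the formal variable. Geometric series and
  \<open>Omega\<close> of a monomial are of this form, so identities between them can be proved for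
  ordinary power series.\<close>

definition zsub :: "(nat \<Rightarrow>\<^sub>0 int) \<Rightarrow> 'a :: comm_ring_1 fps \<Rightarrow> 'a zser" where
  "zsub a f = zsum (\<lambda>n. zmon (of_nat n * a) (fps_nth f n))"

lemma zcoeff_zsub_Sum:
  assumes "upward a"
  shows "zcoeff (zsub a f) c = Sum_any (\<lambda>n. if c = of_nat n * a then fps_nth f n else 0)"
proof -
  obtain N where N: "\<And>n. exp_bounded N 0 (of_nat n * a)"
    using upward_bounded[OF assms] by blast
  show ?thesis unfolding zsub_def
    by (subst zcoeff_zsum[of _ N 0]) (auto simp: zmon.rep_eq N split: if_splits)
qed

lemma zcoeff_zsub [simp]:
  assumes "upward a"
  shows "zcoeff (zsub a f) (of_nat n * a) = fps_nth f n"
proof -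
  have "a \<noteq> 0" using assms by (simp add: upward_def)
  then have "(\<lambda>m. if of_nat n * a = of_nat m * a then fps_nth f m else 0) =
      (\<lambda>m. if m = n then fps_nth f m else 0)"
    by (auto simp: of_nat_times_eq_iff)
  then show ?thesis using assms by (simp only: zcoeff_zsub_Sum Sum_any.delta)
qed

lemma zcoeff_zsub_eq_0:
  assumes "upward a" "\<And>n. c \<noteq> of_nat n * a"
  shows "zcoeff (zsub a f) c = 0"
  using assms by (simp add: zcoeff_zsub_Sum)

lemma zcoeff_zsub_times:
  fixes h :: "'a :: comm_ring_1 zser"
  assumes "upward a"
  shows "zcoeff (zsub a f * h) c = Sum_any (\<lambda>n. fps_nth f n * zcoeff h (c - of_nat n * a))"
    and "finite {n. fps_nth f n * zcoeff h (c - of_nat n * a) \<noteq> 0}"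
proof -
  let ?B = "{b. zcoeff (zsub a f) b * zcoeff h (c - b) \<noteq> 0}"
  let ?S = "{n. fps_nth f n * zcoeff h (c - of_nat n * a) \<noteq> 0}"
  let ?m = "\<lambda>n. of_nat n * a"
  have a0: "a \<noteq> 0" using assms by (simp add: upward_def)
  have inj: "inj_on ?m ?S" by (rule inj_onI) (simp only: of_nat_times_eq_iff[OF a0])
  have B: "?B = ?m ` ?S"
  proof (intro equalityI subsetI)
    fix b assume b: "b \<in> ?B"
    then have "zcoeff (zsub a f) b \<noteq> 0" by auto
    then obtain n where "b = ?m n" using zcoeff_zsub_eq_0[OF assms] by blast
    with b assms show "b \<in> ?m ` ?S" by auto
  qed (use assms in auto)
  have fB: "finite ?B" by (rule finite_zser_conv)
  then show fS: "finite ?S" unfolding B by (rule finite_imageD) (rule inj)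
  have "zcoeff (zsub a f * h) c = (\<Sum>b\<in>?B. zcoeff (zsub a f) b * zcoeff h (c - b))"
    unfolding zcoeff_times by (rule Sum_any.expand_set)
  also have "\<dots> = (\<Sum>n\<in>?S. fps_nth f n * zcoeff h (c - ?m n))"
    unfolding B by (subst sum.reindex[OF inj]) (simp add: assms)
  finally show "zcoeff (zsub a f * h) c = Sum_any (\<lambda>n. fps_nth f n * zcoeff h (c - ?m n))"
    by (simp add: Sum_any.expand_set)
qed

text \<open>Both sides vanish off the multiples of \<open>a\<close>, and at the k-th multiple the
  convolution only meets n <= k, which is the Cauchy product. This is what transports power series
  identities to series in the z_i.\<close>

lemma zsub_mult:
  assumes "upward a"
  shows "zsub a f * zsub a g = zsub a (f * g)"
proof (rule zser_eqI)
  fix c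
  have a0: "a \<noteq> 0" using assms by (simp add: upward_def)
  show "zcoeff (zsub a f * zsub a g) c = zcoeff (zsub a (f * g)) c"
  proof (cases "\<exists>k. c = of_nat k * a")
    case True
    then obtain k where c: "c = of_nat k * a" by blast
    have z: "zcoeff (zsub a g) (of_nat k * a - of_nat n * a) =
        (if n \<le> k then fps_nth g (k - n) else 0)" for n
    proof (cases "n \<le> k")
      case True
      then have "of_nat k * a - of_nat n * a = of_nat (k - n) * a"
        by (simp add: of_nat_diff algebra_simps)
      then show ?thesis using True assms by (simp only: zcoeff_zsub if_True)
    next
      case False
      have "of_nat k * a - of_nat n * a \<noteq> of_nat j * a" for j
      proof
        assume "of_nat k * a - of_nat n * a = of_nat j * a"
        then have "of_nat k * a = of_nat (n + j) * a" by (simp add: algebra_simps)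
        then show False using False by (simp only: of_nat_times_eq_iff[OF a0])
      qed
      with False assms show ?thesis by (simp add: zcoeff_zsub_eq_0)
    qed
    have "zcoeff (zsub a f * zsub a g) c =
        Sum_any (\<lambda>n. fps_nth f n * (if n \<le> k then fps_nth g (k - n) else 0))"
      unfolding c zcoeff_zsub_times(1)[OF assms] z ..
    also have "\<dots> = (\<Sum>n=0..k. fps_nth f n * fps_nth g (k - n))"
      by (subst Sum_any.expand_superset[of "{0..k}"]) (auto split: if_splits)
    finally show ?thesis using assms by (simp add: c fps_mult_nth)
  next
    case False
    have "zcoeff (zsub a g) (c - of_nat n * a) = 0" for n
    proof (rule zcoeff_zsub_eq_0[OF assms])
      fix j show "c - of_nat n * a \<noteq> of_nat j * a"
      proof
        assume "c - of_nat n * a = of_nat j * a"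
        then have "c = of_nat (n + j) * a" by (simp add: algebra_simps)
        with False show False by blast
      qed
    qed
    then show ?thesis using False assms by (simp add: zcoeff_zsub_times(1) zcoeff_zsub_eq_0)
  qed
qed

lemma zsub_const [simp]:
  assumes "upward a" shows "zsub a (fps_const x) = zmon 0 x"
proof (rule zser_eqI)
  fix c
  have "(\<lambda>n. if c = of_nat n * a then fps_nth (fps_const x) n else 0) =
      (\<lambda>n. if n = 0 then (if c = 0 then x else 0) else 0)" by (auto simp: fun_eq_iff)
  then show "zcoeff (zsub a (fps_const x)) c = zcoeff (zmon 0 x) c"
    using assms by (simp only: zcoeff_zsub_Sum Sum_any.delta zmon.rep_eq)
qed

lemma zsub_1 [simp]: "upward a \<Longrightarrow> zsub a 1 = 1"
  using zsub_const[of a 1] by simp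

lemma zsub_power: "upward a \<Longrightarrow> zsub a f ^ n = zsub a (f ^ n)"
  by (induction n) (simp_all add: zsub_mult)

text \<open>The index chosen by \<open>SOME\<close> depends on \<open>a\<close> and \<open>c\<close>
  only, so statements linear in \<open>f\<close> reduce to a single coefficient of
  \<open>f\<close>.\<close>

lemma zcoeff_zsub_if:
  assumes "upward a"
  shows "zcoeff (zsub a f) c =
    (if \<exists>n. c = of_nat n * a then fps_nth f (SOME n. c = of_nat n * a) else 0)"
proof (cases "\<exists>n. c = of_nat n * a")
  case True
  then have "c = of_nat (SOME n. c = of_nat n * a) * a" by (rule someI_ex)
  then have "zcoeff (zsub a f) c = fps_nth f (SOME n. c = of_nat n * a)"
    using zcoeff_zsub[OF assms, of f "SOME n. c = of_nat n * a"] by simp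
  with True show ?thesis by simp
next
  case False
  with zcoeff_zsub_eq_0[OF assms, of c f] show ?thesis by auto
qed

lemma zsub_diff: "upward a \<Longrightarrow> zsub a (f - g) = zsub a f - zsub a g"
  by (rule zser_eqI) (simp add: zcoeff_zsub_if zcoeff_diff)

lemma zsub_X:
  assumes "upward a" shows "zsub a fps_X = zmon a (1 :: 'a :: comm_ring_1)"
proof (rule zser_eqI)
  fix c
  have "(\<lambda>n. if c = of_nat n * a then fps_nth (fps_X :: 'a fps) n else 0) =
      (\<lambda>n. if n = 1 then (if c = a then 1 else 0) else 0)" by (auto simp: fun_eq_iff)
  then show "zcoeff (zsub a fps_X) c = zcoeff (zmon a (1 :: 'a)) c"
    using assms by (simp only: zcoeff_zsub_Sum Sum_any.delta zmon.rep_eq)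
qed

lemma zsum_zsub:
  assumes "upward a"
  shows "zsum (\<lambda>n. zsub a (h n)) = zsub a (Abs_fps (\<lambda>k. Sum_any (\<lambda>n. fps_nth (h n) k)))"
proof (rule zser_eqI)
  fix c
  obtain N where N: "\<And>n. exp_bounded N 0 (of_nat n * a)"
    using upward_bounded[OF assms] by blast
  have "exp_bounded N 0 c" if "zcoeff (zsub a (h n)) c \<noteq> 0" for n c
    using that N by (auto simp: zcoeff_zsub_if[OF assms] split: if_splits)
  then have "zcoeff (zsum (\<lambda>n. zsub a (h n))) c = Sum_any (\<lambda>n. zcoeff (zsub a (h n)) c)"
    by (rule zcoeff_zsum)
  then show "zcoeff (zsum (\<lambda>n. zsub a (h n))) c =
      zcoeff (zsub a (Abs_fps (\<lambda>k. Sum_any (\<lambda>n. fps_nth (h n) k)))) c"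
    by (simp add: zcoeff_zsub_if[OF assms])
qed

text \<open>The inverse of 1 - xX, written out because the coefficient ring of interest,
  \<open>symfun\<close>, is not a field.\<close>

abbreviation fps_geom :: "'a :: comm_ring_1 \<Rightarrow> 'a fps" where
  "fps_geom x \<equiv> Abs_fps (\<lambda>n. x ^ n)"

lemma fps_geom_inverse: "(1 - fps_const x * fps_X) * fps_geom x = 1"
proof (rule fps_ext)
  fix n show "fps_nth ((1 - fps_const x * fps_X) * fps_geom x) n = fps_nth 1 n"
    by (cases n) (simp_all add: left_diff_distrib mult.assoc fps_X_mult_nth)
qed

lemma zgeom_zmon: "zgeom (zmon a x) = zsub a (fps_geom x)"
  by (simp add: zgeom_def zsub_def zmon_power)

lemma zgeom_zmon_inverse:
  assumes "upward a"
  shows "(1 - zmon a x) * zgeom (zmon a x) = 1"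
proof -
  have "1 - zmon a x = zsub a (1 - fps_const x * fps_X)"
    using assms by (simp add: zsub_diff zsub_mult[symmetric] zsub_X zmon_mult)
  then show ?thesis
    by (simp add: zgeom_zmon zsub_mult[OF assms] fps_geom_inverse assms)
qed

section \<open>Exponentials\<close>

text \<open>The equation f' = hf is a recursion that determines (m+1) f_(m+1) from earlier
  coefficients, and m+1 can be cancelled. All identities between exponentials below are proved by
  comparing logarithmic derivatives in this way.\<close>

lemma fps_deriv_eq_mult_unique:
  fixes f g h :: "'a :: {idom, ring_char_0} fps"
  assumes "fps_deriv f = h * f" "fps_deriv g = h * g" "fps_nth f 0 = fps_nth g 0"
  shows "f = g"
proof (rule fps_ext)
  fix n show "fps_nth f n = fps_nth g n"
  proof (induction n rule: less_induct)
    case (less n)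
    show ?case
    proof (cases n)
      case 0
      then show ?thesis using assms(3) by simp
    next
      case (Suc m)
      have "of_nat (Suc m) * fps_nth f (Suc m) = fps_nth (h * f) m"
        by (metis assms(1) Suc_eq_plus1 fps_deriv_nth)
      also have "\<dots> = fps_nth (h * g) m"
        unfolding fps_mult_nth by (intro sum.cong refl arg_cong2[where f = "(*)"] less) (simp add: Suc)
      also have "\<dots> = of_nat (Suc m) * fps_nth g (Suc m)"
        by (metis assms(2) Suc_eq_plus1 fps_deriv_nth)
      finally show ?thesis using Suc by (simp del: of_nat_Suc)
    qed
  qed
qed

lemma scal_0 [simp]: "scal 0 = 0" by (simp add: scal_def)
lemma scal_1 [simp]: "scal 1 = 1" by (simp add: scal_def)
lemma scal_add: "scal (x + y) = scal x + scal y" by (simp add: scal_def single_add)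
lemma scal_uminus: "scal (- x) = - scal x" by (simp add: scal_def single_uminus)
lemma scal_diff: "scal (x - y) = scal x - scal y" by (simp add: scal_def single_diff)
lemma scal_mult: "scal (x * y) = scal x * scal y" by (simp add: scal_def mult_single)
lemma scal_of_nat: "scal (of_nat n) = of_nat n" by (simp add: scal_def)
lemma scal_power: "scal (x ^ n) = scal x ^ n" by (induction n) (simp_all add: scal_mult)

text \<open>The exponential series over \<open>symfun\<close>; the factor 1/n! enters through
  \<open>scal\<close>, exactly as \<open>zexp\<close> produces it.\<close>

definition sym_exp :: "symfun fps \<Rightarrow> symfun fps" where
  "sym_exp g = Abs_fps (\<lambda>k. Sum_any (\<lambda>n. fps_nth (fps_const (scal (1 / fact n)) * g ^ n) k))"

text \<open>Without constant term, g^n starts in degree n, so a truncated exponential already has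
  the right low coefficients.\<close>

lemma sym_exp_nth:
  assumes "fps_nth g 0 = 0" "k \<le> N"
  shows "fps_nth (sym_exp g) k = fps_nth (\<Sum>n\<le>N. fps_const (scal (1 / fact n)) * g ^ n) k"
proof -
  have "fps_nth (g ^ n) k = 0" if "k < n" for n
    using startsby_zero_power_prefix[OF assms(1), of n] that by blast
  then have "{n. fps_nth (fps_const (scal (1 / fact n)) * g ^ n) k \<noteq> 0} \<subseteq> {..N}"
    using assms(2) by (auto simp: not_le[symmetric]) (meson le_trans linear)
  then show ?thesis unfolding sym_exp_def fps_nth_Abs_fps fps_sum_nth
    by (intro Sum_any.expand_superset) auto
qed

lemma sym_exp_0:
  assumes "fps_nth g 0 = 0" shows "fps_nth (sym_exp g) 0 = 1"
  by (simp add: sym_exp_nth[OF assms, of 0 0])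

text \<open>The derivative of the sum up to n = k+1 is exactly g' times the sum up to n = k, and
  both truncations are long enough for the k-th coefficient.\<close>

lemma fps_deriv_sym_exp:
  assumes "fps_nth g 0 = 0"
  shows "fps_deriv (sym_exp g) = fps_deriv g * sym_exp g"
proof (rule fps_ext)
  fix k
  let ?S = "\<lambda>N. \<Sum>n\<le>N. fps_const (scal (1 / fact n)) * g ^ n"
  have "fps_deriv (?S (Suc k)) = (\<Sum>n\<le>Suc k. fps_const (scal (1 / fact n)) * (of_nat n * fps_deriv g * g ^ (n - 1)))"
    by (simp only: fps_deriv_sum fps_deriv_mult_const_left fps_deriv_power')
  also have "\<dots> = (\<Sum>n\<le>k. fps_const (scal (1 / fact (Suc n))) * (of_nat (Suc n) * fps_deriv g * g ^ n))"
    by (subst sum.atMost_Suc_shift) simp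
  also have "\<dots> = (\<Sum>n\<le>k. fps_deriv g * (fps_const (scal (1 / fact n)) * g ^ n))"
  proof (rule sum.cong[OF refl])
    fix n
    have "scal (1 / fact (Suc n)) * of_nat (Suc n) = scal (1 / fact n)"
      by (simp add: scal_mult[symmetric] scal_of_nat[symmetric] field_simps del: of_nat_Suc)
    then have "fps_const (scal (1 / fact (Suc n))) * of_nat (Suc n) = fps_const (scal (1 / fact n))"
      by (simp only: fps_of_nat[symmetric] fps_const_mult)
    moreover have "fps_const (scal (1 / fact (Suc n))) * (of_nat (Suc n) * fps_deriv g * g ^ n) =
        fps_deriv g * ((fps_const (scal (1 / fact (Suc n))) * of_nat (Suc n)) * g ^ n)"
      by (simp only: ac_simps)
    ultimately show "fps_const (scal (1 / fact (Suc n))) * (of_nat (Suc n) * fps_deriv g * g ^ n) =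
        fps_deriv g * (fps_const (scal (1 / fact n)) * g ^ n)"
      by (simp only:)
  qed
  finally have d: "fps_deriv (?S (Suc k)) = fps_deriv g * ?S k" by (simp add: sum_distrib_left)
  have "fps_nth (fps_deriv (sym_exp g)) k = fps_nth (fps_deriv (?S (Suc k))) k"
    by (simp only: fps_deriv_nth Suc_eq_plus1[symmetric] sym_exp_nth[OF assms order_refl])
  also have "\<dots> = fps_nth (fps_deriv g * sym_exp g) k"
    unfolding d fps_mult_nth by (intro sum.cong refl) (subst sym_exp_nth[OF assms, of _ k]; simp)
  finally show "fps_nth (fps_deriv (sym_exp g)) k = fps_nth (fps_deriv g * sym_exp g) k" .
qed

section \<open>The operations \<open>p\<^sub>k[E]\<close>\<close>

lemma adams_poly_1 [simp]: "adams_poly k 1 = 1"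
  by (simp add: adams_poly_def map_poly_pCons one_pCons pcompose_pCons)

lemma adams_poly_minus_1 [simp]: "adams_poly k (- 1) = - 1"
  by (simp add: adams_poly_def map_poly_pCons one_pCons pcompose_pCons)

lemma adams_poly_uminus: "adams_poly k (- f) = - adams_poly k f"
  using adams_poly_mult[of k "- 1" f] by simp

lemma adams_Qqt_uminus:
  assumes "k > 0" shows "adams_Qqt k (- x) = - adams_Qqt k x"
  by (cases x) (simp add: adams_Qqt_Fract assms adams_poly_uminus)

lemma Fract_power: "Fract a 1 ^ n = Fract (a ^ n) (1 :: 'a :: idom)"
  by (induction n) (simp_all add: One_fract_def)

lemma adams_Qqt_1 [simp]: "k > 0 \<Longrightarrow> adams_Qqt k 1 = 1"
  by (simp add: One_fract_def adams_Qqt_Fract)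

lemma adams_Qqt_MM:
  assumes "k > 0"
  shows "adams_Qqt k MM = (1 - tt ^ k) * (1 - qq ^ k)"
proof -
  let ?t = "[:0, 1:] :: rat poly poly" and ?q = "[:[:0, 1:]:] :: rat poly poly"
  have "smult [:- 1:] f = - f" for f :: "rat poly poly"
    by (metis minus_pCons minus_zero one_pCons smult_1_left smult_minus_left)
  then have "adams_poly k (1 - ?t) = 1 - ?t ^ k"
    by (simp add: adams_poly_def map_poly_pCons pcompose_pCons monom_altdef one_pCons)
  moreover have "adams_poly k (1 - ?q) = 1 - ?q ^ k"
    by (simp add: adams_poly_def map_poly_pCons pcompose_pCons monom_altdef one_pCons poly_const_pow)
  moreover have "MM = Fract ((1 - ?t) * (1 - ?q)) 1"
    by (simp add: MM_def qq_def tt_def One_fract_def)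
  ultimately have "adams_Qqt k MM = Fract ((1 - ?t ^ k) * (1 - ?q ^ k)) 1"
    using assms adams_Qqt_Fract[of k 1 "(1 - ?t) * (1 - ?q)"] by (simp only: adams_poly_mult adams_poly_1)
  then show ?thesis
    by (simp add: qq_def tt_def Fract_power) (simp add: One_fract_def)
qed

lemma MM_nonzero: "MM \<noteq> 0"
  by (simp add: MM_def qq_def tt_def One_fract_def eq_fract Zero_fract_def one_pCons)

lemma eval_psum_single:
  "x \<noteq> 0 \<Longrightarrow> eval_psum \<phi> g (sg m x) = \<phi> x * (\<Prod>i\<in>Poly_Mapping.keys m. g (Suc i) ^ lk m i)"
  by (simp add: eval_psum_def)

lemma adams_sym_scal: "k > 0 \<Longrightarrow> x \<noteq> 0 \<Longrightarrow> adams_sym k (scal x) = scal (adams_Qqt k x)"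
  unfolding adams_sym_def scal_def by (subst eval_psum_single) (simp_all add: scal_def)

lemma adams_sym_XX: "k > 0 \<Longrightarrow> adams_sym k XX = psum k"
  unfolding adams_sym_def XX_def by (subst (2) psum_def, subst eval_psum_single) simp_all

lemma adams_sym_minus_XX: "k > 0 \<Longrightarrow> adams_sym k (- XX) = - psum k"
  unfolding adams_sym_def XX_def
  by (subst (2) psum_def, subst single_uminus[symmetric], subst eval_psum_single)
     (simp_all add: adams_Qqt_uminus scal_uminus)

lemma adams_sym_MM: "k > 0 \<Longrightarrow> adams_sym k (scal MM) = scal ((1 - tt ^ k) * (1 - qq ^ k))"
  by (simp add: adams_sym_scal MM_nonzero adams_Qqt_MM)

lemma adams_sym_minus_MM: "k > 0 \<Longrightarrow> adams_sym k (- scal MM) = - scal ((1 - tt ^ k) * (1 - qq ^ k))"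
  by (simp add: scal_uminus[symmetric] adams_sym_scal MM_nonzero adams_Qqt_uminus adams_Qqt_MM)

text \<open>The right side is the test by which \<open>adams\<close> recognizes exponents coming
  from \<open>a\<close> when all variables are raised to the k-th power.\<close>

lemma of_nat_times_eq_conv:
  fixes a c :: "nat \<Rightarrow>\<^sub>0 int"
  assumes "k > 0"
  shows "c = of_nat k * a \<longleftrightarrow>
    (\<forall>i. int k dvd lk c i) \<and> Poly_Mapping.map (\<lambda>x. x div int k) c = a"
proof
  assume c: "c = of_nat k * a"
  show "(\<forall>i. int k dvd lk c i) \<and> Poly_Mapping.map (\<lambda>x. x div int k) c = a"
    using assms by (auto simp: c lookup_of_nat_times map.rep_eq when_def intro!: poly_mapping_eqI)
next
  assume r: "(\<forall>i. int k dvd lk c i) \<and> Poly_Mapping.map (\<lambda>x. x div int k) c = a"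
  show "c = of_nat k * a"
  proof (rule poly_mapping_eqI)
    fix i show "lk c i = lk (of_nat k * a) i"
      using r by (auto simp: lookup_of_nat_times map.rep_eq when_def)
  qed
qed

lemma adams_zmon:
  assumes "k > 0"
  shows "adams k (zmon a x) = zmon (of_nat k * a) (adams_sym k x)"
  by (rule zser_eqI) (auto simp: adams.rep_eq zmon.rep_eq of_nat_times_eq_conv[OF assms] assms)

text \<open>Since p_k[x z^a] = p_k[x] z^(ka), the logarithm and its exponential both stay in the
  image of \<open>zsub a\<close>.\<close>

lemma Omega_zmon:
  assumes "upward a"
  shows "Omega (zmon a x) =
    zsub a (sym_exp (Abs_fps (\<lambda>n. if n = 0 then 0 else scal (1 / of_nat n) * adams_sym n x)))"
    (is "_ = zsub a (sym_exp ?L)")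
proof -
  have "zmon 0 (scal (1 / of_nat (Suc j))) * adams (Suc j) (zmon a x) =
      zsub a (fps_const (scal (1 / of_nat (Suc j)) * adams_sym (Suc j) x) * fps_X ^ Suc j)" for j
    by (simp add: adams_zmon zmon_mult zsub_mult[OF assms, symmetric] zsub_power[OF assms, symmetric]
        zsub_X assms zmon_power del: of_nat_Suc power_Suc)
  then have "zsum (\<lambda>j. zmon 0 (scal (1 / of_nat (Suc j))) * adams (Suc j) (zmon a x)) =
      zsub a (Abs_fps (\<lambda>k. Sum_any (\<lambda>j. fps_nth
        (fps_const (scal (1 / of_nat (Suc j)) * adams_sym (Suc j) x) * fps_X ^ Suc j) k)))"
    by (simp only: zsum_zsub[OF assms])
  also have "Abs_fps (\<lambda>k. Sum_any (\<lambda>j. fps_nth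
        (fps_const (scal (1 / of_nat (Suc j)) * adams_sym (Suc j) x) * fps_X ^ Suc j) k)) = ?L"
  proof (rule fps_ext)
    fix k
    \<comment> \<open>For k = 0 the natural number k - 1 is 0 as well, which is harmless because the
      constant term of \<open>?L\<close> is 0.\<close>
    have "(\<lambda>j. fps_nth (fps_const (scal (1 / of_nat (Suc j)) * adams_sym (Suc j) x) * fps_X ^ Suc j) k) =
        (\<lambda>j. if j = k - 1 then fps_nth ?L k else 0)"
      by (cases k) (auto simp: fun_eq_iff fps_X_power_iff simp del: of_nat_Suc power_Suc)
    then show "fps_nth (Abs_fps (\<lambda>k. Sum_any (\<lambda>j. fps_nth
        (fps_const (scal (1 / of_nat (Suc j)) * adams_sym (Suc j) x) * fps_X ^ Suc j) k))) k = fps_nth ?L k"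
      by (simp only: fps_nth_Abs_fps Sum_any.delta)
  qed
  finally have "Omega (zmon a x) = zexp (zsub a ?L)"
    by (simp only: Omega_def)
  also have "\<dots> = zsum (\<lambda>n. zsub a (fps_const (scal (1 / fact n)) * ?L ^ n))"
    by (simp add: zexp_def zsub_power[OF assms] zsub_mult[OF assms, symmetric] assms)
  also have "\<dots> = zsub a (sym_exp ?L)"
    by (simp only: zsum_zsub[OF assms] sym_exp_def)
  finally show ?thesis .
qed

section \<open>\<open>\<Omega>[-zX]\<close> and \<open>\<Omega>[-zM]\<close>\<close>

text \<open>This is p_k[M] for k >= 1, as computed in \<open>adams_Qqt_MM\<close>.\<close>

definition adams_MM :: "nat \<Rightarrow> Qqt" where "adams_MM k = (1 - tt ^ k) * (1 - qq ^ k)"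

text \<open>Omega[-zX] as a power series in z; its coefficients are (-1)^n e_n.\<close>

definition OmX :: "symfun fps" where
  "OmX = sym_exp (Abs_fps (\<lambda>n. if n = 0 then 0 else scal (1 / of_nat n) * (- psum n)))"

definition OmM :: "symfun fps" where
  "OmM = sym_exp (Abs_fps (\<lambda>n. if n = 0 then 0 else scal (1 / of_nat n) * (- scal (adams_MM n))))"

lemma fps_deriv_log:
  "fps_deriv (Abs_fps (\<lambda>n. if n = 0 then 0 else scal (1 / of_nat n) * F n)) = Abs_fps (\<lambda>n. F (Suc n))"
proof (rule fps_ext)
  fix n
  have "of_nat (Suc n) * scal (1 / of_nat (Suc n)) = 1"
    by (simp add: scal_mult[symmetric] scal_of_nat[symmetric] del: of_nat_Suc)
  then show "fps_nth (fps_deriv (Abs_fps (\<lambda>n. if n = 0 then 0 else scal (1 / of_nat n) * F n))) n =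
      fps_nth (Abs_fps (\<lambda>n. F (Suc n))) n"
    by (simp add: mult.assoc[symmetric] del: of_nat_Suc)
qed

lemma OmX_0: "fps_nth OmX 0 = 1" unfolding OmX_def by (rule sym_exp_0) simp
lemma OmM_0: "fps_nth OmM 0 = 1" unfolding OmM_def by (rule sym_exp_0) simp

text \<open>Newton's identities between the e_n and the power sums, in generating function
  form.\<close>

lemma fps_deriv_OmX: "fps_deriv OmX = Abs_fps (\<lambda>n. - psum (Suc n)) * OmX"
  unfolding OmX_def by (subst fps_deriv_sym_exp) (simp_all add: fps_deriv_log)

lemma fps_deriv_OmM: "fps_deriv OmM = Abs_fps (\<lambda>n. - scal (adams_MM (Suc n))) * OmM"
  unfolding OmM_def by (subst fps_deriv_sym_exp) (simp_all add: fps_deriv_log)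

lemma fps_deriv_linear_factor:
  "fps_deriv (1 - fps_const x * fps_X) =
    Abs_fps (\<lambda>n. - (x ^ Suc n)) * (1 - fps_const (x :: 'a :: comm_ring_1) * fps_X)"
proof -
  have "Abs_fps (\<lambda>n. - (x ^ Suc n)) = - (fps_const x * fps_geom x)"
    by (rule fps_ext) simp
  then have "Abs_fps (\<lambda>n. - (x ^ Suc n)) * (1 - fps_const x * fps_X) =
      - (fps_const x * ((1 - fps_const x * fps_X) * fps_geom x))"
    by (simp add: ac_simps)
  then show ?thesis by (simp add: fps_geom_inverse)
qed

lemma fps_deriv_geom:
  "fps_deriv (fps_geom x) = Abs_fps (\<lambda>n. x ^ Suc n) * fps_geom (x :: 'a :: comm_ring_1)"
proof -
  let ?u = "1 - fps_const x * fps_X" and ?g = "fps_geom x"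
  have "fps_deriv (?u * ?g) = 0" by (simp only: fps_geom_inverse fps_deriv_1)
  then have "?u * fps_deriv ?g = fps_const x * ?g" by (simp add: algebra_simps)
  then have "(?u * ?g) * fps_deriv ?g = fps_const x * ?g * ?g" by (simp only: ac_simps)
  moreover have "Abs_fps (\<lambda>n. x ^ Suc n) = fps_const x * ?g" by (rule fps_ext) simp
  ultimately show ?thesis by (simp add: fps_geom_inverse)
qed

text \<open>From -p_n[M] = -1 - (qt)^n + q^n + t^n, the logarithmic derivative is the sum of those
  of the four factors.\<close>

lemma OmM_eq:
  "OmM = (1 - fps_X) * (1 - fps_const (scal (qq * tt)) * fps_X) *
     fps_geom (scal qq) * fps_geom (scal tt)"
proof -
  let ?f1 = "1 - fps_const 1 * fps_X :: symfun fps"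
  let ?f2 = "1 - fps_const (scal (qq * tt)) * fps_X"
  let ?h1 = "Abs_fps (\<lambda>n. - (1 ^ Suc n)) :: symfun fps"
  let ?h2 = "Abs_fps (\<lambda>n. - (scal (qq * tt) ^ Suc n))"
  let ?h3 = "Abs_fps (\<lambda>n. scal qq ^ Suc n)" and ?h4 = "Abs_fps (\<lambda>n. scal tt ^ Suc n)"
  let ?h = "Abs_fps (\<lambda>n. - scal (adams_MM (Suc n)))"
  have h: "?h = ?h1 + ?h2 + ?h3 + ?h4"
    by (rule fps_ext) (simp add: adams_MM_def scal_power[symmetric] scal_1[symmetric]
        scal_add[symmetric] scal_uminus[symmetric] scal_diff[symmetric] power_mult_distrib
        algebra_simps del: scal_1 power_Suc)
  have "OmM = ?f1 * ?f2 * fps_geom (scal qq) * fps_geom (scal tt)"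
  proof (rule fps_deriv_eq_mult_unique[OF fps_deriv_OmM])
    show "fps_deriv (?f1 * ?f2 * fps_geom (scal qq) * fps_geom (scal tt)) =
        ?h * (?f1 * ?f2 * fps_geom (scal qq) * fps_geom (scal tt))"
      unfolding fps_deriv_mult fps_deriv_linear_factor fps_deriv_geom h
      by (simp only: distrib_right distrib_left ac_simps)
  qed (simp add: OmM_0)
  then show ?thesis by simp
qed

section \<open>Ring homomorphisms out of the symmetric functions\<close>

definition rhom :: "('a :: comm_ring_1 \<Rightarrow> 'b :: comm_ring_1) \<Rightarrow> bool" where
  "rhom h \<longleftrightarrow> h 1 = 1 \<and> (\<forall>x y. h (x + y) = h x + h y) \<and> (\<forall>x y. h (x * y) = h x * h y)"

lemma rhomD:
  assumes "rhom h"
  shows "h 1 = 1" "h (x + y) = h x + h y" "h (x * y) = h x * h y" "h 0 = 0" "h (- x) = - h x"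
proof -
  show 1: "h 1 = 1" "h (x * y) = h x * h y" "h (x + y) = h x + h y" for x y
    using assms by (auto simp: rhom_def)
  from 1(3)[of 0 0] show 0: "h 0 = 0" by simp
  from 1(3)[of "- x" x] 0 show "h (- x) = - h x" by (simp add: eq_neg_iff_add_eq_0)
qed

lemma rhom_sum: "rhom h \<Longrightarrow> h (sum f A) = (\<Sum>x\<in>A. h (f x))"
  by (induction A rule: infinite_finite_induct) (simp_all add: rhomD)

lemma rhom_prod: "rhom h \<Longrightarrow> h (prod f A) = (\<Prod>x\<in>A. h (f x))"
  by (induction A rule: infinite_finite_induct) (simp_all add: rhomD)

lemma rhom_power: "rhom h \<Longrightarrow> h (x ^ n) = h x ^ n"
  by (induction n) (simp_all add: rhomD)

lemma rhom_of_nat: "rhom h \<Longrightarrow> h (of_nat n) = of_nat n"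
  by (induction n) (simp_all add: rhomD)

lemma poly_mapping_sum_single: "(\<Sum>m\<in>Poly_Mapping.keys F. sg m (lk F m)) = F"
proof (rule poly_mapping_eqI)
  fix k
  have "lk (\<Sum>m\<in>Poly_Mapping.keys F. sg m (lk F m)) k = (\<Sum>m\<in>Poly_Mapping.keys F. if m = k then lk F m else 0)"
    by (simp add: lookup_sum lookup_single when_def)
  also have "\<dots> = lk F k" by (auto simp: sum.delta' in_keys_iff)
  finally show "lk (\<Sum>m\<in>Poly_Mapping.keys F. sg m (lk F m)) k = lk F k" .
qed

section \<open>Universal property of the polynomial ring in the power sums\<close>

definition mono_eval :: "(nat \<Rightarrow> 'b :: comm_ring_1) \<Rightarrow> (nat \<Rightarrow>\<^sub>0 nat) \<Rightarrow> 'b" where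
  "mono_eval g m = (\<Prod>i\<in>Poly_Mapping.keys m. g (Suc i) ^ lk m i)"

lemma mono_eval_superset:
  "finite K \<Longrightarrow> Poly_Mapping.keys m \<subseteq> K \<Longrightarrow> mono_eval g m = (\<Prod>i\<in>K. g (Suc i) ^ lk m i)"
  unfolding mono_eval_def by (rule prod.mono_neutral_left) (auto simp: in_keys_iff)

lemma mono_eval_add: "mono_eval g (m + n) = mono_eval g m * mono_eval g n"
proof -
  let ?K = "Poly_Mapping.keys m \<union> Poly_Mapping.keys n"
  have "mono_eval g (m + n) = (\<Prod>i\<in>?K. g (Suc i) ^ lk (m + n) i)"
    by (rule mono_eval_superset) (simp_all add: keys_add)
  also have "\<dots> = mono_eval g m * mono_eval g n"
    by (simp add: mono_eval_superset[of ?K] lookup_add power_add prod.distrib)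
  finally show ?thesis .
qed

lemma eval_psum_superset:
  assumes "rhom \<phi>" "finite S" "Poly_Mapping.keys F \<subseteq> S"
  shows "eval_psum \<phi> g F = (\<Sum>m\<in>S. \<phi> (lk F m) * mono_eval g m)"
  unfolding eval_psum_def mono_eval_def
  by (rule sum.mono_neutral_left) (use assms in \<open>auto simp: in_keys_iff rhomD\<close>)

lemma eval_psum_sg:
  assumes "rhom \<phi>" shows "eval_psum \<phi> g (sg m x) = \<phi> x * mono_eval g m"
  using eval_psum_superset[OF assms, of "{m}" "sg m x" g] by (simp add: split: if_splits)

lemma eval_psum_add:
  assumes "rhom \<phi>" shows "eval_psum \<phi> g (F + G) = eval_psum \<phi> g F + eval_psum \<phi> g G"
proof -
  let ?S = "Poly_Mapping.keys F \<union> Poly_Mapping.keys G"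
  have "eval_psum \<phi> g (F + G) = (\<Sum>m\<in>?S. \<phi> (lk (F + G) m) * mono_eval g m)"
    by (rule eval_psum_superset[OF assms]) (simp_all add: keys_add)
  also have "\<dots> = eval_psum \<phi> g F + eval_psum \<phi> g G"
    by (simp add: eval_psum_superset[OF assms, of ?S] lookup_add rhomD[OF assms] distrib_right sum.distrib)
  finally show ?thesis .
qed

lemma eval_psum_sum:
  assumes "rhom \<phi>" shows "eval_psum \<phi> g (sum f A) = (\<Sum>x\<in>A. eval_psum \<phi> g (f x))"
  by (induction A rule: infinite_finite_induct)
     (simp_all add: eval_psum_add[OF assms], simp_all add: eval_psum_def)

text \<open>The existence half of the universal property: scalars may go to any ring by a
  homomorphism, and the power sums may be sent anywhere.\<close>

lemma rhom_eval_psum: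
  assumes "rhom \<phi>" shows "rhom (eval_psum \<phi> g)"
  unfolding rhom_def
proof (intro conjI allI)
  show "eval_psum \<phi> g 1 = 1"
    using eval_psum_sg[OF assms, of g 0 1] by (simp add: mono_eval_def rhomD[OF assms])
  show "eval_psum \<phi> g (F + G) = eval_psum \<phi> g F + eval_psum \<phi> g G" for F G
    by (rule eval_psum_add[OF assms])
  fix F G :: symfun
  have "F * G = (\<Sum>m\<in>Poly_Mapping.keys F. sg m (lk F m)) * (\<Sum>m\<in>Poly_Mapping.keys G. sg m (lk G m))"
    by (simp only: poly_mapping_sum_single)
  also have "\<dots> = (\<Sum>m\<in>Poly_Mapping.keys F. \<Sum>n\<in>Poly_Mapping.keys G. sg (m + n) (lk F m * lk G n))"
    by (simp add: sum_product mult_single)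
  finally have "eval_psum \<phi> g (F * G) =
      (\<Sum>m\<in>Poly_Mapping.keys F. \<Sum>n\<in>Poly_Mapping.keys G. \<phi> (lk F m * lk G n) * mono_eval g (m + n))"
    by (simp only: eval_psum_sum[OF assms] eval_psum_sg[OF assms])
  also have "\<dots> = eval_psum \<phi> g F * eval_psum \<phi> g G"
    by (simp add: eval_psum_superset[OF assms finite_keys order_refl] sum_product mono_eval_add
        rhomD[OF assms] ac_simps)
  finally show "eval_psum \<phi> g (F * G) = eval_psum \<phi> g F * eval_psum \<phi> g G" .
qed

lemma eval_psum_scal: "rhom \<phi> \<Longrightarrow> eval_psum \<phi> g (scal x) = \<phi> x"
  by (simp add: scal_def eval_psum_sg mono_eval_def)

lemma eval_psum_psum: "rhom \<phi> \<Longrightarrow> k > 0 \<Longrightarrow> eval_psum \<phi> g (psum k) = g k"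
  by (simp add: psum_def eval_psum_sg mono_eval_def rhomD)

lemma mono_eval_psum: "mono_eval psum m = sg m 1"
proof -
  have pw: "psum (Suc i) ^ n = sg (sg i n) 1" for i n
    by (induction n) (simp_all add: psum_def mult_single single_add[symmetric] ac_simps)
  have pr: "(\<Prod>i\<in>K. sg (f i) 1) = (sg (sum f K) 1 :: symfun)" for K :: "nat set" and f
    by (induction K rule: infinite_finite_induct) (simp_all add: mult_single)
  show ?thesis unfolding mono_eval_def pw pr poly_mapping_sum_single ..
qed

lemma rhom_eq_eval_psum:
  assumes "rhom h"
  shows "h F = eval_psum (\<lambda>x. h (scal x)) (\<lambda>k. h (psum k)) F"
proof -
  have "sg m x = scal x * mono_eval psum m" for m x
    by (simp add: mono_eval_psum scal_def mult_single)
  then have "F = (\<Sum>m\<in>Poly_Mapping.keys F. scal (lk F m) * mono_eval psum m)"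
    using poly_mapping_sum_single[of F] by simp
  then have "h F = h (\<Sum>m\<in>Poly_Mapping.keys F. scal (lk F m) * mono_eval psum m)"
    by simp
  also have "\<dots> = eval_psum (\<lambda>x. h (scal x)) (\<lambda>k. h (psum k)) F"
    by (simp add: rhom_sum[OF assms] rhomD[OF assms] mono_eval_def rhom_prod[OF assms]
        rhom_power[OF assms] eval_psum_def)
  finally show ?thesis .
qed

text \<open>The uniqueness half: scalars and power sums generate. Plethystic identities are thereby
  checked on p_k alone.\<close>

lemma rhom_eqI:
  assumes "rhom h" "rhom h'" "\<And>x. h (scal x) = h' (scal x)" "\<And>k. k > 0 \<Longrightarrow> h (psum k) = h' (psum k)"
  shows "h F = h' F"
  unfolding rhom_eq_eval_psum[OF assms(1), of F] rhom_eq_eval_psum[OF assms(2), of F]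
  by (simp add: assms eval_psum_def)

lemma rhom_scal: "rhom scal" by (simp add: rhom_def scal_add scal_mult)
lemma rhom_zmon: "rhom (zmon 0)" by (simp add: rhom_def zmon_add zmon_mult)
lemma rhom_pconst: "rhom (\<lambda>x. [:x:])" by (simp add: rhom_def one_pCons)
lemma rhom_comp: "rhom f \<Longrightarrow> rhom g \<Longrightarrow> rhom (\<lambda>x. f (g x))" by (simp add: rhom_def)

lemma rhom_poly_map_poly:
  assumes "rhom h" "rhom T"
  shows "rhom (\<lambda>F. poly (map_poly h (T F)) y)"
proof -
  have "map_poly h (p + q) = map_poly h p + map_poly h q" for p q
    by (rule poly_eqI) (simp add: coeff_map_poly rhomD[OF assms(1)])
  moreover have "map_poly h (p * q) = map_poly h p * map_poly h q" for p q
    by (rule map_poly_mult_hom) (simp_all add: rhomD[OF assms(1)])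
  moreover have "map_poly h 1 = 1"
    by (simp add: one_pCons map_poly_pCons rhomD[OF assms(1)])
  ultimately show ?thesis by (simp add: rhom_def rhomD[OF assms(2)])
qed

section \<open>Translation \<open>F[X + M y]\<close>\<close>

text \<open>The variable y of the polynomial stands for 1/z, so that the shift of X by M/z in
  \<open>D_op\<close> leads to finite sums.\<close>

definition translate :: "symfun \<Rightarrow> symfun poly" where
  "translate = eval_psum (\<lambda>x. [:scal x:]) (\<lambda>k. [:psum k:] + monom (scal (adams_MM k)) k)"

lemma rhom_translate: "rhom translate"
  unfolding translate_def by (intro rhom_eval_psum rhom_comp[OF rhom_pconst] rhom_scal)

lemma translate_scal: "translate (scal x) = [:scal x:]"
  unfolding translate_def by (simp add: eval_psum_scal rhom_comp[OF rhom_pconst rhom_scal])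

lemma translate_psum: "k > 0 \<Longrightarrow> translate (psum k) = [:psum k:] + monom (scal (adams_MM k)) k"
  unfolding translate_def by (simp add: eval_psum_psum rhom_comp[OF rhom_pconst rhom_scal])

text \<open>\<open>J\<close> is an arbitrary set rather than an interval, so that variables can be
  adjoined one at a time.\<close>

definition pleth_vars :: "nat set \<Rightarrow> symfun \<Rightarrow> symfun zser" where
  "pleth_vars J F = pleth F (zX + (\<Sum>i\<in>J. zM * zvar_pow i (- 1)))"

lemma single_inj_neg: "sg i (- 1 :: int) = sg j (- 1) \<longleftrightarrow> i = j"
  by (metis lookup_single_eq lookup_single_not_eq neg_equal_0_iff_equal zero_neq_one)

lemma zcoeff_X_plus_M:
  assumes "finite J"
  shows "zcoeff (zX + (\<Sum>i\<in>J. zmon (sg i (- x)) y)) c =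
    (if c = 0 then XX else 0) + (\<Sum>i\<in>J. if c = sg i (- x) then y else 0)"
  by (simp add: plus_zser.rep_eq zcoeff_sum zmon.rep_eq)

text \<open>\<open>adams\<close> acts coefficient by coefficient. The monomials 1 and 1/z_i are
  distinct, so no coefficient is a genuine sum and no additivity of \<open>adams_sym\<close> has to
  be known.\<close>

lemma adams_X_plus_M:
  assumes "finite J" "k > 0"
  shows "adams k (zX + (\<Sum>i\<in>J. zM * zvar_pow i (- 1))) =
    zmon 0 (psum k) + (\<Sum>i\<in>J. zmon (sg i (- int k)) (scal (adams_MM k)))"
proof (rule zser_eqI)
  fix c :: "nat \<Rightarrow>\<^sub>0 int"
  let ?a = "Poly_Mapping.map (\<lambda>x. x div int k) c"
  have E: "zX + (\<Sum>i\<in>J. zM * zvar_pow i (- 1)) = zX + (\<Sum>i\<in>J. zmon (sg i (- 1)) (scal MM))"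
    by (simp add: zvar_pow_def zmon_mult)
  have R: "zcoeff (zmon 0 (psum k) + (\<Sum>i\<in>J. zmon (sg i (- int k)) (scal (adams_MM k)))) c =
      (if c = 0 then psum k else 0) + (\<Sum>i\<in>J. if c = sg i (- int k) then scal (adams_MM k) else 0)"
    by (simp add: plus_zser.rep_eq zcoeff_sum zmon.rep_eq)
  have s: "of_nat k * sg i (- 1 :: int) = sg i (- int k)" for i :: nat
    by (rule poly_mapping_eqI) (simp add: lookup_of_nat_times lookup_single when_def)
  have c0: "c = 0 \<longleftrightarrow> (\<forall>i. int k dvd lk c i) \<and> ?a = 0"
    using of_nat_times_eq_conv[OF assms(2), of c 0] by simp
  have ci: "c = sg i (- int k) \<longleftrightarrow> (\<forall>i. int k dvd lk c i) \<and> ?a = sg i (- 1)" for i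
    using of_nat_times_eq_conv[OF assms(2), of c "sg i (- 1)"] by (simp add: s)
  have ne: "sg i (- 1 :: int) \<noteq> 0" for i :: nat by (metis lookup_single_eq lookup_zero zero_neq_neg_one)
  show "zcoeff (adams k (zX + (\<Sum>i\<in>J. zM * zvar_pow i (- 1)))) c =
      zcoeff (zmon 0 (psum k) + (\<Sum>i\<in>J. zmon (sg i (- int k)) (scal (adams_MM k)))) c"
  proof (cases "\<forall>i. int k dvd lk c i")
    case False
    then have "c \<noteq> 0" "\<And>i. c \<noteq> sg i (- int k)" using c0 ci by blast+
    then show ?thesis unfolding R adams.rep_eq using False by (simp only: if_False simp_thms sum.neutral_const) simp
  next
    case True
    have L: "zcoeff (adams k (zX + (\<Sum>i\<in>J. zM * zvar_pow i (- 1)))) c =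
        adams_sym k ((if ?a = 0 then XX else 0) + (\<Sum>i\<in>J. if ?a = sg i (- 1) then scal MM else 0))"
      using True assms by (simp add: adams.rep_eq E zcoeff_X_plus_M)
    have c0': "c = 0 \<longleftrightarrow> ?a = 0" and ci': "\<And>i. c = sg i (- int k) \<longleftrightarrow> ?a = sg i (- 1)"
      using True c0 ci by blast+
    \<comment> \<open>At most one of the monomials 1 and 1/z_i matches, so \<open>adams_sym\<close>
      is only evaluated at \<open>XX\<close>, \<open>scal MM\<close> or 0.\<close>
    consider "?a = 0" | i where "i \<in> J" "?a = sg i (- 1)" | "?a \<noteq> 0" "\<And>i. i \<in> J \<Longrightarrow> ?a \<noteq> sg i (- 1)"
      by blast
    then show ?thesis
    proof cases
      case 1
      then show ?thesis unfolding L R c0' ci'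
        using assms by (simp add: adams_sym_XX not_sym[OF ne])
    next
      case 2
      then show ?thesis unfolding L R c0' ci'
        using assms by (simp add: ne single_inj_neg adams_sym_MM adams_MM_def[symmetric])
    next
      case 3
      then show ?thesis unfolding L R c0' ci' by simp
    qed
  qed
qed

lemma pleth_vars_eq_eval_psum:
  assumes "finite J"
  shows "pleth_vars J = eval_psum (\<lambda>x. zmon 0 (scal x))
    (\<lambda>k. zmon 0 (psum k) + (\<Sum>i\<in>J. zmon (sg i (- int k)) (scal (adams_MM k))))"
  by (rule ext) (simp add: pleth_vars_def pleth_def eval_psum_def adams_X_plus_M assms del: of_nat_Suc)

lemma rhom_pleth_vars: "finite J \<Longrightarrow> rhom (pleth_vars J)"
  unfolding pleth_vars_eq_eval_psum by (intro rhom_eval_psum rhom_comp[OF rhom_zmon] rhom_scal)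

lemma pleth_vars_scal: "finite J \<Longrightarrow> pleth_vars J (scal x) = zmon 0 (scal x)"
  by (simp add: pleth_vars_eq_eval_psum eval_psum_scal rhom_comp[OF rhom_zmon rhom_scal])

lemma pleth_vars_psum: "finite J \<Longrightarrow> k > 0 \<Longrightarrow> pleth_vars J (psum k) =
    zmon 0 (psum k) + (\<Sum>i\<in>J. zmon (sg i (- int k)) (scal (adams_MM k)))"
  by (simp add: pleth_vars_eq_eval_psum eval_psum_psum rhom_comp[OF rhom_zmon rhom_scal])

lemma pleth_vars_empty: "pleth_vars {} F = zmon 0 F"
  by (rule rhom_eqI[OF rhom_pleth_vars rhom_zmon]) (simp_all add: pleth_vars_scal pleth_vars_psum)

lemma zvar_pow_power: "zvar_pow i k ^ n = zvar_pow i (int n * k)"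
proof -
  have "of_nat n * sg i k = sg i (int n * k)"
    by (rule poly_mapping_eqI) (simp add: lookup_of_nat_times lookup_single when_def)
  then show ?thesis by (simp add: zvar_pow_def zmon_power)
qed

text \<open>Adding M/z_i may be done first, as a translation by My, followed by
  \<open>pleth_vars J\<close> on the coefficients and y = 1/z_i. Both sides are ring homomorphisms
  in \<open>F\<close> that agree on scalars and power sums.\<close>

lemma pleth_vars_insert:
  assumes "finite J" "i \<notin> J" "degree (translate F) \<le> N"
  shows "pleth_vars (insert i J) F =
    (\<Sum>k\<le>N. pleth_vars J (coeff (translate F) k) * zvar_pow i (- int k))"
proof -
  let ?h = "\<lambda>F. poly (map_poly (pleth_vars J) (translate F)) (zvar_pow i (- 1))"
  have P: "rhom (pleth_vars J)" using assms(1) by (rule rhom_pleth_vars)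
  have p: "?h F = (\<Sum>k\<le>N. pleth_vars J (coeff (translate F) k) * zvar_pow i (- int k))"
    if "degree (translate F) \<le> N" for F N
  proof -
    have "?h F = (\<Sum>k\<le>degree (map_poly (pleth_vars J) (translate F)).
        coeff (map_poly (pleth_vars J) (translate F)) k * zvar_pow i (- 1) ^ k)"
      by (rule poly_altdef)
    also have "\<dots> = (\<Sum>k\<le>N. coeff (map_poly (pleth_vars J) (translate F)) k * zvar_pow i (- 1) ^ k)"
    proof (rule sum.mono_neutral_left)
      show "{..degree (map_poly (pleth_vars J) (translate F))} \<subseteq> {..N}"
        using map_poly_degree_leq[of "pleth_vars J" "translate F"] that rhomD(4)[OF P] by auto
    qed (auto simp: coeff_eq_0)
    finally show ?thesis by (simp add: coeff_map_poly rhomD[OF P] zvar_pow_power)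
  qed
  have "pleth_vars (insert i J) F = ?h F"
  proof (rule rhom_eqI)
    show "rhom (pleth_vars (insert i J))" using assms by (simp add: rhom_pleth_vars)
    show "rhom ?h" by (rule rhom_poly_map_poly[OF P rhom_translate])
    show "pleth_vars (insert i J) (scal x) = ?h (scal x)" for x
      using assms by (simp add: pleth_vars_scal translate_scal map_poly_pCons rhomD[OF P])
    fix k :: nat assume k: "k > 0"
    have "map_poly (pleth_vars J) ([:psum k:] + monom (scal (adams_MM k)) k) =
        [:pleth_vars J (psum k):] + monom (pleth_vars J (scal (adams_MM k))) k"
      by (rule poly_eqI) (auto simp: coeff_map_poly rhomD[OF P] coeff_pCons split: nat.splits)
    moreover have "zmon 0 x * zvar_pow i (- 1) ^ k = zmon (sg i (- int k)) x" for x :: symfun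
      by (simp add: zvar_pow_power) (simp add: zvar_pow_def zmon_mult)
    ultimately show "pleth_vars (insert i J) (psum k) = ?h (psum k)"
      using assms k by (simp add: translate_psum poly_monom pleth_vars_psum pleth_vars_scal ac_simps)
  qed
  with p[OF assms(3)] show ?thesis by simp
qed

text \<open>The coefficients of \<open>OmM\<close> do not involve X, hence plethystic substitution
  leaves them alone.\<close>

lemma OmM_scal: "\<exists>x. fps_nth OmM n = scal x"
proof -
  define S where "S f \<longleftrightarrow> (\<forall>n. fps_nth f n \<in> range scal)" for f :: "symfun fps"
  have m: "S (f * g)" if "S f" "S g" for f g
  proof -
    have "\<forall>n. \<exists>x. fps_nth f n = scal x" "\<forall>n. \<exists>x. fps_nth g n = scal x"
      using that by (auto simp: S_def image_iff)
    then obtain a b where "\<And>n. fps_nth f n = scal (a n)" "\<And>n. fps_nth g n = scal (b n)"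
      by metis
    then have "fps_nth (f * g) n = scal (\<Sum>i=0..n. a i * b (n - i))" for n
      by (simp add: fps_mult_nth rhom_sum[OF rhom_scal] scal_mult)
    then show ?thesis by (auto simp: S_def)
  qed
  have l: "S (1 - fps_const (scal x) * fps_X)" for x
  proof -
    have "fps_nth (1 - fps_const (scal x) * fps_X) n =
        scal (if n = 0 then 1 else if n = 1 then - x else 0)" for n
      by (auto simp: scal_uminus)
    then show ?thesis by (auto simp only: S_def)
  qed
  have g: "S (fps_geom (scal x))" for x by (auto simp: S_def scal_power[symmetric])
  have "S OmM" unfolding OmM_eq using l[of 1] by (auto intro!: m l g)
  then show ?thesis by (auto simp: S_def)
qed

text \<open>Omega[-z(X + My)] = Omega[-zX] Omega[-zyM], read at z^n y^k. This is where the pair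
  factors Omega[-M z_i/z_j] come from. As series in z over polynomials in y, both sides have the
  same logarithmic derivative and constant term 1.\<close>

lemma translate_OmX:
  "coeff (translate (fps_nth OmX n)) k = (if k \<le> n then fps_nth OmM k * fps_nth OmX (n - k) else 0)"
proof -
  let ?T = "Abs_fps (\<lambda>n. translate (fps_nth OmX n))"
  let ?A = "Abs_fps (\<lambda>n. [:fps_nth OmX n:])" and ?B = "Abs_fps (\<lambda>n. monom (fps_nth OmM n) n)"
  let ?a = "Abs_fps (\<lambda>n. [:- psum (Suc n):])"
  let ?b = "Abs_fps (\<lambda>n. monom (- scal (adams_MM (Suc n))) (Suc n))"
  \<comment> \<open>Newton's identities survive a ring homomorphism applied coefficientwise; this
    serves both for \<open>translate\<close> and for the embedding as constant polynomials.\<close>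
  have hom: "fps_deriv (Abs_fps (\<lambda>n. h (fps_nth OmX n))) =
      Abs_fps (\<lambda>n. h (- psum (Suc n))) * Abs_fps (\<lambda>n. h (fps_nth OmX n))"
    if h: "rhom h" for h :: "symfun \<Rightarrow> symfun poly"
  proof (rule fps_ext)
    fix n
    have "h (of_nat (Suc n) * fps_nth OmX (Suc n)) = h (\<Sum>i=0..n. - psum (Suc i) * fps_nth OmX (n - i))"
      using arg_cong[OF fps_deriv_OmX, of "\<lambda>f. h (fps_nth f n)"] by (simp only: fps_deriv_nth fps_mult_nth
          fps_nth_Abs_fps Suc_eq_plus1)
    then show "fps_nth (fps_deriv (Abs_fps (\<lambda>n. h (fps_nth OmX n)))) n =
        fps_nth (Abs_fps (\<lambda>n. h (- psum (Suc n))) * Abs_fps (\<lambda>n. h (fps_nth OmX n))) n"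
      by (simp only: rhomD(3)[OF h] rhom_of_nat[OF h] rhom_sum[OF h] fps_deriv_nth fps_mult_nth
          fps_nth_Abs_fps Suc_eq_plus1)
  qed
  \<comment> \<open>\<open>?B\<close> is \<open>OmM\<close> in the variable zy; differentiating in z
    brings out a further y, whence \<open>Suc n\<close> as the exponent in
    \<open>?b\<close>.\<close>
  have B: "fps_deriv ?B = ?b * ?B"
  proof (rule fps_ext)
    fix n
    have e: "of_nat (Suc n) * fps_nth OmM (Suc n) = (\<Sum>i=0..n. - scal (adams_MM (Suc i)) * fps_nth OmM (n - i))"
      using arg_cong[OF fps_deriv_OmM, of "\<lambda>f. fps_nth f n"] by (simp only: fps_deriv_nth fps_mult_nth
          fps_nth_Abs_fps Suc_eq_plus1)
    have "fps_nth (fps_deriv ?B) n = monom (of_nat (Suc n) * fps_nth OmM (Suc n)) (Suc n)"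
      by (simp add: of_nat_poly smult_monom del: of_nat_Suc)
    also have "\<dots> = (\<Sum>i=0..n. monom (- scal (adams_MM (Suc i)) * fps_nth OmM (n - i)) (Suc n))"
      unfolding e by (rule monom_sum)
    also have "\<dots> = fps_nth (?b * ?B) n"
      unfolding fps_mult_nth by (intro sum.cong refl) (simp add: mult_monom)
    finally show "fps_nth (fps_deriv ?B) n = fps_nth (?b * ?B) n" .
  qed
  have "?T = ?A * ?B"
  proof (rule fps_deriv_eq_mult_unique[OF hom[OF rhom_translate]])
    have "Abs_fps (\<lambda>n. translate (- psum (Suc n))) = ?a + ?b"
      by (rule fps_ext) (simp add: rhomD[OF rhom_translate] translate_psum minus_monom[symmetric])
    then show "fps_deriv (?A * ?B) = Abs_fps (\<lambda>n. translate (- psum (Suc n))) * (?A * ?B)"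
      unfolding fps_deriv_mult hom[OF rhom_pconst] B by (simp add: algebra_simps)
  qed (simp add: OmX_0 OmM_0 rhomD[OF rhom_translate] one_pCons)
  then have "translate (fps_nth OmX n) = fps_nth (?A * ?B) n"
    by (metis fps_nth_Abs_fps)
  also have "\<dots> = (\<Sum>i=0..n. smult (fps_nth OmX i) (monom (fps_nth OmM (n - i)) (n - i)))"
    by (simp add: fps_mult_nth)
  finally have "coeff (translate (fps_nth OmX n)) k =
      (\<Sum>i=0..n. if n - i = k then fps_nth OmX i * fps_nth OmM (n - i) else 0)"
    by (simp add: coeff_sum if_distrib cong: if_cong)
  also have "\<dots> = (if k \<le> n then fps_nth OmM k * fps_nth OmX (n - k) else 0)"
  proof (cases "k \<le> n")
    case True
    have "(\<Sum>i=0..n. if n - i = k then fps_nth OmX i * fps_nth OmM (n - i) else 0) =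
        (\<Sum>i=0..n. if i = n - k then fps_nth OmX i * fps_nth OmM (n - i) else 0)"
      by (rule sum.cong) (use True in auto)
    with True show ?thesis by (simp add: mult.commute)
  next
    case False
    then have "(\<Sum>i=0..n. if n - i = k then fps_nth OmX i * fps_nth OmM (n - i) else 0) = 0"
      by (intro sum.neutral) auto
    with False show ?thesis by simp
  qed
  finally show ?thesis .
qed

section \<open>The factors Omega[-z_i X] and Omega[-(z_i/z_j) M] as one-variable series\<close>

lemma exp_psum_single: "exp_psum (sg i x) j = (if i \<le> j then x else 0)"
  by (simp add: exp_psum_def lookup_single when_def)

lemma upward_single: "upward (sg i 1)"
proof -
  have "sg i (1 :: int) \<noteq> 0" by (metis lookup_single_eq lookup_zero zero_neq_one)
  then show ?thesis by (simp add: upward_def exp_psum_single)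
qed

lemma upward_ratio:
  assumes "i < j" shows "upward (sg i 1 - sg j 1)"
proof -
  have "lk (sg i 1 - sg j 1 :: nat \<Rightarrow>\<^sub>0 int) i \<noteq> lk 0 i"
    using assms by (simp add: lookup_minus lookup_single)
  then have "sg i 1 - sg j (1 :: int) \<noteq> 0" by metis
  then show ?thesis using assms by (auto simp: upward_def exp_psum_single)
qed

definition zOmX :: "nat \<Rightarrow> symfun zser" where "zOmX i = zsub (sg i 1) OmX"
definition zOmM :: "nat \<Rightarrow> nat \<Rightarrow> symfun zser" where "zOmM i j = zsub (sg i 1 - sg j 1) OmM"

lemma Omega_X: "Omega (- (zvar_pow i 1 * zX)) = zOmX i"
proof -
  have "- (zvar_pow i 1 * zX) = zmon (sg i 1) (- XX)"
    by (simp add: zvar_pow_def zmon_mult zmon_uminus)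
  moreover have "(\<lambda>n. if n = 0 then 0 else scal (1 / of_nat n) * adams_sym n (- XX)) =
      (\<lambda>n. if n = 0 then 0 else scal (1 / of_nat n) * (- psum n))"
    by (auto simp: fun_eq_iff adams_sym_minus_XX)
  ultimately show ?thesis by (simp add: Omega_zmon upward_single zOmX_def OmX_def)
qed

lemma Omega_M:
  assumes "i < j"
  shows "Omega (- (zvar_pow i 1 * zvar_pow j (- 1) * zM)) = zOmM i j"
proof -
  have "- (zvar_pow i 1 * zvar_pow j (- 1) * zM) = zmon (sg i 1 - sg j 1) (- scal MM)"
    by (simp add: zvar_pow_def zmon_mult zmon_uminus single_uminus)
  moreover have "(\<lambda>n. if n = 0 then 0 else scal (1 / of_nat n) * adams_sym n (- scal MM)) =
      (\<lambda>n. if n = 0 then 0 else scal (1 / of_nat n) * (- scal (adams_MM n)))"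
    by (auto simp: fun_eq_iff adams_sym_minus_MM adams_MM_def)
  ultimately show ?thesis by (simp add: Omega_zmon upward_ratio assms zOmM_def OmM_def)
qed

section \<open>Extracting the coefficient of a power of one variable\<close>

lift_definition slice :: "nat \<Rightarrow> int \<Rightarrow> 'a :: zero zser \<Rightarrow> 'a zser"
  is "\<lambda>i x f c. if lk c i = 0 then f (c + sg i x) else 0"
proof -
  fix i x and f :: "(nat \<Rightarrow>\<^sub>0 int) \<Rightarrow> 'a"
  assume "\<exists>N d. \<forall>a. f a \<noteq> 0 \<longrightarrow> exp_bounded N d a"
  then obtain N d where b: "\<And>a. f a \<noteq> 0 \<Longrightarrow> exp_bounded N d a" by blast
  obtain N' d' where b': "exp_bounded N' d' (sg i (- x))" using exp_bounded_single by blast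
  show "\<exists>N d. \<forall>c. (if lk c i = 0 then f (c + sg i x) else 0) \<noteq> 0 \<longrightarrow> exp_bounded N d c"
  proof (intro exI allI impI)
    fix c assume "(if lk c i = 0 then f (c + sg i x) else 0) \<noteq> 0"
    then have "exp_bounded N d (c + sg i x)" by (intro b) (auto split: if_splits)
    then have "exp_bounded (max N N') d (c + sg i x)" "exp_bounded (max N N') d' (sg i (- x))"
      using b' by (auto intro: exp_bounded_mono)
    from exp_bounded_add[OF this] show "exp_bounded (max N N') (d + d') c"
      by (simp add: single_uminus)
  qed
qed

definition no_var :: "nat \<Rightarrow> 'a :: zero zser \<Rightarrow> bool" where
  "no_var i f \<longleftrightarrow> (\<forall>c. zcoeff f c \<noteq> 0 \<longrightarrow> lk c i = 0)"

lemma no_var_0: "no_var i (0 :: 'a :: comm_ring_1 zser)" by (simp add: no_var_def)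

lemma no_var_zmon: "lk a i = 0 \<Longrightarrow> no_var i (zmon a x)"
  by (auto simp: no_var_def zmon.rep_eq split: if_splits)

lemma no_var_1: "no_var i (1 :: 'a :: comm_ring_1 zser)"
  using no_var_zmon[of 0 i "1 :: 'a"] by simp

lemma no_var_add: "no_var i f \<Longrightarrow> no_var i g \<Longrightarrow> no_var i (f + g :: 'a :: comm_ring_1 zser)"
  by (auto simp: no_var_def plus_zser.rep_eq) (metis add_0)

lemma no_var_mult:
  fixes f g :: "'a :: comm_ring_1 zser"
  assumes "no_var i f" "no_var i g" shows "no_var i (f * g)"
  unfolding no_var_def
proof (intro allI impI)
  fix c assume "zcoeff (f * g) c \<noteq> 0"
  then obtain a where "zcoeff f a * zcoeff g (c - a) \<noteq> 0"
    unfolding zcoeff_times by (rule Sum_any.not_neutral_obtains_not_neutral)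
  then have "zcoeff f a \<noteq> 0" "zcoeff g (c - a) \<noteq> 0" by auto
  then have "lk a i = 0" "lk (c - a) i = 0"
    using assms by (auto simp: no_var_def)
  then show "lk c i = 0" by (simp add: lookup_minus)
qed

lemma no_var_sum: "(\<And>x. x \<in> A \<Longrightarrow> no_var i (f x)) \<Longrightarrow> no_var i (sum f A :: 'a :: comm_ring_1 zser)"
  by (induction A rule: infinite_finite_induct) (auto intro: no_var_0 no_var_add)

lemma no_var_prod: "(\<And>x. x \<in> A \<Longrightarrow> no_var i (f x)) \<Longrightarrow> no_var i (prod f A :: 'a :: comm_ring_1 zser)"
  by (induction A rule: infinite_finite_induct) (auto intro: no_var_1 no_var_mult)

lemma no_var_power: "no_var i f \<Longrightarrow> no_var i (f ^ n :: 'a :: comm_ring_1 zser)"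
  by (induction n) (auto intro: no_var_1 no_var_mult)

lemma no_var_zsub:
  assumes "upward a" "lk a i = 0" shows "no_var i (zsub a f)"
  using assms zcoeff_zsub_eq_0[OF assms(1)] unfolding no_var_def
  by (metis lookup_of_nat_times mult_zero_right)

text \<open>A factor free of z_i is a constant for coefficient extraction in z_i.\<close>

lemma slice_mult:
  fixes f g :: "'a :: comm_ring_1 zser"
  assumes "no_var i g" shows "slice i x (f * g) = slice i x f * g"
proof (rule zser_eqI)
  fix c
  show "zcoeff (slice i x (f * g)) c = zcoeff (slice i x f * g) c"
  proof (cases "lk c i = 0")
    case True
    have g: "zcoeff g (c - b) = 0" if "lk b i \<noteq> 0" for b
      using assms that True by (auto simp: no_var_def lookup_minus)
    have "bij (\<lambda>b. b + sg i x)"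
      by (rule bijI) (auto intro!: injI surjI[of _ "\<lambda>b. b - sg i x"])
    then have "Sum_any (\<lambda>b. zcoeff f b * zcoeff g (c + sg i x - b)) =
        Sum_any (\<lambda>b. zcoeff (slice i x f) b * zcoeff g (c - b))"
      by (rule Sum_any.reindex_cong) (auto simp: fun_eq_iff slice.rep_eq g)
    with True show ?thesis by (simp add: slice.rep_eq zcoeff_times)
  next
    case False
    have "zcoeff (slice i x f) b * zcoeff g (c - b) = 0" for b
    proof (cases "lk b i = 0")
      case True
      then have "lk (c - b) i \<noteq> 0" using False by (simp add: lookup_minus)
      then have "zcoeff g (c - b) = 0" using assms by (auto simp: no_var_def)
      then show ?thesis by simp
    qed (simp add: slice.rep_eq)
    with False show ?thesis by (simp add: slice.rep_eq zcoeff_times)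
  qed
qed

lemma slice_zvar_pow:
  fixes f :: "'a :: comm_ring_1 zser"
  shows "slice i x (zvar_pow i k * f) = slice i (x - k) f"
  by (rule zser_eqI) (simp add: slice.rep_eq zvar_pow_def zcoeff_zmon_times single_diff add_diff_eq)

lemma slice_sum: "slice i x (sum f A) = (\<Sum>y\<in>A. slice i x (f y :: 'a :: comm_ring_1 zser))"
  by (rule zser_eqI) (simp add: slice.rep_eq zcoeff_sum)

lemma zcoeff_slice: "lk c i = 0 \<Longrightarrow> zcoeff f (sg i x + c) = zcoeff (slice i x f) c"
  by (simp add: slice.rep_eq add.commute)

section \<open>The operators \<open>D\<^sub>k\<close>\<close>

text \<open>Extended by 0 to negative indices, since the index n of D_n is an arbitrary integer and
  gets shifted in both directions.\<close>

definition OmXc :: "int \<Rightarrow> symfun" where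
  "OmXc n = (if n < 0 then 0 else fps_nth OmX (nat n))"

lemma coeff_translate_OmXc: "coeff (translate (OmXc n)) k = fps_nth OmM k * OmXc (n - int k)"
  by (auto simp: OmXc_def translate_OmX rhomD[OF rhom_translate] nat_diff_distrib)

lemma degree_translate_OmXc: "degree (translate (OmXc n)) \<le> nat n"
  by (rule degree_le) (unfold coeff_translate_OmXc, auto simp: OmXc_def)

lemma slice_zOmX: "slice i n (zOmX i) = zmon 0 (OmXc n)"
proof (rule zser_eqI)
  fix c
  have s: "of_nat k * sg i (1 :: int) = sg i (int k)" for k
    by (rule poly_mapping_eqI) (simp add: lookup_of_nat_times lookup_single when_def)
  have e: "c + sg i n = of_nat k * sg i 1 \<longleftrightarrow> c = 0 \<and> n = int k" if "lk c i = 0" for k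
  proof
    assume "c + sg i n = of_nat k * sg i 1"
    then have eq: "c + sg i n = sg i (int k)" by (simp only: s)
    from arg_cong[OF this, of "\<lambda>c. lk c i"] that have "n = int k" by (simp add: lookup_add)
    with eq show "c = 0 \<and> n = int k" by simp
  qed (simp add: s)
  show "zcoeff (slice i n (zOmX i)) c = zcoeff (zmon 0 (OmXc n)) c"
  proof (cases "lk c i = 0")
    case False
    then show ?thesis by (auto simp: slice.rep_eq zmon.rep_eq)
  next
    case True
    show ?thesis
    proof (cases "c = 0 \<and> n \<ge> 0")
      case c: True
      then have "c + sg i n = of_nat (nat n) * sg i 1" using e[OF True, of "nat n"] by simp
      then have "zcoeff (slice i n (zOmX i)) c = fps_nth OmX (nat n)"
        using True by (simp only: slice.rep_eq simp_thms if_True zOmX_def zcoeff_zsub[OF upward_single])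
      with c show ?thesis by (simp add: zmon.rep_eq OmXc_def)
    next
      case False
      then have "zcoeff (zOmX i) (c + sg i n) = 0"
        unfolding zOmX_def by (intro zcoeff_zsub_eq_0[OF upward_single]) (use e[OF True] in auto)
      with False True show ?thesis by (auto simp: slice.rep_eq zmon.rep_eq OmXc_def)
    qed
  qed
qed

lemma no_var_pleth_vars:
  assumes "finite J" "i \<notin> J" shows "no_var i (pleth_vars J F)"
  unfolding pleth_vars_eq_eval_psum[OF assms(1)] eval_psum_def
  by (intro no_var_sum no_var_prod no_var_mult no_var_power no_var_add no_var_zmon)
     (use assms in \<open>auto simp: lookup_single when_def\<close>)

text \<open>The product on the left is Omega[-z_i (X + sum of M/z_j)], so each coefficient in z_i is
  the corresponding coefficient of Omega[-z_i X] after the plethystic shift. Each new j is one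
  application of \<open>translate_OmX\<close>.\<close>

lemma slice_zOmX_zOmM:
  assumes "finite J" "\<And>j. j \<in> J \<Longrightarrow> i < j"
  shows "slice i n (zOmX i * (\<Prod>j\<in>J. zOmM i j)) = pleth_vars J (OmXc n)"
  using assms
proof (induction J arbitrary: n rule: finite_induct)
  case empty
  then show ?case by (simp add: slice_zOmX pleth_vars_empty)
next
  case (insert j J)
  have ij: "i < j" and iJ: "i \<notin> insert j J" using insert.prems by auto
  have up: "upward (sg i 1 - sg j 1)" using ij by (rule upward_ratio)
  let ?G = "zOmX i * (\<Prod>j\<in>J. zOmM i j)"
  have IH: "slice i n ?G = pleth_vars J (OmXc n)" for n using insert by blast
  have P: "rhom (pleth_vars J)" using insert(1) by (rule rhom_pleth_vars)
  show ?case
  proof (rule zser_eqI)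
    fix c
    show "zcoeff (slice i n (zOmX i * (\<Prod>j\<in>insert j J. zOmM i j))) c =
        zcoeff (pleth_vars (insert j J) (OmXc n)) c"
    proof (cases "lk c i = 0")
      case False
      have "no_var i (pleth_vars (insert j J) (OmXc n))"
        using insert(1) iJ by (intro no_var_pleth_vars) auto
      with False show ?thesis by (auto simp: no_var_def slice.rep_eq)
    next
      case True
      have s: "of_nat k * sg i (1 :: int) = sg i (int k)" for k i :: nat
        by (rule poly_mapping_eqI) (simp add: lookup_of_nat_times lookup_single when_def)
      have G: "zcoeff ?G (c + sg i n - of_nat k * (sg i 1 - sg j 1)) =
          zcoeff (pleth_vars J (OmXc (n - int k))) (c + sg j (int k))" for k
      proof -
        have "c + sg i n - of_nat k * (sg i 1 - sg j 1) = sg i (n - int k) + (c + sg j (int k))"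
          by (simp add: right_diff_distrib s single_diff algebra_simps)
        moreover have "lk (c + sg j (int k)) i = 0"
          using True ij by (simp add: lookup_add lookup_single)
        ultimately show ?thesis by (simp only: zcoeff_slice IH)
      qed
      have "zcoeff (slice i n (zOmX i * (\<Prod>j\<in>insert j J. zOmM i j))) c =
          zcoeff (zOmM i j * ?G) (c + sg i n)"
        using True insert(1,2) by (simp add: slice.rep_eq ac_simps)
      also have "\<dots> = Sum_any (\<lambda>k. fps_nth OmM k * zcoeff (pleth_vars J (OmXc (n - int k))) (c + sg j (int k)))"
        by (subst zOmM_def) (simp only: zcoeff_zsub_times(1)[OF up] G)
      \<comment> \<open>Beyond k = \<open>nat n\<close> the index n - k is negative and
        \<open>OmXc\<close> vanishes; for negative n the one remaining term is 0 too.\<close>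
      also have "\<dots> = (\<Sum>k\<le>nat n. fps_nth OmM k * zcoeff (pleth_vars J (OmXc (n - int k))) (c + sg j (int k)))"
        by (rule Sum_any.expand_superset) (auto simp: OmXc_def rhomD[OF P] split: if_splits)
      also have "\<dots> = zcoeff (pleth_vars (insert j J) (OmXc n)) c"
      proof -
        have "pleth_vars (insert j J) (OmXc n) =
            (\<Sum>k\<le>nat n. pleth_vars J (fps_nth OmM k * OmXc (n - int k)) * zvar_pow j (- int k))"
          unfolding pleth_vars_insert[OF insert(1,2) degree_translate_OmXc] coeff_translate_OmXc ..
        moreover have "pleth_vars J (fps_nth OmM k) = zmon 0 (fps_nth OmM k)" for k
          using OmM_scal[of k] insert(1) by (auto simp: pleth_vars_scal)
        moreover have "zmon (sg j (- int k)) (fps_nth OmM k) =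
            zmon 0 (fps_nth OmM k) * zvar_pow j (- int k)" for k
          by (simp add: zvar_pow_def zmon_mult)
        ultimately have "pleth_vars (insert j J) (OmXc n) = (\<Sum>k\<le>nat n.
            zmon (sg j (- int k)) (fps_nth OmM k) * pleth_vars J (OmXc (n - int k)))"
          by (simp only: rhomD(3)[OF P] ac_simps)
        then show ?thesis by (simp add: zcoeff_sum zcoeff_zmon_times single_uminus)
      qed
      finally show ?thesis .
    qed
  qed
qed

definition Psi :: "nat set \<Rightarrow> symfun \<Rightarrow> symfun zser" where
  "Psi J F = pleth_vars J F * (\<Prod>i\<in>J. zOmX i)"

text \<open>The explicit form of D_n: y^k in F[X + My] stands for z^(-k), so its coefficient meets
  that of z^(n+k) in Omega[-zX].\<close>

definition D_sum :: "int \<Rightarrow> symfun \<Rightarrow> symfun" where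
  "D_sum n F = (\<Sum>k\<le>degree (translate F). coeff (translate F) k * OmXc (n + int k))"

text \<open>The composition rule for one variable: after expanding F[X + M/z_i] in 1/z_i, everything
  that is left is \<open>pleth_vars J\<close> applied to the terms of D_n F, and
  \<open>pleth_vars J\<close> is a ring homomorphism.\<close>

lemma slice_Psi:
  assumes "finite J" "\<And>j. j \<in> J \<Longrightarrow> i < j"
  shows "slice i n (Psi (insert i J) F * (\<Prod>j\<in>J. zOmM i j)) = Psi J (D_sum n F)"
proof -
  have iJ: "i \<notin> J" using assms(2) by blast
  let ?G = "zOmX i * (\<Prod>j\<in>J. zOmM i j)" and ?O = "\<Prod>j\<in>J. zOmX j"
  let ?d = "degree (translate F)" and ?c = "coeff (translate F)"
  have P: "rhom (pleth_vars J)" using assms(1) by (rule rhom_pleth_vars)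
  have nO: "no_var i ?O" unfolding zOmX_def
    by (intro no_var_prod no_var_zsub upward_single) (use iJ in \<open>auto simp: lookup_single when_def\<close>)
  have n: "no_var i (pleth_vars J (?c k) * ?O)" for k
    by (intro no_var_mult nO no_var_pleth_vars assms(1) iJ)
  have "Psi (insert i J) F * (\<Prod>j\<in>J. zOmM i j) =
      (\<Sum>k\<le>?d. zvar_pow i (- int k) * (?G * (pleth_vars J (?c k) * ?O)))"
    unfolding Psi_def pleth_vars_insert[OF assms(1) iJ order_refl]
    using assms(1) iJ by (simp add: sum_distrib_left sum_distrib_right ac_simps)
  then have "slice i n (Psi (insert i J) F * (\<Prod>j\<in>J. zOmM i j)) =
      (\<Sum>k\<le>?d. slice i (n + int k) ?G * (pleth_vars J (?c k) * ?O))"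
    by (simp only: slice_sum slice_zvar_pow slice_mult[OF n] diff_minus_eq_add)
  also have "\<dots> = Psi J (D_sum n F)"
    unfolding Psi_def D_sum_def
    by (simp add: slice_zOmX_zOmM[OF assms(1), OF assms(2)] rhom_sum[OF P] rhomD[OF P] sum_distrib_left sum_distrib_right ac_simps)
  finally show ?thesis .
qed

lemma Psi_empty: "Psi {} F = zmon 0 F"
  by (simp add: Psi_def pleth_vars_empty)

lemma D_op_eq_D_sum: "D_op n F = D_sum n F"
proof -
  have "D_op n F = zcoeff (Psi {1} F) (sg 1 n + 0)"
    by (simp add: D_op_def Psi_def pleth_vars_def Omega_X)
  also have "\<dots> = zcoeff (slice 1 n (Psi {1} F)) 0"
    by (rule zcoeff_slice) simp
  also have "slice 1 n (Psi {1} F) = zmon 0 (D_sum n F)"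
    using slice_Psi[of "{}" 1 n F] by (simp add: Psi_empty)
  finally show ?thesis by (simp add: zmon.rep_eq)
qed

text \<open>\<open>D_sum\<close> with an arbitrary polynomial in place of
  \<open>translate F\<close>. It is linear in that polynomial, and multiplication by y raises n by
  one.\<close>

definition OmX_pairing :: "int \<Rightarrow> symfun poly \<Rightarrow> symfun" where
  "OmX_pairing n p = (\<Sum>k\<le>degree p. coeff p k * OmXc (n + int k))"

lemma OmX_pairing_superset:
  "degree p \<le> N \<Longrightarrow> OmX_pairing n p = (\<Sum>k\<le>N. coeff p k * OmXc (n + int k))"
  unfolding OmX_pairing_def by (rule sum.mono_neutral_left) (auto simp: coeff_eq_0)

lemma OmX_pairing_add: "OmX_pairing n (p + q) = OmX_pairing n p + OmX_pairing n q"
proof -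
  let ?N = "max (degree p) (degree q)"
  have "degree (p + q) \<le> ?N" by (rule degree_add_le_max)
  then show ?thesis
    by (simp add: OmX_pairing_superset[of _ ?N] distrib_right sum.distrib)
qed

lemma OmX_pairing_smult: "OmX_pairing n (smult a p) = a * OmX_pairing n p"
  using degree_smult_le[of a p]
  by (simp add: OmX_pairing_superset[of _ "degree p"] sum_distrib_left mult.assoc)

lemma OmX_pairing_pCons: "OmX_pairing n (pCons 0 p) = OmX_pairing (n + 1) p"
proof -
  have "degree (pCons 0 p) \<le> Suc (degree p)" by (rule degree_pCons_le)
  then show ?thesis
    by (subst OmX_pairing_superset[of _ "Suc (degree p)"], assumption, subst sum.atMost_Suc_shift)
       (simp add: OmX_pairing_def add_ac)
qed

lemma D_op_eq: "D_op n F = OmX_pairing n (translate F)"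
  by (simp add: D_op_eq_D_sum D_sum_def OmX_pairing_def)

lemma D_op_add: "D_op n (F + G) = D_op n F + D_op n G"
  by (simp add: D_op_eq rhomD[OF rhom_translate] OmX_pairing_add)

lemma D_op_scal: "D_op n (scal x * F) = scal x * D_op n F"
  by (simp add: D_op_eq rhomD[OF rhom_translate] translate_scal OmX_pairing_smult)

lemma D_op_0: "D_op n 0 = 0"
  using D_op_scal[of n 0 0] by simp

lemma D_op_sum: "D_op n (sum f A) = (\<Sum>x\<in>A. D_op n (f x))"
  by (induction A rule: infinite_finite_induct) (simp_all add: D_op_0 D_op_add)

text \<open>Translation sends e_1 to e_1 + My, and the y raises the index. In commutator form this
  is the recursion for Q_(1,n).\<close>

lemma D_op_e1: "D_op n (e1 * F) = e1 * D_op n F + scal MM * D_op (n + 1) F"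
proof -
  have "translate (e1 * F) = ([:psum 1:] + monom (scal MM) 1) * translate F"
    by (simp add: e1_def rhomD[OF rhom_translate] translate_psum adams_MM_def MM_def)
  also have "\<dots> = smult e1 (translate F) + pCons 0 (smult (scal MM) (translate F))"
    by (simp add: e1_def distrib_right monom_Suc monom_0 One_nat_def)
  finally show ?thesis
    by (simp add: D_op_eq OmX_pairing_add OmX_pairing_smult OmX_pairing_pCons)
qed

section \<open>Products of the operators \<open>D\<^sub>k\<close>\<close>

definition less_pairs :: "nat set \<Rightarrow> (nat \<times> nat) set" where
  "less_pairs J = {(i, j). i \<in> J \<and> j \<in> J \<and> i < j}"

definition V_kernel :: "nat set \<Rightarrow> symfun \<Rightarrow> symfun zser" where
  "V_kernel J F = Psi J F * (\<Prod>(i, j)\<in>less_pairs J. zOmM i j)"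

lemma finite_less_pairs: "finite J \<Longrightarrow> finite (less_pairs J)"
  by (rule finite_subset[of _ "J \<times> J"]) (auto simp: less_pairs_def)

text \<open>The smallest variable belongs to the operator applied first: its pair factors with the
  later variables implement the shift of X that those operators perform.\<close>

lemma slice_kernel:
  assumes "finite J" "\<And>j. j \<in> J \<Longrightarrow> i < j"
  shows "slice i n (V_kernel (insert i J) F) = V_kernel J (D_op n F)"
proof -
  let ?W = "\<Prod>(i, j)\<in>less_pairs J. zOmM i j"
  have iJ: "i \<notin> J" using assms(2) by blast
  have "less_pairs (insert i J) = Pair i ` J \<union> less_pairs J"
    using assms(2) by (force simp: less_pairs_def)
  moreover have "Pair i ` J \<inter> less_pairs J = {}"
    using iJ by (auto simp: less_pairs_def)
  ultimately have "(\<Prod>(i, j)\<in>less_pairs (insert i J). zOmM i j) = (\<Prod>j\<in>J. zOmM i j) * ?W"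
    using assms(1) by (simp add: prod.union_disjoint finite_less_pairs prod.reindex inj_on_def)
  then have "V_kernel (insert i J) F = Psi (insert i J) F * (\<Prod>j\<in>J. zOmM i j) * ?W"
    by (simp add: V_kernel_def mult.assoc)
  moreover have "no_var i ?W"
    by (rule no_var_prod)
       (use iJ in \<open>auto simp: less_pairs_def zOmM_def lookup_minus lookup_single when_def
           intro!: no_var_zsub upward_ratio\<close>)
  ultimately show ?thesis
    by (simp add: slice_mult slice_Psi[OF assms(1), OF assms(2)] V_kernel_def D_op_eq_D_sum)
qed

text \<open>The head of the list acts first, so [1,...,m] gives the composition with D_(c_m)
  outermost.\<close>

fun D_list :: "nat list \<Rightarrow> (nat \<Rightarrow>\<^sub>0 int) \<Rightarrow> symfun \<Rightarrow> symfun" where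
  "D_list [] c F = F"
| "D_list (i # is) c F = D_list is c (D_op (lk c i) F)"

lemma D_list_cong: "(\<And>i. i \<in> set is \<Longrightarrow> lk c i = lk c' i) \<Longrightarrow> D_list is c F = D_list is c' F"
  by (induction "is" arbitrary: F) simp_all

lemma D_list_snoc: "D_list (is @ [j]) c F = D_op (lk c j) (D_list is c F)"
  by (induction "is" arbitrary: F) simp_all

text \<open>Peeling off the smallest variable by \<open>slice_kernel\<close> applies one D after
  another until the kernel is the constant series \<open>F\<close>.\<close>

lemma zcoeff_kernel:
  assumes "sorted_wrt (<) is" "Poly_Mapping.keys c \<subseteq> set is"
  shows "zcoeff (V_kernel (set is) F) c = D_list is c F"
  using assms
proof (induction "is" arbitrary: c F)
  case Nil
  then show ?case by (simp add: V_kernel_def less_pairs_def Psi_empty zmon.rep_eq)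
next
  case (Cons i "is")
  have i: "\<And>j. j \<in> set is \<Longrightarrow> i < j" using Cons.prems(1) by simp
  define c' where "c' = c - sg i (lk c i)"
  have c'i: "lk c' i = 0" by (simp add: c'_def lookup_minus)
  have c'j: "lk c' j = lk c j" if "j \<noteq> i" for j using that by (simp add: c'_def lookup_minus lookup_single)
  have k: "Poly_Mapping.keys c' \<subseteq> set is"
  proof
    fix j assume "j \<in> Poly_Mapping.keys c'"
    then have "lk c' j \<noteq> 0" by (simp add: in_keys_iff)
    moreover from this have "j \<noteq> i" using c'i by auto
    ultimately show "j \<in> set is" using c'j Cons.prems(2) by (auto simp: in_keys_iff)
  qed
  have "c = sg i (lk c i) + c'" by (simp add: c'_def)
  from arg_cong[OF this, of "zcoeff (V_kernel (set (i # is)) F)"]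
  have "zcoeff (V_kernel (set (i # is)) F) c = zcoeff (slice i (lk c i) (V_kernel (insert i (set is)) F)) c'"
    by (simp only: zcoeff_slice[OF c'i] list.simps)
  also have "\<dots> = D_list is c' (D_op (lk c i) F)"
    using Cons.IH[OF _ k] Cons.prems(1) slice_kernel[of "set is" i, OF finite_set] i by simp
  also have "\<dots> = D_list is c (D_op (lk c i) F)"
  proof (rule D_list_cong)
    fix j assume "j \<in> set is"
    then have "j \<noteq> i" using i[of j] by auto
    then show "lk c' j = lk c j" by (rule c'j)
  qed
  finally show ?case by simp
qed

section \<open>Renaming variables\<close>

definition vmap :: "(nat \<Rightarrow> nat) \<Rightarrow> (nat \<Rightarrow>\<^sub>0 int) \<Rightarrow> (nat \<Rightarrow>\<^sub>0 int)" where
  "vmap \<tau> c = (\<Sum>i\<in>Poly_Mapping.keys c. sg (\<tau> i) (lk c i))"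

lemma lookup_vmap:
  assumes "inj \<tau>" shows "lk (vmap \<tau> c) (\<tau> i) = lk c i"
proof -
  have "lk (vmap \<tau> c) (\<tau> i) = (\<Sum>j\<in>Poly_Mapping.keys c. if j = i then lk c j else 0)"
    using assms by (simp add: vmap_def lookup_sum lookup_single when_def inj_eq)
  then show ?thesis by (simp add: sum.delta' in_keys_iff)
qed

lemma lookup_vmap_eq_0: "j \<notin> range \<tau> \<Longrightarrow> lk (vmap \<tau> c) j = 0"
  by (auto simp: vmap_def lookup_sum lookup_single when_def intro!: sum.neutral)

lemma vmap_eqI:
  assumes "inj \<tau>" "\<And>i. lk a (\<tau> i) = lk c i" "\<And>j. j \<notin> range \<tau> \<Longrightarrow> lk a j = 0"
  shows "vmap \<tau> c = a"
proof (rule poly_mapping_eqI)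
  fix j show "lk (vmap \<tau> c) j = lk a j"
    by (cases "j \<in> range \<tau>") (auto simp: lookup_vmap assms lookup_vmap_eq_0)
qed

lemma vmap_add: "inj \<tau> \<Longrightarrow> vmap \<tau> (a + b) = vmap \<tau> a + vmap \<tau> b"
  by (rule vmap_eqI) (simp_all add: lookup_add lookup_vmap lookup_vmap_eq_0)

lemma vmap_diff: "inj \<tau> \<Longrightarrow> vmap \<tau> (a - b) = vmap \<tau> a - vmap \<tau> b"
  by (rule vmap_eqI) (simp_all add: lookup_minus lookup_vmap lookup_vmap_eq_0)

lemma vmap_0: "vmap \<tau> 0 = 0"
  by (simp add: vmap_def)

lemma vmap_uminus: "inj \<tau> \<Longrightarrow> vmap \<tau> (- b) = - vmap \<tau> b"
  using vmap_diff[of \<tau> 0 b] by (simp add: vmap_0)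

lemma vmap_of_nat_times: "inj \<tau> \<Longrightarrow> vmap \<tau> (of_nat n * a) = of_nat n * vmap \<tau> a"
  by (rule vmap_eqI) (simp_all add: lookup_of_nat_times lookup_vmap lookup_vmap_eq_0)

lemma vmap_single: "vmap \<tau> (sg i x) = sg (\<tau> i) x"
  by (simp add: vmap_def)

lemma vmap_inj: "inj \<tau> \<Longrightarrow> inj (vmap \<tau>)"
  by (rule injI) (metis lookup_vmap poly_mapping_eqI)

lemma Sum_any_inj:
  assumes "inj h" "\<And>y. y \<notin> range h \<Longrightarrow> g y = 0"
  shows "Sum_any g = Sum_any (\<lambda>x. g (h x))"
proof -
  have s: "{y. g y \<noteq> 0} = h ` {x. g (h x) \<noteq> 0}" using assms(2) by (auto simp: image_iff) (metis rangeE)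
  show ?thesis unfolding Sum_any.expand_set s
    by (subst sum.reindex) (use assms(1) in \<open>auto intro: inj_on_subset\<close>)
qed

text \<open>A relation, because an arbitrary renaming can lead out of the admissible series. The
  second clause matters for maps that are not onto, such as \<open>Suc\<close>.\<close>

definition renamed :: "(nat \<Rightarrow> nat) \<Rightarrow> 'a :: zero zser \<Rightarrow> 'a zser \<Rightarrow> bool" where
  "renamed \<tau> f f' \<longleftrightarrow>
    (\<forall>c. zcoeff f' (vmap \<tau> c) = zcoeff f c) \<and> (\<forall>c. c \<notin> range (vmap \<tau>) \<longrightarrow> zcoeff f' c = 0)"

context
  fixes \<tau> :: "nat \<Rightarrow> nat"
  assumes inj: "inj \<tau>"
begin

lemma renamed_mult:
  fixes f g :: "'a :: comm_ring_1 zser"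
  assumes "renamed \<tau> f f'" "renamed \<tau> g g'"
  shows "renamed \<tau> (f * g) (f' * g')"
  unfolding renamed_def
proof (intro conjI allI impI)
  fix c
  have "zcoeff (f' * g') (vmap \<tau> c) =
      Sum_any (\<lambda>b. zcoeff f' (vmap \<tau> b) * zcoeff g' (vmap \<tau> c - vmap \<tau> b))"
    unfolding zcoeff_times
    by (rule Sum_any_inj[OF vmap_inj[OF inj]]) (use assms(1) in \<open>auto simp: renamed_def\<close>)
  then show "zcoeff (f' * g') (vmap \<tau> c) = zcoeff (f * g) c"
    using assms by (simp add: vmap_diff[OF inj, symmetric] renamed_def zcoeff_times)
next
  fix c assume c: "c \<notin> range (vmap \<tau>)"
  show "zcoeff (f' * g') c = 0"
  proof (rule ccontr)
    assume "zcoeff (f' * g') c \<noteq> 0"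
    then obtain a where "zcoeff f' a * zcoeff g' (c - a) \<noteq> 0"
      unfolding zcoeff_times by (rule Sum_any.not_neutral_obtains_not_neutral)
    then have "zcoeff f' a \<noteq> 0" "zcoeff g' (c - a) \<noteq> 0" by auto
    then obtain a' b' where "a = vmap \<tau> a'" "c - a = vmap \<tau> b'"
      using assms unfolding renamed_def by blast
    then have "c = vmap \<tau> (a' + b')" by (simp add: vmap_add[OF inj] algebra_simps)
    with c show False by blast
  qed
qed

lemma renamed_add:
  "renamed \<tau> f f' \<Longrightarrow> renamed \<tau> g g' \<Longrightarrow> renamed \<tau> (f + g) (f' + g' :: 'a :: comm_ring_1 zser)"
  by (simp add: renamed_def plus_zser.rep_eq)

lemma renamed_diff:
  "renamed \<tau> f f' \<Longrightarrow> renamed \<tau> g g' \<Longrightarrow> renamed \<tau> (f - g) (f' - g' :: 'a :: comm_ring_1 zser)"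
  by (simp add: renamed_def zcoeff_diff)

lemma renamed_zmon: "renamed \<tau> (zmon a x) (zmon (vmap \<tau> a) x)"
  by (auto simp: renamed_def zmon.rep_eq inj_eq[OF vmap_inj[OF inj]])

lemma renamed_zvar_pow: "renamed \<tau> (zvar_pow i k) (zvar_pow (\<tau> i) k)"
  using renamed_zmon[of "sg i k"] by (simp add: zvar_pow_def vmap_single)

lemma renamed_const: "renamed \<tau> (zmon 0 x) (zmon 0 x)"
  using renamed_zmon[of 0] by (simp add: vmap_0)

lemma renamed_1: "renamed \<tau> 1 (1 :: 'a :: comm_ring_1 zser)"
  using renamed_const[of "1 :: 'a"] by simp

lemma renamed_0: "renamed \<tau> 0 (0 :: 'a :: comm_ring_1 zser)"
  by (simp add: renamed_def)

lemma renamed_prod: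
  "(\<And>x. x \<in> A \<Longrightarrow> renamed \<tau> (f x) (g x)) \<Longrightarrow> renamed \<tau> (prod f A) (prod g A :: 'a :: comm_ring_1 zser)"
  by (induction A rule: infinite_finite_induct) (auto intro: renamed_1 renamed_mult)

lemma renamed_sum:
  "(\<And>x. x \<in> A \<Longrightarrow> renamed \<tau> (f x) (g x)) \<Longrightarrow> renamed \<tau> (sum f A) (sum g A :: 'a :: comm_ring_1 zser)"
  by (induction A rule: infinite_finite_induct) (auto intro: renamed_0 renamed_add)

lemma renamed_power: "renamed \<tau> f f' \<Longrightarrow> renamed \<tau> (f ^ n) (f' ^ n :: 'a :: comm_ring_1 zser)"
  by (induction n) (auto intro: renamed_1 renamed_mult)

text \<open>The second assumption fails when z_i and z_j are exchanged in the ratio z_i/z_j, i < j.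
  This is why the denominator in that ratio must be gone before the exchange.\<close>

lemma renamed_zsub:
  assumes "upward a" "upward (vmap \<tau> a)"
  shows "renamed \<tau> (zsub a f) (zsub (vmap \<tau> a) f)"
  unfolding renamed_def
proof (intro conjI allI impI)
  fix c
  show "zcoeff (zsub (vmap \<tau> a) f) (vmap \<tau> c) = zcoeff (zsub a f) c"
    by (simp add: zcoeff_zsub_Sum assms vmap_of_nat_times[OF inj, symmetric] inj_eq[OF vmap_inj[OF inj]])
next
  fix c assume c: "c \<notin> range (vmap \<tau>)"
  show "zcoeff (zsub (vmap \<tau> a) f) c = 0"
    by (rule zcoeff_zsub_eq_0[OF assms(2)]) (use c in \<open>auto simp: vmap_of_nat_times[OF inj, symmetric]\<close>)
qed

lemma renamed_Psi:
  assumes "finite J" shows "renamed \<tau> (Psi J F) (Psi (\<tau> ` J) F)"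
proof -
  have i: "inj_on \<tau> J" using inj by (auto intro: inj_on_subset)
  have "renamed \<tau> (pleth_vars J F) (pleth_vars (\<tau> ` J) F)"
    unfolding pleth_vars_eq_eval_psum[OF assms] pleth_vars_eq_eval_psum[OF finite_imageI[OF assms]]
      eval_psum_def sum.reindex[OF i] comp_def
    by (intro renamed_sum renamed_mult renamed_prod renamed_power renamed_add renamed_const)
       (use renamed_zmon[of "sg _ _"] in \<open>simp add: vmap_single\<close>)
  moreover have "renamed \<tau> (\<Prod>i\<in>J. zOmX i) (\<Prod>i\<in>\<tau> ` J. zOmX i)"
    unfolding prod.reindex[OF i] comp_def zOmX_def
    using renamed_zsub[OF upward_single] upward_single by (auto intro!: renamed_prod simp: vmap_single)
  ultimately show ?thesis unfolding Psi_def by (rule renamed_mult)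
qed

end

section \<open>Constant terms\<close>

text \<open>N and its compositions with one D_k all have this form with different multipliers
  \<open>A\<close>, so operators are compared through their multipliers.\<close>

definition V_op :: "nat \<Rightarrow> symfun zser \<Rightarrow> symfun \<Rightarrow> symfun" where
  "V_op m A F = zcoeff (V_kernel {1..m} F * A) 0"

text \<open>Coefficients free of X are what lets D_n pass through them; the restriction on variables
  leaves room for one more.\<close>

definition scalar_in :: "nat \<Rightarrow> symfun zser \<Rightarrow> bool" where
  "scalar_in m A \<longleftrightarrow>
    (\<forall>c. zcoeff A c \<noteq> 0 \<longrightarrow> Poly_Mapping.keys c \<subseteq> {1..m}) \<and> (\<forall>c. zcoeff A c \<in> range scal)"

lemma V_op_Sum_any: "V_op m A F = Sum_any (\<lambda>c. zcoeff A c * zcoeff (V_kernel {1..m} F) (- c))"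
  unfolding V_op_def by (subst mult.commute) (simp add: zcoeff_times)

lemma zcoeff_kernel_atLeastAtMost:
  assumes "Poly_Mapping.keys c \<subseteq> {1..m}"
  shows "zcoeff (V_kernel {1..m} F) c = D_list [1..<Suc m] c F"
proof -
  have "set [1..<Suc m] = {1..m}" by auto
  then show ?thesis using zcoeff_kernel[of "[1..<Suc m]" c F] assms by (metis strict_sorted_iff sorted_upt distinct_upt)
qed

text \<open>The operator applied last gets the largest variable z_(m+1), and its power -n selects
  the index n.\<close>

lemma D_op_V_op:
  assumes A: "scalar_in m A"
  shows "D_op n (V_op m A F) = V_op (Suc m) (A * zvar_pow (Suc m) (- n)) F"
proof -
  let ?b = "\<lambda>c. zcoeff (V_kernel {1..m} F) (- c)"
  let ?S = "{c. zcoeff A c * ?b c \<noteq> 0}"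
  \<comment> \<open>The constant term is a finite sum, which is what allows \<open>D_op\<close> to
    be applied term by term.\<close>
  have fin: "finite ?S" using finite_zser_conv[of A "V_kernel {1..m} F" 0] by simp
  have b': "zcoeff A c * zcoeff (zvar_pow (Suc m) (- n) * V_kernel {1..Suc m} F) (- c) =
      D_op n (zcoeff A c * ?b c)" for c
  proof (cases "zcoeff A c = 0")
    case True
    then show ?thesis by (simp add: D_op_0)
  next
    case False
    then have k: "Poly_Mapping.keys c \<subseteq> {1..m}" using A by (auto simp: scalar_in_def)
    have "lk c (Suc m) = 0" using k by (metis atLeastAtMost_iff in_keys_iff not_less_eq_eq order_refl subsetD)
    then have l: "lk (- c + sg (Suc m) n) (Suc m) = n" by (simp add: lookup_add lookup_minus)
    have "Poly_Mapping.keys (- c + sg (Suc m) n) \<subseteq> {1..Suc m}"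
      using k keys_add[of "- c" "sg (Suc m) n"] by (fastforce split: if_splits)
    then have "zcoeff (zvar_pow (Suc m) (- n) * V_kernel {1..Suc m} F) (- c) =
        D_list [1..<Suc (Suc m)] (- c + sg (Suc m) n) F"
      by (simp add: zvar_pow_def zcoeff_zmon_times single_uminus zcoeff_kernel_atLeastAtMost[unfolded One_nat_def] del: upt_Suc)
    also have "\<dots> = D_op n (D_list [1..<Suc m] (- c + sg (Suc m) n) F)"
      by (subst upt_Suc) (simp only: D_list_snoc l if_True le_numeral_extra Suc_leI zero_less_Suc One_nat_def)
    also have "D_list [1..<Suc m] (- c + sg (Suc m) n) F = D_list [1..<Suc m] (- c) F"
      by (rule D_list_cong) (auto simp: lookup_minus lookup_single when_def)
    also have "\<dots> = ?b c" using k by (simp add: zcoeff_kernel_atLeastAtMost[unfolded One_nat_def] del: upt_Suc)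
    finally have e: "zcoeff (zvar_pow (Suc m) (- n) * V_kernel {1..Suc m} F) (- c) = D_op n (?b c)" .
    obtain x where "zcoeff A c = scal x" using A unfolding scalar_in_def by blast
    then show ?thesis unfolding e by (simp only: D_op_scal)
  qed
  have "D_op n (V_op m A F) = (\<Sum>c\<in>?S. D_op n (zcoeff A c * ?b c))"
    unfolding V_op_Sum_any Sum_any.expand_set D_op_sum ..
  also have "\<dots> = Sum_any (\<lambda>c. zcoeff A c * zcoeff (zvar_pow (Suc m) (- n) * V_kernel {1..Suc m} F) (- c))"
    unfolding b' by (rule Sum_any.expand_superset[symmetric, OF fin]) (auto simp: D_op_0)
  also have "\<dots> = V_op (Suc m) (A * zvar_pow (Suc m) (- n)) F"
  proof -
    have "V_kernel {1..Suc m} F * (A * zvar_pow (Suc m) (- n)) = A * (zvar_pow (Suc m) (- n) * V_kernel {1..Suc m} F)"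
      by (simp only: ac_simps)
    then show ?thesis unfolding V_op_def by (simp only: zcoeff_times[of A] diff_0)
  qed
  finally show ?thesis .
qed

text \<open>The operator applied first needs the smallest variable, so all the variables of
  \<open>A\<close> move up by one.\<close>

lemma V_op_D_op:
  assumes A: "scalar_in m A" and A': "renamed Suc A A'"
  shows "V_op m A (D_op n F) = V_op (Suc m) (A' * zvar_pow 1 (- n)) F"
proof -
  have b: "zcoeff A c * zcoeff (V_kernel {1..m} (D_op n F)) (- c) =
      zcoeff A c * zcoeff (zvar_pow 1 (- n) * V_kernel {1..Suc m} F) (- vmap Suc c)" for c
  proof (cases "zcoeff A c = 0")
    case False
    then have k: "Poly_Mapping.keys c \<subseteq> {1..m}" using A by (auto simp: scalar_in_def)
    let ?c = "- vmap Suc c + sg 1 n"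
    have v: "lk (vmap Suc c) (Suc i) = lk c i" for i by (simp add: lookup_vmap)
    \<comment> \<open>Index 0 does not occur in \<open>A\<close>, so after the shift position 1 is
      free for the new variable.\<close>
    have "lk c 0 = 0" using k by (metis atLeastAtMost_iff in_keys_iff not_one_le_zero subsetD)
    then have v1: "lk (vmap Suc c) 1 = 0" using v[of 0] by simp
    have "Poly_Mapping.keys ?c \<subseteq> {1..Suc m}"
    proof
      fix j assume "j \<in> Poly_Mapping.keys ?c"
      then have j: "lk ?c j \<noteq> 0" by (simp add: in_keys_iff)
      show "j \<in> {1..Suc m}"
      proof (cases j)
        case 0
        then show ?thesis using j by (simp add: lookup_minus lookup_single lookup_vmap_eq_0)
      next
        case (Suc i)
        show ?thesis
        proof (cases "j = 1")
          case False
          then have "lk c i \<noteq> 0" using j Suc by (simp add: lookup_minus lookup_single v)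
          then show ?thesis using k Suc by (auto simp: in_keys_iff)
        qed simp
      qed
    qed
    then have "zcoeff (zvar_pow 1 (- n) * V_kernel {1..Suc m} F) (- vmap Suc c) = D_list [1..<Suc (Suc m)] ?c F"
      by (simp add: zvar_pow_def zcoeff_zmon_times single_uminus zcoeff_kernel_atLeastAtMost[unfolded One_nat_def] del: upt_Suc)
    also have "\<dots> = D_list [Suc 1..<Suc (Suc m)] ?c (D_op n F)"
      by (subst upt_conv_Cons) (simp_all add: lookup_minus v1[simplified] del: upt_Suc)
    also have "\<dots> = D_list (map Suc [1..<Suc m]) ?c (D_op n F)"
      by (simp add: map_Suc_upt del: upt_Suc)
    also have "\<dots> = D_list [1..<Suc m] (- c) (D_op n F)"
    proof -
      have "D_list (map Suc js) ?c G = D_list js (- c) G" if "\<forall>j\<in>set js. j \<ge> 1" for js G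
        using that by (induction js arbitrary: G) (simp_all add: lookup_minus lookup_single v)
      then show ?thesis by (simp del: upt_Suc)
    qed
    also have "\<dots> = zcoeff (V_kernel {1..m} (D_op n F)) (- c)"
      using k by (simp add: zcoeff_kernel_atLeastAtMost[unfolded One_nat_def] del: upt_Suc)
    finally show ?thesis by simp
  qed simp
  have "V_op m A (D_op n F) =
      Sum_any (\<lambda>c. zcoeff A' (vmap Suc c) * zcoeff (zvar_pow 1 (- n) * V_kernel {1..Suc m} F) (- vmap Suc c))"
    unfolding V_op_Sum_any b using A' by (simp add: renamed_def)
  also have "\<dots> = Sum_any (\<lambda>c. zcoeff A' c * zcoeff (zvar_pow 1 (- n) * V_kernel {1..Suc m} F) (- c))"
    by (rule Sum_any_inj[OF vmap_inj, symmetric]) (use A' in \<open>auto simp: renamed_def\<close>)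
  also have "\<dots> = V_op (Suc m) (A' * zvar_pow 1 (- n)) F"
  proof -
    have "V_kernel {1..Suc m} F * (A' * zvar_pow 1 (- n)) = A' * (zvar_pow 1 (- n) * V_kernel {1..Suc m} F)"
      by (simp only: ac_simps)
    then show ?thesis unfolding V_op_def by (simp only: zcoeff_times[of A'] diff_0)
  qed
  finally show ?thesis .
qed

lemma scalar_in_mult:
  assumes "scalar_in m A" "scalar_in m B" shows "scalar_in m (A * B)"
  unfolding scalar_in_def
proof (intro conjI allI impI)
  fix c assume "zcoeff (A * B) c \<noteq> 0"
  then obtain a where "zcoeff A a * zcoeff B (c - a) \<noteq> 0"
    unfolding zcoeff_times by (rule Sum_any.not_neutral_obtains_not_neutral)
  then have "zcoeff A a \<noteq> 0" "zcoeff B (c - a) \<noteq> 0" by auto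
  then have "Poly_Mapping.keys a \<subseteq> {1..m}" "Poly_Mapping.keys (c - a) \<subseteq> {1..m}"
    using assms by (auto simp: scalar_in_def)
  then show "Poly_Mapping.keys c \<subseteq> {1..m}" using keys_add[of a "c - a"] by auto
next
  fix c
  have "\<forall>a. \<exists>x. zcoeff A a * zcoeff B (c - a) = scal x"
  proof
    fix a
    obtain x y where "zcoeff A a = scal x" "zcoeff B (c - a) = scal y"
      using assms unfolding scalar_in_def by blast
    then show "\<exists>x. zcoeff A a * zcoeff B (c - a) = scal x" by (metis scal_mult)
  qed
  then obtain x where x: "\<And>a. zcoeff A a * zcoeff B (c - a) = scal (x a)" by metis
  show "zcoeff (A * B) c \<in> range scal"
    unfolding zcoeff_times x Sum_any.expand_set rhom_sum[OF rhom_scal, symmetric] by blast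
qed

lemma scalar_in_zmon:
  "Poly_Mapping.keys a \<subseteq> {1..m} \<Longrightarrow> scalar_in m (zmon a (scal x))"
  unfolding scalar_in_def by (auto simp: zmon.rep_eq) (metis rangeI scal_0)

lemma scalar_in_zvar_pow: "i \<in> {1..m} \<Longrightarrow> scalar_in m (zvar_pow i k)"
  using scalar_in_zmon[of "sg i k" m 1] by (auto simp: zvar_pow_def split: if_splits)

lemma scalar_in_1: "scalar_in m 1"
  using scalar_in_zmon[of 0 m 1] by simp

lemma scalar_in_prod: "(\<And>x. x \<in> A \<Longrightarrow> scalar_in m (f x)) \<Longrightarrow> scalar_in m (prod f A)"
  by (induction A rule: infinite_finite_induct) (auto intro: scalar_in_1 scalar_in_mult)

section \<open>Ratios of variables\<close>

text \<open>A single monomial, so z_j/z_i exists along with z_i/z_j; only infinite series are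
  restricted to one direction.\<close>

definition zratio :: "nat \<Rightarrow> nat \<Rightarrow> symfun zser" where
  "zratio i j = zvar_pow i 1 * zvar_pow j (- 1)"

lemma zratio_eq: "zratio i j = zmon (sg i 1 - sg j 1) 1"
  by (simp add: zratio_def zvar_pow_def zmon_mult single_uminus)

lemma zratio_zvar: "zvar_pow j 1 * zratio i j = zvar_pow i 1" "zvar_pow i (- 1) * zratio i j = zvar_pow j (- 1)"
  by (simp_all add: zratio_eq zvar_pow_def zmon_mult single_uminus)

lemma zratio_mult: "zratio i j * zratio j k = zratio i k"
  by (simp add: zratio_eq zmon_mult)

lemma zratio_self [simp]: "zratio i i = 1"
  by (simp add: zratio_eq)

definition zpq :: "symfun zser" where "zpq = zmon 0 (scal (qq * tt))"
definition zsq :: "symfun zser" where "zsq = zmon 0 (scal (qq + tt))"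

definition chain :: "nat \<Rightarrow> symfun zser" where
  "chain i = zgeom (zpq * (zvar_pow i 1 * zvar_pow (i + 1) (- 1)))"

lemma chain_eq: "chain i = zsub (sg i 1 - sg (i + 1) 1) (fps_geom (scal (qq * tt)))"
  unfolding chain_def zratio_def[symmetric] zratio_eq
  by (simp add: zpq_def zmon_mult zgeom_zmon)

lemma chain_inverse: "chain i * (1 - zpq * zratio i (i + 1)) = 1"
  using zgeom_zmon_inverse[OF upward_ratio[of i "i + 1"], of "scal (qq * tt)"]
  unfolding chain_def zratio_def[symmetric] by (simp add: zpq_def zratio_eq zmon_mult mult.commute)

lemma scalar_in_chain:
  assumes "1 \<le> i" "i < m" shows "scalar_in m (chain i)"
  unfolding scalar_in_def
proof (intro conjI allI impI)
  have up: "upward (sg i 1 - sg (i + 1) 1)" by (rule upward_ratio) simp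
  fix c
  show "zcoeff (chain i) c \<in> range scal"
    unfolding chain_eq zcoeff_zsub_if[OF up] by (auto simp: scal_power[symmetric]) (metis rangeI scal_0)
  assume "zcoeff (chain i) c \<noteq> 0"
  then obtain n where c: "c = of_nat n * (sg i 1 - sg (i + 1) 1)"
    unfolding chain_eq using zcoeff_zsub_eq_0[OF up] by blast
  show "Poly_Mapping.keys c \<subseteq> {1..m}"
    using assms by (auto simp: c in_keys_iff lookup_of_nat_times lookup_minus lookup_single when_def
        split: if_splits)
qed

section \<open>Factorization of Omega[-xM] for x = z_i/z_j\<close>

definition zinvD :: "nat \<Rightarrow> nat \<Rightarrow> symfun zser" where
  "zinvD i j = zsub (sg i 1 - sg j 1) (fps_geom (scal qq) * fps_geom (scal tt))"

text \<open>Omega[-xM] is cut into (1 - x)/((1 - qx)(1 - tx)) and the polynomial 1 - qtx. For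
  adjacent variables the latter cancels \<open>chain\<close>, and \<open>zDelta\<close> removes the
  denominator of the former.\<close>

definition omega_fst :: "nat \<Rightarrow> nat \<Rightarrow> symfun zser" where
  "omega_fst i j = (1 - zratio i j) * zinvD i j"

definition omega_snd :: "nat \<Rightarrow> nat \<Rightarrow> symfun zser" where
  "omega_snd i j = 1 - zpq * zratio i j"

definition zDelta :: "nat \<Rightarrow> nat \<Rightarrow> symfun zser" where
  "zDelta i j = 1 - zsq * zratio i j + zpq * zratio i j * zratio i j"

lemma zinvD_inverse:
  assumes "i < j" shows "zDelta i j * zinvD i j = 1"
proof -
  have up: "upward (sg i 1 - sg j 1)" using assms by (rule upward_ratio)
  have z: "zsub (sg i 1 - sg j 1) (1 - fps_const x * fps_X) = 1 - zmon 0 x * zratio i j" for x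
    using up by (simp add: zsub_diff zsub_mult[symmetric] zsub_X zratio_eq)
  have "zDelta i j = (1 - zmon 0 (scal qq) * zratio i j) * (1 - zmon 0 (scal tt) * zratio i j)"
    by (simp add: zDelta_def zsq_def zpq_def scal_add scal_mult zmon_add algebra_simps
        zmon_mult[of 0 "scal qq" 0 "scal tt", simplified, symmetric])
  also have "\<dots> = zsub (sg i 1 - sg j 1)
      ((1 - fps_const (scal qq) * fps_X) * (1 - fps_const (scal tt) * fps_X))"
    by (simp only: z zsub_mult[OF up, symmetric])
  finally have "zDelta i j * zinvD i j = zsub (sg i 1 - sg j 1)
      (((1 - fps_const (scal qq) * fps_X) * fps_geom (scal qq)) *
       ((1 - fps_const (scal tt) * fps_X) * fps_geom (scal tt)))"
    by (simp only: zinvD_def zsub_mult[OF up] ac_simps)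
  then show ?thesis using up by (simp only: fps_geom_inverse zsub_1 mult_1_left)
qed

lemma zOmM_eq:
  assumes "i < j" shows "zOmM i j = omega_fst i j * omega_snd i j"
proof -
  have up: "upward (sg i 1 - sg j 1)" using assms by (rule upward_ratio)
  have z: "zsub (sg i 1 - sg j 1) (1 - fps_const x * fps_X) = 1 - zmon 0 x * zratio i j" for x
    using up by (simp add: zsub_diff zsub_mult[symmetric] zsub_X zratio_eq)
  have O: "OmM = (1 - fps_const 1 * fps_X) * (1 - fps_const (scal (qq * tt)) * fps_X) *
      (fps_geom (scal qq) * fps_geom (scal tt))"
    by (simp add: OmM_eq mult.assoc)
  have "zOmM i j = (1 - zmon 0 1 * zratio i j) * (1 - zmon 0 (scal (qq * tt)) * zratio i j) * zinvD i j"
    unfolding zOmM_def O zinvD_def by (simp only: zsub_mult[OF up, symmetric] z)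
  then show ?thesis by (simp add: omega_fst_def omega_snd_def zpq_def ac_simps)
qed

lemma omega_fst_zDelta: "i < j \<Longrightarrow> omega_fst i j * zDelta i j = 1 - zratio i j"
  using zinvD_inverse[of i j] by (simp add: omega_fst_def mult.assoc mult.commute[of "zinvD i j"])

section \<open>The commutators as constant terms\<close>

lemma V_op_diff: "V_op m (A - B) F = V_op m A F - V_op m B F"
  by (simp add: V_op_def right_diff_distrib zcoeff_diff)

lemma V_op_scal: "V_op m (zmon 0 (scal x) * A) F = scal x * V_op m A F"
  unfolding V_op_def by (subst mult.left_commute) (simp add: zcoeff_zmon_times)

lemma zvar_pow_add: "zvar_pow i (a + b) = zvar_pow i a * zvar_pow i b"
  by (simp add: zvar_pow_def zmon_mult single_add)

lemma zvar_pow_0 [simp]: "zvar_pow i 0 = 1"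
  by (simp add: zvar_pow_def)

lemma zvar_inverse: "zvar_pow i 1 * zvar_pow i (- 1) = 1"
  by (simp flip: zvar_pow_add)

definition zpows :: "nat \<Rightarrow> int \<Rightarrow> symfun zser" where
  "zpows m k = (\<Prod>i=1..m. zvar_pow i k)"

definition chain_prod :: "nat \<Rightarrow> symfun zser" where
  "chain_prod m = (\<Prod>i=1..m - 1. chain i)"

lemma N_op_eq_V_op:
  "N_op m n F = V_op m ((\<Prod>i=1..m. zvar_pow i (- negut_exp m n i)) * chain_prod m) F"
proof -
  have "(\<Prod>(i, j)\<in>{(i, j). 1 \<le> i \<and> i < j \<and> j \<le> m}. Omega (- (zvar_pow i 1 * zvar_pow j (- 1) * zM))) =
      (\<Prod>(i, j)\<in>less_pairs {1..m}. zOmM i j)"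
    by (rule prod.cong) (auto simp: less_pairs_def Omega_M)
  moreover have "(\<Prod>i=1..m. Omega (- (zvar_pow i 1 * zX))) = (\<Prod>i=1..m. zOmX i)"
    by (simp only: Omega_X)
  ultimately show ?thesis
    unfolding N_op_def V_op_def V_kernel_def Psi_def pleth_vars_def chain_prod_def chain_def zpq_def
    by (simp only: ac_simps)
qed

lemma scalar_in_chain_prod: "scalar_in m (chain_prod m)"
  unfolding chain_prod_def by (rule scalar_in_prod) (auto intro!: scalar_in_chain)

lemma scalar_in_zpows: "scalar_in m (zpows m k)"
  unfolding zpows_def by (rule scalar_in_prod) (rule scalar_in_zvar_pow)

lemma renamed_chain: "renamed Suc (chain i) (chain (Suc i))"
proof -
  have "vmap Suc (sg i 1 - sg (i + 1) 1) = sg (Suc i) 1 - sg (Suc i + 1) 1"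
    by (simp add: vmap_diff vmap_single)
  then show ?thesis unfolding chain_eq
    using renamed_zsub[of Suc "sg i 1 - sg (i + 1) 1"] upward_ratio[of i "i + 1"]
      upward_ratio[of "Suc i" "Suc i + 1"] by simp
qed

lemma prod_atLeast1_shift: "(\<Prod>i=1..Suc m. f i) = f 1 * (\<Prod>i=1..m. f (Suc i) :: 'a :: comm_monoid_mult)"
  using prod.atLeast_Suc_atMost_Suc_shift[of f 0 m]
  by (simp add: prod.atLeast_Suc_atMost prod.shift_bounds_cl_Suc_ivl del: prod.cl_ivl_Suc)

lemma zpows_Suc: "zpows (Suc m) k = zpows m k * zvar_pow (Suc m) k"
  by (simp add: zpows_def mult.commute)

lemma zpows_shift: "zpows (Suc m) k = zvar_pow 1 k * (\<Prod>i=1..m. zvar_pow (Suc i) k)"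
  unfolding zpows_def by (rule prod_atLeast1_shift)

lemma chain_prod_Suc: "m \<ge> 1 \<Longrightarrow> chain_prod (Suc m) = chain_prod m * chain m"
  by (cases m) (simp_all add: chain_prod_def mult.commute)

lemma chain_prod_shift: "m \<ge> 1 \<Longrightarrow> chain_prod (Suc m) = chain 1 * (\<Prod>i=1..m - 1. chain (Suc i))"
  using prod_atLeast1_shift[of chain "m - 1"] by (cases m) (simp_all add: chain_prod_def)

lemma zM_eq: "zM = 1 - zsq + zpq"
  by (simp add: MM_def zsq_def zpq_def flip: zmon_0_1 scal_1 zmon_add zmon_diff scal_add scal_diff)
     (simp add: algebra_simps)

text \<open>Here \<open>c\<close> is the full chain product, c(1 - px) and c(1 - py) lack one end
  factor each, and 1 - s + p is M. The mixed term p(jy - i) vanishes by the first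
  assumption.\<close>

lemma commutator_ring_identity:
  fixes i j z c p x y s y' :: "'a :: comm_ring_1"
  assumes "j * y = i" "i * y' = j"
  shows "i * (z * (c * (1 - p * x))) - j * (z * (c * (1 - p * y))) - (1 - s + p) * (i * (z * c)) =
    z * c * (i * (s - p * x - y'))"
proof -
  have "i * (z * (c * (1 - p * x))) - j * (z * (c * (1 - p * y))) - (1 - s + p) * (i * (z * c)) =
      z * c * (i * (s - p * x) - j + p * (j * y - i))"
    by (simp add: algebra_simps)
  also have "\<dots> = z * c * (i * (s - p * x) - i * y')" using assms by simp
  also have "\<dots> = z * c * (i * (s - p * x - y'))" by (simp add: right_diff_distrib)
  finally show ?thesis .
qed

text \<open>The two orders of composition place the new variable in front or at the end, so their
  multipliers lack \<open>chain 1\<close> and \<open>chain m\<close> respectively. The right side is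
  the error term that has to vanish.\<close>

lemma commutator_last:
  fixes k :: int
  assumes "m \<ge> 1"
  defines "A \<equiv> \<lambda>m. zvar_pow m (- 1) * (zpows m (- k) * chain_prod m)"
  shows "op_commutator (V_op m (A m)) (D_op k) F - scal MM * V_op (Suc m) (A (Suc m)) F =
    V_op (Suc m) (zpows (Suc m) (- k) * chain_prod (Suc m) * (zvar_pow (Suc m) (- 1) *
      (zsq - zpq * zratio 1 2 - zratio (Suc m) m))) F"
proof -
  have s: "scalar_in m (A m)" unfolding A_def
    by (intro scalar_in_mult scalar_in_chain_prod scalar_in_zpows scalar_in_zvar_pow) (use assms in auto)
  define Z where "Z = zpows (Suc m) (- k)"
  define C where "C = chain_prod (Suc m)"
  let ?A' = "zvar_pow (Suc m) (- 1) * ((\<Prod>i=1..m. zvar_pow (Suc i) (- k)) * (\<Prod>i=1..m - 1. chain (Suc i)))"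
  have "renamed Suc (A m) ?A'"
    unfolding A_def zpows_def chain_prod_def
    by (intro renamed_mult renamed_prod renamed_zvar_pow renamed_chain) simp_all
  then have 1: "V_op m (A m) (D_op k F) = V_op (Suc m) (?A' * zvar_pow 1 (- k)) F"
    by (rule V_op_D_op[OF s])
  have 2: "D_op k (V_op m (A m) F) = V_op (Suc m) (A m * zvar_pow (Suc m) (- k)) F"
    by (rule D_op_V_op[OF s])
  \<comment> \<open>Multiplying \<open>C\<close> by the inverse of a chain factor deletes it; this
    puts all three multipliers over the common denominator.\<close>
  have c1: "C * (1 - zpq * zratio 1 2) = (\<Prod>i=1..m - 1. chain (Suc i))"
    using chain_inverse[of 1] unfolding C_def chain_prod_shift[OF assms(1)]
    by (simp add: mult.commute mult.left_commute mult.assoc[symmetric] numeral_2_eq_2)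
  have c2: "C * (1 - zpq * zratio m (Suc m)) = chain_prod m"
    using chain_inverse[of m] unfolding C_def chain_prod_Suc[OF assms(1)] by (simp add: mult.assoc)
  have e1: "?A' * zvar_pow 1 (- k) = zvar_pow (Suc m) (- 1) * (Z * (\<Prod>i=1..m - 1. chain (Suc i)))"
    unfolding Z_def zpows_shift by (simp only: ac_simps)
  have e2: "A m * zvar_pow (Suc m) (- k) = zvar_pow m (- 1) * (Z * chain_prod m)"
    unfolding Z_def zpows_Suc A_def by (simp only: ac_simps)
  have e3: "A (Suc m) = zvar_pow (Suc m) (- 1) * (Z * C)"
    by (simp only: A_def Z_def C_def)
  have "?A' * zvar_pow 1 (- k) - A m * zvar_pow (Suc m) (- k) - zM * A (Suc m) =
      zvar_pow (Suc m) (- 1) * (Z * (C * (1 - zpq * zratio 1 2)))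
      - zvar_pow m (- 1) * (Z * (C * (1 - zpq * zratio m (Suc m))))
      - zM * (zvar_pow (Suc m) (- 1) * (Z * C))"
    unfolding e1 e2 e3 c1 c2 ..
  also have "\<dots> = Z * C * (zvar_pow (Suc m) (- 1) * (zsq - zpq * zratio 1 2 - zratio (Suc m) m))"
  proof -
    have r: "zvar_pow m (- 1) * zratio m (Suc m) = zvar_pow (Suc m) (- 1)"
      "zvar_pow (Suc m) (- 1) * zratio (Suc m) m = zvar_pow m (- 1)"
      by (rule zratio_zvar)+
    from commutator_ring_identity[OF r] show ?thesis unfolding zM_eq .
  qed
  finally show ?thesis
    unfolding op_commutator_def 1 2 Z_def C_def V_op_diff[symmetric] V_op_scal[symmetric] by simp
qed

text \<open>The mirror image: the extra monomial is z_1 at the front end, and a new variable in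
  front pushes it to z_2.\<close>

lemma commutator_first:
  fixes k :: int
  assumes "m \<ge> 1"
  defines "A \<equiv> \<lambda>m. zvar_pow 1 1 * (zpows m (- k) * chain_prod m)"
  shows "op_commutator (D_op k) (V_op m (A m)) F - scal MM * V_op (Suc m) (A (Suc m)) F =
    V_op (Suc m) (zpows (Suc m) (- k) * chain_prod (Suc m) * (zvar_pow 1 1 *
      (zsq - zpq * zratio m (Suc m) - zratio 2 1))) F"
proof -
  have s: "scalar_in m (A m)" unfolding A_def
    by (intro scalar_in_mult scalar_in_chain_prod scalar_in_zpows scalar_in_zvar_pow) (use assms in auto)
  define Z where "Z = zpows (Suc m) (- k)"
  define C where "C = chain_prod (Suc m)"
  let ?A' = "zvar_pow (Suc 1) 1 * ((\<Prod>i=1..m. zvar_pow (Suc i) (- k)) * (\<Prod>i=1..m - 1. chain (Suc i)))"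
  have "renamed Suc (A m) ?A'"
    unfolding A_def zpows_def chain_prod_def
    by (intro renamed_mult renamed_prod renamed_zvar_pow renamed_chain) simp_all
  then have 1: "V_op m (A m) (D_op k F) = V_op (Suc m) (?A' * zvar_pow 1 (- k)) F"
    by (rule V_op_D_op[OF s])
  have 2: "D_op k (V_op m (A m) F) = V_op (Suc m) (A m * zvar_pow (Suc m) (- k)) F"
    by (rule D_op_V_op[OF s])
  have c1: "C * (1 - zpq * zratio 1 2) = (\<Prod>i=1..m - 1. chain (Suc i))"
    using chain_inverse[of 1] unfolding C_def chain_prod_shift[OF assms(1)]
    by (simp add: mult.commute mult.left_commute mult.assoc[symmetric] numeral_2_eq_2)
  have c2: "C * (1 - zpq * zratio m (Suc m)) = chain_prod m"
    using chain_inverse[of m] unfolding C_def chain_prod_Suc[OF assms(1)] by (simp add: mult.assoc)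
  have e1: "?A' * zvar_pow 1 (- k) = zvar_pow 2 1 * (Z * (\<Prod>i=1..m - 1. chain (Suc i)))"
    unfolding Z_def zpows_shift numeral_2_eq_2 One_nat_def[symmetric] by (simp only: ac_simps)
  have e2: "A m * zvar_pow (Suc m) (- k) = zvar_pow 1 1 * (Z * chain_prod m)"
    unfolding Z_def zpows_Suc A_def by (simp only: ac_simps)
  have e3: "A (Suc m) = zvar_pow 1 1 * (Z * C)"
    by (simp only: A_def Z_def C_def)
  have "A m * zvar_pow (Suc m) (- k) - ?A' * zvar_pow 1 (- k) - zM * A (Suc m) =
      zvar_pow 1 1 * (Z * (C * (1 - zpq * zratio m (Suc m))))
      - zvar_pow 2 1 * (Z * (C * (1 - zpq * zratio 1 2)))
      - zM * (zvar_pow 1 1 * (Z * C))"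
    unfolding e1 e2 e3 c1 c2 ..
  also have "\<dots> = Z * C * (zvar_pow 1 1 * (zsq - zpq * zratio m (Suc m) - zratio 2 1))"
  proof -
    have r: "zvar_pow 2 1 * zratio 1 2 = zvar_pow 1 1" "zvar_pow 1 1 * zratio 2 1 = zvar_pow 2 1"
      by (rule zratio_zvar)+
    from commutator_ring_identity[OF r] show ?thesis unfolding zM_eq .
  qed
  finally show ?thesis
    unfolding op_commutator_def 1 2 Z_def C_def V_op_diff[symmetric] V_op_scal[symmetric] by simp
qed

section \<open>Antisymmetry\<close>

definition swapv :: "nat \<Rightarrow> nat \<Rightarrow> nat \<Rightarrow> nat" where
  "swapv i j k = (if k = i then j else if k = j then i else k)"

lemma swapv_simps [simp]:
  "swapv i j i = j" "swapv i j j = i" "k \<noteq> i \<Longrightarrow> k \<noteq> j \<Longrightarrow> swapv i j k = k"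
  by (simp_all add: swapv_def)

lemma inj_swapv: "inj (swapv i j)"
  by (rule injI) (auto simp: swapv_def split: if_splits)

lemma swapv_image: "i \<in> J \<Longrightarrow> j \<in> J \<Longrightarrow> swapv i j ` J = J"
  by (force simp: swapv_def image_iff)

abbreviation symm :: "nat \<Rightarrow> nat \<Rightarrow> symfun zser \<Rightarrow> bool" where
  "symm i j f \<equiv> renamed (swapv i j) f f"

lemma symm_mult: "symm i j f \<Longrightarrow> symm i j g \<Longrightarrow> symm i j (f * g)"
  by (rule renamed_mult[OF inj_swapv])

lemma symm_diff: "symm i j f \<Longrightarrow> symm i j g \<Longrightarrow> symm i j (f - g)"
  by (rule renamed_diff[OF inj_swapv])

lemma symm_pair:
  assumes "renamed (swapv i j) f g" "renamed (swapv i j) g f"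
  shows "symm i j (f * g)"
  using renamed_mult[OF inj_swapv assms] by (simp add: mult.commute)

text \<open>The constant term is the difference of the coefficients of \<open>f\<close> at 1/z_j and
  1/z_i, which symmetry identifies.\<close>

lemma antisymmetric_constant_term:
  assumes "symm i j f"
  shows "zcoeff (f * (zvar_pow j 1 - zvar_pow i 1)) 0 = 0"
proof -
  have "zcoeff f (vmap (swapv i j) (- sg i 1)) = zcoeff f (- sg i 1)"
    using assms by (simp add: renamed_def)
  then have "zcoeff f (- sg j 1) = zcoeff f (- sg i 1)"
    by (simp add: vmap_uminus[OF inj_swapv] vmap_single swapv_def)
  then show ?thesis
    by (subst mult.commute) (simp add: left_diff_distrib zcoeff_diff zvar_pow_def zcoeff_zmon_times)
qed

lemma renamed_zratio: "inj \<tau> \<Longrightarrow> renamed \<tau> (zratio a b) (zratio (\<tau> a) (\<tau> b))"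
  using renamed_zmon[of \<tau> "sg a 1 - sg b 1"] by (simp add: zratio_eq vmap_diff vmap_single)

lemma renamed_omega_snd: "inj \<tau> \<Longrightarrow> renamed \<tau> (omega_snd a b) (omega_snd (\<tau> a) (\<tau> b))"
  unfolding omega_snd_def zpq_def
  by (intro renamed_diff renamed_1 renamed_mult renamed_const renamed_zratio)

lemma renamed_omega_fst:
  assumes "inj \<tau>" "a < b" "\<tau> a < \<tau> b"
  shows "renamed \<tau> (omega_fst a b) (omega_fst (\<tau> a) (\<tau> b))"
proof -
  have "vmap \<tau> (sg a 1 - sg b 1) = sg (\<tau> a) 1 - sg (\<tau> b) 1"
    using assms(1) by (simp add: vmap_diff vmap_single)
  then have "renamed \<tau> (zinvD a b) (zinvD (\<tau> a) (\<tau> b))"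
    unfolding zinvD_def using renamed_zsub[OF assms(1) upward_ratio[OF assms(2)]] upward_ratio[OF assms(3)]
    by simp
  then show ?thesis unfolding omega_fst_def
    using assms(1) by (intro renamed_mult renamed_diff renamed_1 renamed_zratio)
qed

lemma symm_zpq: "symm i j zpq"
  unfolding zpq_def by (rule renamed_const[OF inj_swapv])

lemma symm_zvar_pow: "a \<notin> {i, j} \<Longrightarrow> symm i j (zvar_pow a k)"
  using renamed_zvar_pow[OF inj_swapv, of i j a k] by (simp add: swapv_def)

lemma symm_zvar_pow_pair: "symm i j (zvar_pow i k * zvar_pow j k)"
  using renamed_zvar_pow[OF inj_swapv, of i j i k] renamed_zvar_pow[OF inj_swapv, of i j j k]
  by (intro symm_pair) simp_all

lemma symm_omega_fst:
  "a < b \<Longrightarrow> a \<notin> {i, j} \<Longrightarrow> b \<notin> {i, j} \<Longrightarrow> symm i j (omega_fst a b)"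
  using renamed_omega_fst[OF inj_swapv, of a b i j] by (simp add: swapv_def)

lemma symm_omega_snd: "a \<notin> {i, j} \<Longrightarrow> b \<notin> {i, j} \<Longrightarrow> symm i j (omega_snd a b)"
  using renamed_omega_snd[OF inj_swapv, of i j a b] by (simp add: swapv_def)

text \<open>The swap exchanges the two factors. As b lies above both i and j, the ratios keep their
  direction; for adjacent i and j every other variable lies above both or below both.\<close>

lemma symm_omega_fst_above:
  assumes "i < b" "j < b" shows "symm i j (omega_fst i b * omega_fst j b)"
  using renamed_omega_fst[OF inj_swapv, of i b i j] renamed_omega_fst[OF inj_swapv, of j b i j] assms
  by (intro symm_pair) simp_all

lemma symm_omega_fst_below:
  assumes "a < i" "a < j" shows "symm i j (omega_fst a i * omega_fst a j)"
  using renamed_omega_fst[OF inj_swapv, of a i i j] renamed_omega_fst[OF inj_swapv, of a j i j] assms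
  by (intro symm_pair) simp_all

lemma symm_omega_snd_above:
  assumes "i < b" "j < b" shows "symm i j (omega_snd i b * omega_snd j b)"
  using renamed_omega_snd[OF inj_swapv, of i j i b] renamed_omega_snd[OF inj_swapv, of i j j b] assms
  by (intro symm_pair) simp_all

lemma symm_omega_snd_below:
  assumes "a < i" "a < j" shows "symm i j (omega_snd a i * omega_snd a j)"
  using renamed_omega_snd[OF inj_swapv, of i j a i] renamed_omega_snd[OF inj_swapv, of i j a j] assms
  by (intro symm_pair) simp_all

lemma symm_Psi_zpows:
  assumes "i \<in> {1..m}" "j \<in> {1..m}"
  shows "symm i j (Psi {1..m} F * zpows m k)"
proof (rule symm_mult)
  show "symm i j (Psi {1..m} F)"
    using renamed_Psi[OF inj_swapv, of "{1..m}" i j F] swapv_image[OF assms] by simp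
  have "renamed (swapv i j) (\<Prod>a=1..m. zvar_pow a k) (\<Prod>a=1..m. zvar_pow (swapv i j a) k)"
    by (intro renamed_prod renamed_zvar_pow inj_swapv)
  also have "(\<Prod>a=1..m. zvar_pow (swapv i j a) k) = (\<Prod>a\<in>swapv i j ` {1..m}. zvar_pow a k)"
    by (subst prod.reindex) (auto intro: inj_on_subset[OF inj_swapv])
  finally show "symm i j (zpows m k)" unfolding zpows_def swapv_image[OF assms] .
qed

section \<open>Vanishing of the constant terms\<close>

text \<open>Rewrites the factor 1 - z_i/z_j left by \<open>omega_fst_zDelta\<close> as a monomial
  times the antisymmetric z_j - z_i.\<close>

lemma zratio_diff: "zratio j k * (1 - zratio i j) = zvar_pow k (- 1) * (zvar_pow j 1 - zvar_pow i 1)"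
proof -
  have "zratio j k * (1 - zratio i j) = zratio j k - zratio i j * zratio j k"
    by (simp add: algebra_simps)
  then show ?thesis unfolding zratio_mult by (simp add: zratio_def algebra_simps)
qed

lemma one_minus_zratio: "1 - zratio i j = zvar_pow j (- 1) * (zvar_pow j 1 - zvar_pow i 1)"
  using zratio_diff[of j j i] by simp

lemma zvar_zratio_diff: "zvar_pow i 1 * (- zratio j i * (1 - zratio i j)) = - (zvar_pow j 1 - zvar_pow i 1)"
  by (simp only: mult_minus_left mult_minus_right zratio_diff mult.assoc[symmetric] zvar_inverse mult_1_left)

text \<open>
  Each summand on the right contains a factor \<open>1 - sx + px\<^sup>2\<close>, which cancels the
  denominator of \<open>\<Omega>[-xM]\<close>.
\<close>

lemma numerator_identity_3:
  fixes s p x y y' :: "'a :: comm_ring_1"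
  assumes "y * y' = 1"
  shows "(s - p * x - y') * (1 - p * (x * y)) =
    p * y * (1 - s * x + p * x * x) - y' * (1 - s * y + p * y * y)"
proof -
  have "y' * (1 - p * (x * y)) = y' - p * x * (y * y')"
    "y' * (1 - s * y + p * y * y) = y' - s * (y * y') + p * y * (y * y')"
    by (simp_all add: algebra_simps)
  then have "y' * (1 - p * (x * y)) = y' - p * x" "y' * (1 - s * y + p * y * y) = y' - s + p * y"
    by (simp_all add: assms)
  then show ?thesis unfolding left_diff_distrib[of "s - p * x"] by (simp add: algebra_simps)
qed

text \<open>For x = z_1/z_2, y = z_2/z_3, w = z_3/z_4 the factors 1 - pxy and 1 - pyw are
  \<open>omega_snd 1 3\<close> and \<open>omega_snd 2 4\<close>. The outer summands keep the one
  that pairs with \<open>omega_snd 1 4\<close> under their swap; the middle summand keeps neither,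
  as \<open>omega_snd 1 4\<close> alone is symmetric in z_2, z_3.\<close>

lemma numerator_identity_4:
  fixes s p x y w w' :: "'a :: comm_ring_1"
  assumes "w * w' = 1"
  shows "(s - p * x - w') * ((1 - p * (x * y)) * (1 - p * (y * w))) =
    p * y * (1 - p * (y * w)) * (1 - s * x + p * x * x) + p * (w - x) * (1 - s * y + p * y * y)
    - w' * (1 - p * (x * y)) * (1 - s * w + p * w * w)"
proof -
  have "w' * (1 - p * (y * w)) = w' - p * y * (w * w')"
    "w' * (1 - s * w + p * w * w) = w' - s * (w * w') + p * w * (w * w')"
    by (simp_all add: algebra_simps)
  then have *: "w' * (1 - p * (y * w)) = w' - p * y" "w' * (1 - s * w + p * w * w) = w' - s + p * w"
    by (simp_all add: assms)
  have "(s - p * x - w') * ((1 - p * (x * y)) * (1 - p * (y * w))) =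
      (s - p * x) * ((1 - p * (x * y)) * (1 - p * (y * w))) - (w' * (1 - p * (y * w))) * (1 - p * (x * y))"
    by (simp only: left_diff_distrib ac_simps)
  also have "\<dots> = p * y * (1 - p * (y * w)) * (1 - s * x + p * x * x) + p * (w - x) * (1 - s * y + p * y * y)
      - (w' * (1 - s * w + p * w * w)) * (1 - p * (x * y))"
    unfolding * by (simp add: algebra_simps)
  finally show ?thesis by (simp only: ac_simps)
qed

section \<open>The kernels for two, three and four variables\<close>

lemma less_pairs_2: "less_pairs {1..2} = {(1, 2)}"
  by (auto simp: less_pairs_def)

lemma less_pairs_3: "less_pairs {1..3} = {(1, 2), (1, 3), (2, 3)}"
  by (auto simp: less_pairs_def)

lemma less_pairs_4: "less_pairs {1..4} = {(1, 2), (1, 3), (1, 4), (2, 3), (2, 4), (3, 4)}"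
  by (auto simp: less_pairs_def)

lemma chain_prod_2: "chain_prod 2 = chain 1"
  by (simp add: chain_prod_def)

lemma chain_prod_3: "chain_prod 3 = chain 1 * chain 2"
  using chain_prod_Suc[of 2] by (simp add: chain_prod_2)

lemma chain_prod_4: "chain_prod 4 = chain 1 * chain 2 * chain 3"
  using chain_prod_Suc[of 3] by (simp add: chain_prod_3)

lemma chain_omega_snd:
  "chain 1 * omega_snd 1 2 = 1" "chain 2 * omega_snd 2 3 = 1" "chain 3 * omega_snd 3 4 = 1"
  using chain_inverse[of 1] chain_inverse[of 2] chain_inverse[of 3]
  by (simp_all only: omega_snd_def one_add_one) simp_all

text \<open>Every chain factor meets the numerator 1 - qtx of its adjacent pair and cancels; in the
  versions for three and four variables only non-adjacent \<open>omega_snd\<close> remain.\<close>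

lemma V_kernel_2:
  "V_kernel {1..2} F * (zpows 2 k * chain_prod 2 * E) = Psi {1..2} F * zpows 2 k * (omega_fst 1 2 * E)"
proof -
  have "V_kernel {1..2} F * (zpows 2 k * chain_prod 2 * E) =
      (chain 1 * omega_snd 1 2) * (Psi {1..2} F * zpows 2 k * (omega_fst 1 2 * E))"
    unfolding V_kernel_def less_pairs_2 chain_prod_2 by (simp add: zOmM_eq ac_simps)
  then show ?thesis by (simp only: chain_omega_snd mult_1_left)
qed

lemma V_kernel_3:
  "V_kernel {1..3} F * (zpows 3 k * chain_prod 3 * E) = Psi {1..3} F * zpows 3 k *
    (omega_fst 1 2 * omega_fst 1 3 * omega_fst 2 3 * (omega_snd 1 3 * E))"
proof -
  have "V_kernel {1..3} F * (zpows 3 k * chain_prod 3 * E) =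
      (chain 1 * omega_snd 1 2) * (chain 2 * omega_snd 2 3) * (Psi {1..3} F * zpows 3 k *
      (omega_fst 1 2 * omega_fst 1 3 * omega_fst 2 3 * (omega_snd 1 3 * E)))"
    unfolding V_kernel_def less_pairs_3 chain_prod_3 by (simp add: zOmM_eq ac_simps)
  then show ?thesis by (simp only: chain_omega_snd mult_1_left)
qed

lemma V_kernel_4:
  "V_kernel {1..4} F * (zpows 4 k * chain_prod 4 * E) = Psi {1..4} F * zpows 4 k *
    (omega_fst 1 2 * omega_fst 1 3 * omega_fst 1 4 * omega_fst 2 3 * omega_fst 2 4 * omega_fst 3 4 *
     (omega_snd 1 4 * (E * (omega_snd 1 3 * omega_snd 2 4))))"
proof -
  have "V_kernel {1..4} F * (zpows 4 k * chain_prod 4 * E) =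
      (chain 1 * omega_snd 1 2) * (chain 2 * omega_snd 2 3) * (chain 3 * omega_snd 3 4) *
      (Psi {1..4} F * zpows 4 k *
      (omega_fst 1 2 * omega_fst 1 3 * omega_fst 1 4 * omega_fst 2 3 * omega_fst 2 4 * omega_fst 3 4 *
       (omega_snd 1 4 * (E * (omega_snd 1 3 * omega_snd 2 4)))))"
    unfolding V_kernel_def less_pairs_4 chain_prod_4 by (simp add: zOmM_eq ac_simps)
  then show ?thesis by (simp only: chain_omega_snd mult_1_left)
qed

lemma omega_fst_zDelta_adjacent:
  "omega_fst 1 2 * zDelta 1 2 = 1 - zratio 1 2"
  "omega_fst 2 3 * zDelta 2 3 = 1 - zratio 2 3"
  "omega_fst 3 4 * zDelta 3 4 = 1 - zratio 3 4"
  by (rule omega_fst_zDelta, simp)+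

lemma vanish_2:
  "V_op 2 (zpows 2 k * chain_prod 2 * (zvar_pow 2 (- 1) * (zsq - zpq * zratio 1 2 - zratio 2 1))) F = 0"
proof -
  let ?P = "Psi {1..2} F * zpows 2 k"
  have "zratio 1 2 * zratio 2 1 = 1" by (simp add: zratio_mult)
  \<comment> \<open>With two variables the error factor is itself -1/x times the quadratic in x =
    z_1/z_2.\<close>
  then have "zsq - zpq * zratio 1 2 - zratio 2 1 = - (zratio 2 1 * zDelta 1 2)"
    unfolding zDelta_def by (simp add: algebra_simps)
  then have "?P * (omega_fst 1 2 * (zvar_pow 2 (- 1) * (zsq - zpq * zratio 1 2 - zratio 2 1))) =
      - (?P * zvar_pow 2 (- 1) * (zratio 2 1 * (omega_fst 1 2 * zDelta 1 2)))"
    by (simp add: ac_simps)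
  also have "\<dots> = - (?P * (zvar_pow 1 (- 1) * zvar_pow 2 (- 1)) * (zvar_pow 2 1 - zvar_pow 1 1))"
    by (simp add: omega_fst_zDelta zratio_diff ac_simps)
  finally show ?thesis
    unfolding V_op_def V_kernel_2
    using antisymmetric_constant_term[OF symm_mult[OF symm_Psi_zpows symm_zvar_pow_pair], of 1 2 2 F k "- 1"]
    by (simp add: uminus_zser.rep_eq)
qed

lemma vanish_ring_3:
  fixes P z N u A B :: "'a :: comm_ring_1"
  assumes "N * u = A * d1 + B * d2" "h12 * d1 = a" "h23 * d2 = b"
  shows "P * (h12 * h13 * h23 * (u * (z * N))) =
    P * (h13 * h23) * (z * (A * a)) + P * (h12 * h13) * (z * (B * b))"
proof -
  have "P * (h12 * h13 * h23 * (u * (z * N))) = P * (h12 * h13 * h23) * z * (N * u)"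
    by (simp only: ac_simps)
  also have "\<dots> = P * (h13 * h23) * (z * (A * (h12 * d1))) + P * (h12 * h13) * (z * (B * (h23 * d2)))"
    unfolding assms(1) by (simp only: distrib_left ac_simps)
  finally show ?thesis unfolding assms(2,3) .
qed

text \<open>The brackets on the right collect factors that are exchanged by the swap of the adjacent
  pair whose denominator was cancelled: (1,2), (2,3) and (3,4) in this order.\<close>

lemma vanish_ring_4:
  fixes P z N A B C :: "'a :: comm_ring_1"
  assumes "N * (u13 * u24) = A * u24 * d1 + B * d2 + C * u13 * d3"
    "h12 * d1 = a" "h23 * d2 = b" "h34 * d3 = c"
  shows "P * (h12 * h13 * h14 * h23 * h24 * h34 * (u14 * (z * N * (u13 * u24)))) =
    P * ((u14 * u24) * ((h13 * h23) * ((h14 * h24) * h34))) * (z * (A * a)) +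
    P * (u14 * ((h12 * h13) * (h14 * (h24 * h34)))) * (z * (B * b)) +
    P * ((u13 * u14) * ((h13 * h14) * ((h23 * h24) * h12))) * (z * (C * c))"
proof -
  have "P * (h12 * h13 * h14 * h23 * h24 * h34 * (u14 * (z * N * (u13 * u24)))) =
      P * (h12 * h13 * h14 * h23 * h24 * h34) * u14 * z * (N * (u13 * u24))"
    by (simp only: ac_simps)
  also have "\<dots> = P * ((u14 * u24) * ((h13 * h23) * ((h14 * h24) * h34))) * (z * (A * (h12 * d1))) +
      P * (u14 * ((h12 * h13) * (h14 * (h24 * h34)))) * (z * (B * (h23 * d2))) +
      P * ((u13 * u14) * ((h13 * h14) * ((h23 * h24) * h12))) * (z * (C * (h34 * d3)))"
    unfolding assms(1) by (simp only: distrib_left ac_simps)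
  finally show ?thesis unfolding assms(2-4) .
qed

lemma zcoeff_eq_0:
  "zcoeff f c = 0 \<Longrightarrow> zcoeff g c = 0 \<Longrightarrow> zcoeff (f + g) c = (0 :: 'a :: comm_ring_1)"
  "zcoeff f c = 0 \<Longrightarrow> zcoeff (- f) c = (0 :: 'a :: comm_ring_1)"
  by (simp_all add: plus_zser.rep_eq uminus_zser.rep_eq)

text \<open>The first summand is antisymmetric in z_1, z_2 and the second in z_2, z_3, each up to
  the symmetric factors listed in the \<open>symm\<close> rules.\<close>

lemma vanish_3_last:
  "V_op 3 (zpows 3 k * chain_prod 3 * (zvar_pow 3 (- 1) * (zsq - zpq * zratio 1 2 - zratio 3 2))) F = 0"
proof -
  let ?P = "Psi {1..3} F * zpows 3 k"
  have "zratio 2 3 * zratio 3 2 = 1" by (simp add: zratio_mult)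
  from numerator_identity_3[OF this, of zsq zpq "zratio 1 2"]
  have N: "(zsq - zpq * zratio 1 2 - zratio 3 2) * omega_snd 1 3 =
      zpq * zratio 2 3 * zDelta 1 2 + (- zratio 3 2) * zDelta 2 3"
    by (simp add: omega_snd_def zratio_mult zDelta_def)
  have 1: "?P * (omega_fst 1 3 * omega_fst 2 3) * (zvar_pow 3 (- 1) * (zpq * zratio 2 3 * (1 - zratio 1 2))) =
      ?P * ((omega_fst 1 3 * omega_fst 2 3) * (zvar_pow 3 (- 1) * (zpq * zvar_pow 3 (- 1)))) *
        (zvar_pow 2 1 - zvar_pow 1 1)"
    by (simp only: mult.assoc zratio_diff)
  have 2: "?P * (omega_fst 1 2 * omega_fst 1 3) * (zvar_pow 3 (- 1) * (- zratio 3 2 * (1 - zratio 2 3))) =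
      - (?P * ((omega_fst 1 2 * omega_fst 1 3) * (zvar_pow 2 (- 1) * zvar_pow 3 (- 1))) *
        (zvar_pow 3 1 - zvar_pow 2 1))"
    by (simp add: mult.assoc zratio_diff mult.left_commute)
  have "zcoeff (?P * ((omega_fst 1 3 * omega_fst 2 3) * (zvar_pow 3 (- 1) * (zpq * zvar_pow 3 (- 1)))) *
        (zvar_pow 2 1 - zvar_pow 1 1)) 0 = 0"
    by (intro antisymmetric_constant_term symm_mult[OF symm_Psi_zpows]
        symm_mult[OF symm_omega_fst_above] symm_mult[OF symm_zvar_pow] symm_mult[OF symm_zpq] symm_zvar_pow) simp_all
  moreover have "zcoeff (?P * ((omega_fst 1 2 * omega_fst 1 3) * (zvar_pow 2 (- 1) * zvar_pow 3 (- 1))) *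
        (zvar_pow 3 1 - zvar_pow 2 1)) 0 = 0"
    by (intro antisymmetric_constant_term symm_mult[OF symm_Psi_zpows]
        symm_mult[OF symm_omega_fst_below] symm_zvar_pow_pair) simp_all
  ultimately show ?thesis
    unfolding V_op_def V_kernel_3 vanish_ring_3[OF N omega_fst_zDelta_adjacent(1,2)] 1 2
    by (intro zcoeff_eq_0)
qed

lemma vanish_3_first:
  "V_op 3 (zpows 3 k * chain_prod 3 * (zvar_pow 1 1 * (zsq - zpq * zratio 2 3 - zratio 2 1))) F = 0"
proof -
  let ?P = "Psi {1..3} F * zpows 3 k"
  have "zratio 1 2 * zratio 2 1 = 1" by (simp add: zratio_mult)
  \<comment> \<open>The identity is read from the other end of the chain: its x is z_2/z_3 and its y
    is z_1/z_2.\<close>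
  from numerator_identity_3[OF this, of zsq zpq "zratio 2 3"]
  have N: "(zsq - zpq * zratio 2 3 - zratio 2 1) * omega_snd 1 3 =
      (- zratio 2 1) * zDelta 1 2 + zpq * zratio 1 2 * zDelta 2 3"
    unfolding omega_snd_def zDelta_def zratio_mult[of 1 2 3, symmetric] by (simp add: mult.commute)
  have 1: "?P * (omega_fst 1 3 * omega_fst 2 3) * (zvar_pow 1 1 * (- zratio 2 1 * (1 - zratio 1 2))) =
      - (?P * (omega_fst 1 3 * omega_fst 2 3) * (zvar_pow 2 1 - zvar_pow 1 1))"
    by (simp only: zvar_zratio_diff mult_minus_right)
  have 2: "?P * (omega_fst 1 2 * omega_fst 1 3) * (zvar_pow 1 1 * (zpq * zratio 1 2 * (1 - zratio 2 3))) =
      ?P * ((omega_fst 1 2 * omega_fst 1 3) * (zvar_pow 1 1 * (zpq * (zvar_pow 1 1 *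
        (zvar_pow 2 (- 1) * zvar_pow 3 (- 1)))))) * (zvar_pow 3 1 - zvar_pow 2 1)"
    unfolding one_minus_zratio[of 2 3] zratio_def[of 1 2] by (simp only: mult.assoc)
  have "zcoeff (?P * (omega_fst 1 3 * omega_fst 2 3) * (zvar_pow 2 1 - zvar_pow 1 1)) 0 = 0"
    by (intro antisymmetric_constant_term symm_mult[OF symm_Psi_zpows] symm_omega_fst_above) simp_all
  moreover have "zcoeff (?P * ((omega_fst 1 2 * omega_fst 1 3) * (zvar_pow 1 1 * (zpq * (zvar_pow 1 1 *
        (zvar_pow 2 (- 1) * zvar_pow 3 (- 1)))))) * (zvar_pow 3 1 - zvar_pow 2 1)) 0 = 0"
    by (intro antisymmetric_constant_term symm_mult[OF symm_Psi_zpows] symm_mult[OF symm_omega_fst_below]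
        symm_mult[OF symm_zvar_pow] symm_mult[OF symm_zpq] symm_zvar_pow_pair) simp_all
  ultimately show ?thesis
    unfolding V_op_def V_kernel_3 vanish_ring_3[OF N omega_fst_zDelta_adjacent(1,2)] 1 2
    by (intro zcoeff_eq_0)
qed

text \<open>For z_3/z_4 - z_1/z_2 the bracket is z_2 z_3 - z_1 z_4, which is symmetric in z_2 and
  z_3.\<close>

lemma zratio_diff_ratio:
  "zratio a b - zratio c d = zvar_pow b (- 1) * (zvar_pow d (- 1) *
    (zvar_pow a 1 * zvar_pow d 1 - zvar_pow c 1 * zvar_pow b 1))"
proof -
  have "zvar_pow b (- 1) * (zvar_pow d (- 1) * (zvar_pow a 1 * zvar_pow d 1 - zvar_pow c 1 * zvar_pow b 1)) =
      (zvar_pow d 1 * zvar_pow d (- 1)) * zratio a b - (zvar_pow b 1 * zvar_pow b (- 1)) * zratio c d"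
    unfolding zratio_def by (simp only: right_diff_distrib ac_simps)
  then show ?thesis by (simp only: zvar_inverse mult_1_left)
qed

lemma vanish_4_last:
  "V_op 4 (zpows 4 k * chain_prod 4 * (zvar_pow 4 (- 1) * (zsq - zpq * zratio 1 2 - zratio 4 3))) F = 0"
proof -
  let ?P = "Psi {1..4} F * zpows 4 k"
  let ?G12 = "(omega_snd 1 4 * omega_snd 2 4) * ((omega_fst 1 3 * omega_fst 2 3) *
    ((omega_fst 1 4 * omega_fst 2 4) * omega_fst 3 4))"
  let ?G23 = "omega_snd 1 4 * ((omega_fst 1 2 * omega_fst 1 3) * (omega_fst 1 4 * (omega_fst 2 4 * omega_fst 3 4)))"
  let ?G34 = "(omega_snd 1 3 * omega_snd 1 4) * ((omega_fst 1 3 * omega_fst 1 4) *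
    ((omega_fst 2 3 * omega_fst 2 4) * omega_fst 1 2))"
  let ?q = "zvar_pow 2 1 * zvar_pow 3 1 - zvar_pow 1 1 * zvar_pow 4 1"
  have "zratio 3 4 * zratio 4 3 = 1" by (simp add: zratio_mult)
  from numerator_identity_4[OF this, of zsq zpq "zratio 1 2" "zratio 2 3"]
  have N: "(zsq - zpq * zratio 1 2 - zratio 4 3) * (omega_snd 1 3 * omega_snd 2 4) =
      zpq * zratio 2 3 * omega_snd 2 4 * zDelta 1 2 + zpq * (zratio 3 4 - zratio 1 2) * zDelta 2 3 +
      (- zratio 4 3) * omega_snd 1 3 * zDelta 3 4"
    by (simp add: omega_snd_def zratio_mult zDelta_def)
  have 1: "?P * ?G12 * (zvar_pow 4 (- 1) * (zpq * zratio 2 3 * (1 - zratio 1 2))) =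
      ?P * (?G12 * (zvar_pow 4 (- 1) * (zpq * zvar_pow 3 (- 1)))) * (zvar_pow 2 1 - zvar_pow 1 1)"
    by (simp only: mult.assoc zratio_diff)
  \<comment> \<open>The 1/z_2 from the difference of ratios joins the 1/z_3 from 1 - z_2/z_3 to a
    symmetric pair.\<close>
  have 2: "?P * ?G23 * (zvar_pow 4 (- 1) * (zpq * (zratio 3 4 - zratio 1 2) * (1 - zratio 2 3))) =
      ?P * (?G23 * (zvar_pow 4 (- 1) * (zpq * (zvar_pow 4 (- 1) * ((zvar_pow 2 (- 1) * zvar_pow 3 (- 1)) * ?q)))))
        * (zvar_pow 3 1 - zvar_pow 2 1)"
    unfolding zratio_diff_ratio one_minus_zratio[of 2 3] by (simp only: ac_simps)
  have 3: "?P * ?G34 * (zvar_pow 4 (- 1) * (- zratio 4 3 * (1 - zratio 3 4))) =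
      - (?P * (?G34 * (zvar_pow 3 (- 1) * zvar_pow 4 (- 1))) * (zvar_pow 4 1 - zvar_pow 3 1))"
    by (simp add: mult.assoc zratio_diff mult.left_commute)
  have "zcoeff (?P * (?G12 * (zvar_pow 4 (- 1) * (zpq * zvar_pow 3 (- 1)))) * (zvar_pow 2 1 - zvar_pow 1 1)) 0 = 0"
    by (intro antisymmetric_constant_term symm_mult[OF symm_Psi_zpows] symm_mult[OF symm_mult[OF symm_omega_snd_above]]
        symm_mult[OF symm_omega_fst_above] symm_omega_fst
        symm_mult[OF symm_zvar_pow] symm_mult[OF symm_zpq] symm_zvar_pow) simp_all
  moreover have "zcoeff (?P * (?G23 * (zvar_pow 4 (- 1) * (zpq * (zvar_pow 4 (- 1) *
      ((zvar_pow 2 (- 1) * zvar_pow 3 (- 1)) * ?q))))) * (zvar_pow 3 1 - zvar_pow 2 1)) 0 = 0"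
    by (intro antisymmetric_constant_term symm_mult[OF symm_Psi_zpows] symm_mult[OF symm_mult[OF symm_omega_snd]]
        symm_mult[OF symm_omega_fst_below] symm_mult[OF symm_omega_fst] symm_omega_fst_above
        symm_mult[OF symm_zvar_pow] symm_mult[OF symm_zpq] symm_mult[OF symm_zvar_pow_pair]
        symm_diff symm_zvar_pow_pair symm_zvar_pow) simp_all
  moreover have "zcoeff (?P * (?G34 * (zvar_pow 3 (- 1) * zvar_pow 4 (- 1))) * (zvar_pow 4 1 - zvar_pow 3 1)) 0 = 0"
    by (intro antisymmetric_constant_term symm_mult[OF symm_Psi_zpows] symm_mult[OF symm_mult[OF symm_omega_snd_below]]
        symm_mult[OF symm_omega_fst_below] symm_omega_fst symm_zvar_pow_pair) simp_all
  ultimately show ?thesis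
    unfolding V_op_def V_kernel_4
      vanish_ring_4[OF N omega_fst_zDelta_adjacent] 1 2 3
    by (intro zcoeff_eq_0)
qed

lemma vanish_4_first:
  "V_op 4 (zpows 4 k * chain_prod 4 * (zvar_pow 1 1 * (zsq - zpq * zratio 3 4 - zratio 2 1))) F = 0"
proof -
  let ?P = "Psi {1..4} F * zpows 4 k"
  let ?G12 = "(omega_snd 1 4 * omega_snd 2 4) * ((omega_fst 1 3 * omega_fst 2 3) *
    ((omega_fst 1 4 * omega_fst 2 4) * omega_fst 3 4))"
  let ?G23 = "omega_snd 1 4 * ((omega_fst 1 2 * omega_fst 1 3) * (omega_fst 1 4 * (omega_fst 2 4 * omega_fst 3 4)))"
  let ?G34 = "(omega_snd 1 3 * omega_snd 1 4) * ((omega_fst 1 3 * omega_fst 1 4) *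
    ((omega_fst 2 3 * omega_fst 2 4) * omega_fst 1 2))"
  let ?q = "zvar_pow 1 1 * zvar_pow 4 1 - zvar_pow 2 1 * zvar_pow 3 1"
  have "zratio 1 2 * zratio 2 1 = 1" by (simp add: zratio_mult)
  \<comment> \<open>Again read from the other end: x = z_3/z_4, y = z_2/z_3, w = z_1/z_2.\<close>
  from numerator_identity_4[OF this, of zsq zpq "zratio 3 4" "zratio 2 3"]
  have N: "(zsq - zpq * zratio 3 4 - zratio 2 1) * (omega_snd 1 3 * omega_snd 2 4) =
      (- zratio 2 1) * omega_snd 2 4 * zDelta 1 2 + zpq * (zratio 1 2 - zratio 3 4) * zDelta 2 3 +
      zpq * zratio 2 3 * omega_snd 1 3 * zDelta 3 4"
    unfolding omega_snd_def zDelta_def zratio_mult[of 1 2 3, symmetric] zratio_mult[of 2 3 4, symmetric]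
    by (simp add: mult.commute)
  have 1: "?P * ?G12 * (zvar_pow 1 1 * (- zratio 2 1 * (1 - zratio 1 2))) =
      - (?P * ?G12 * (zvar_pow 2 1 - zvar_pow 1 1))"
    by (simp only: zvar_zratio_diff mult_minus_right)
  have 2: "?P * ?G23 * (zvar_pow 1 1 * (zpq * (zratio 1 2 - zratio 3 4) * (1 - zratio 2 3))) =
      ?P * (?G23 * (zvar_pow 1 1 * (zpq * (zvar_pow 4 (- 1) * ((zvar_pow 2 (- 1) * zvar_pow 3 (- 1)) * ?q)))))
        * (zvar_pow 3 1 - zvar_pow 2 1)"
    unfolding zratio_diff_ratio one_minus_zratio[of 2 3] by (simp only: ac_simps)
  have 3: "?P * ?G34 * (zvar_pow 1 1 * (zpq * zratio 2 3 * (1 - zratio 3 4))) =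
      ?P * (?G34 * (zvar_pow 1 1 * (zpq * (zvar_pow 2 1 * (zvar_pow 3 (- 1) * zvar_pow 4 (- 1)))))) *
        (zvar_pow 4 1 - zvar_pow 3 1)"
    unfolding one_minus_zratio[of 3 4] zratio_def[of 2 3] by (simp only: mult.assoc)
  have "zcoeff (?P * ?G12 * (zvar_pow 2 1 - zvar_pow 1 1)) 0 = 0"
    by (intro antisymmetric_constant_term symm_mult[OF symm_Psi_zpows] symm_mult[OF symm_omega_snd_above]
        symm_mult[OF symm_omega_fst_above] symm_omega_fst) simp_all
  moreover have "zcoeff (?P * (?G23 * (zvar_pow 1 1 * (zpq * (zvar_pow 4 (- 1) *
      ((zvar_pow 2 (- 1) * zvar_pow 3 (- 1)) * ?q))))) * (zvar_pow 3 1 - zvar_pow 2 1)) 0 = 0"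
    by (intro antisymmetric_constant_term symm_mult[OF symm_Psi_zpows] symm_mult[OF symm_mult[OF symm_omega_snd]]
        symm_mult[OF symm_omega_fst_below] symm_mult[OF symm_omega_fst] symm_omega_fst_above
        symm_mult[OF symm_zvar_pow] symm_mult[OF symm_zpq] symm_mult[OF symm_zvar_pow_pair]
        symm_diff symm_zvar_pow_pair symm_zvar_pow) simp_all
  moreover have "zcoeff (?P * (?G34 * (zvar_pow 1 1 * (zpq * (zvar_pow 2 1 *
      (zvar_pow 3 (- 1) * zvar_pow 4 (- 1)))))) * (zvar_pow 4 1 - zvar_pow 3 1)) 0 = 0"
    by (intro antisymmetric_constant_term symm_mult[OF symm_Psi_zpows] symm_mult[OF symm_mult[OF symm_omega_snd_below]]
        symm_mult[OF symm_omega_fst_below] symm_omega_fst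
        symm_mult[OF symm_zvar_pow] symm_mult[OF symm_zpq] symm_zvar_pow_pair) simp_all
  ultimately show ?thesis
    unfolding V_op_def V_kernel_4
      vanish_ring_4[OF N omega_fst_zDelta_adjacent] 1 2 3
    by (intro zcoeff_eq_0)
qed

section \<open>Comparison of the recursions\<close>

lemma negut_exp_div: "negut_exp u v i = int (i * v div u) - int ((i - 1) * v div u)"
  unfolding negut_exp_def by (simp only: floor_divide_of_nat_eq)

text \<open>The floor of j(mk+1)/m is jk until j = m, where it gains the only extra unit.\<close>

lemma negut_exp_last:
  assumes "1 \<le> i" "i \<le> m"
  shows "negut_exp m (m * k + 1) i = int k + (if i = m then 1 else 0)"
proof -
  have d: "j * (m * k + 1) div m = j * k + (if j = m then 1 else 0)" if "j \<le> m" for j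
  proof -
    have "j * (m * k + 1) = j + m * (j * k)" by (simp add: algebra_simps)
    then have "j * (m * k + 1) div m = j * k + j div m"
      using assms by (simp only: div_mult_self2)
    then show ?thesis using that assms by auto
  qed
  have "i - 1 \<le> m" using assms by auto
  then show ?thesis unfolding negut_exp_div d[OF assms(2)] d[OF \<open>i - 1 \<le> m\<close>]
    using assms by (cases i) auto
qed

text \<open>The floor of j(mk+m-1)/m is jk + j - 1 for 1 <= j <= m but 0 for j = 0, so the first
  step alone is short by one.\<close>

lemma negut_exp_first:
  assumes "1 \<le> i" "i \<le> m"
  shows "negut_exp m (m * k + (m - 1)) i = int (k + 1) - (if i = 1 then 1 else 0)"
proof -
  \<comment> \<open>For j = 0 the truncated subtraction j - 1 gives the correct value 0.\<close>
  have d: "j * (m * k + (m - 1)) div m = j * k + (j - 1)" if "j \<le> m" for j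
  proof (cases j)
    case 0
    then show ?thesis by simp
  next
    case (Suc l)
    have "j * (m * k + (m - 1)) = (m - j) + m * (j * k + l)"
      using Suc that by (simp add: algebra_simps diff_mult_distrib2)
    then have "j * (m * k + (m - 1)) div m = j * k + l + (m - j) div m"
      using assms by (simp only: div_mult_self2)
    then show ?thesis using that assms Suc by simp
  qed
  have "i - 1 \<le> m" using assms by auto
  then show ?thesis unfolding negut_exp_div d[OF assms(2)] d[OF \<open>i - 1 \<le> m\<close>]
    using assms by (cases i) auto
qed

lemma N_op_last:
  assumes "m \<ge> 1"
  shows "N_op m (m * k + 1) F = V_op m (zvar_pow m (- 1) * (zpows m (- int k) * chain_prod m)) F"
proof -
  have "(\<Prod>i=1..m. zvar_pow i (- negut_exp m (m * k + 1) i)) =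
      (\<Prod>i=1..m. zvar_pow i (- int k) * (if i = m then zvar_pow i (- 1) else 1))"
  proof (rule prod.cong[OF refl])
    fix i assume "i \<in> {1..m}"
    then have "negut_exp m (m * k + 1) i = int k + (if i = m then 1 else 0)"
      by (intro negut_exp_last) auto
    then show "zvar_pow i (- negut_exp m (m * k + 1) i) =
        zvar_pow i (- int k) * (if i = m then zvar_pow i (- 1) else 1)"
      by (cases "i = m") (simp_all flip: zvar_pow_add)
  qed
  also have "\<dots> = zpows m (- int k) * zvar_pow m (- 1)"
    using assms by (simp add: prod.distrib zpows_def prod.delta)
  finally show ?thesis by (simp add: N_op_eq_V_op ac_simps)
qed

lemma N_op_first:
  assumes "m \<ge> 1"
  shows "N_op m (m * k + (m - 1)) F =
    V_op m (zvar_pow 1 1 * (zpows m (- int (k + 1)) * chain_prod m)) F"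
proof -
  have "(\<Prod>i=1..m. zvar_pow i (- negut_exp m (m * k + (m - 1)) i)) =
      (\<Prod>i=1..m. zvar_pow i (- int (k + 1)) * (if i = 1 then zvar_pow i 1 else 1))"
  proof (rule prod.cong[OF refl])
    fix i assume "i \<in> {1..m}"
    then have "negut_exp m (m * k + (m - 1)) i = int (k + 1) - (if i = 1 then 1 else 0)"
      by (intro negut_exp_first) auto
    then show "zvar_pow i (- negut_exp m (m * k + (m - 1)) i) =
        zvar_pow i (- int (k + 1)) * (if i = 1 then zvar_pow i 1 else 1)"
      by (cases "i = 1") (simp_all flip: zvar_pow_add)
  qed
  also have "\<dots> = zpows m (- int (k + 1)) * zvar_pow 1 1"
    using assms by (simp add: prod.distrib zpows_def prod.delta)
  finally show ?thesis by (simp add: N_op_eq_V_op ac_simps)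
qed

text \<open>The constant term in no variables is the identity operator; \<open>D_op_V_op\<close>
  adds the single variable.\<close>

lemma N_op_1: "N_op 1 n = D_op n"
proof
  fix F
  have "V_op 0 1 F = F"
    by (simp add: V_op_def V_kernel_def Psi_empty less_pairs_def zmon.rep_eq)
  then have "D_op n F = V_op 1 (1 * zvar_pow 1 (- int n)) F"
    using D_op_V_op[OF scalar_in_1, of "int n" 0 F] by simp
  moreover have "negut_exp 1 n 1 = int n" by (simp add: negut_exp_def)
  ultimately show "N_op 1 n F = D_op n F" by (simp add: N_op_eq_V_op chain_prod_def)
qed

lemma scal_MM_cancel: "A - scal MM * B = 0 \<Longrightarrow> scal (1 / MM) * A = B"
  by (simp add: mult.assoc[symmetric] scal_mult[symmetric] MM_nonzero)

lemma N_op_commutator_last: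
  assumes "m \<in> {1, 2, 3}"
  shows "scal (1 / MM) * op_commutator (N_op m (m * k + 1)) (D_op (int k)) F = N_op (Suc m) (Suc m * k + 1) F"
proof (rule scal_MM_cancel)
  have m: "m \<ge> 1" using assms by auto
  have N: "N_op m (m * k + 1) = V_op m (zvar_pow m (- 1) * (zpows m (- int k) * chain_prod m))"
    using m by (intro ext N_op_last)
  have N': "N_op (Suc m) (Suc m * k + 1) F =
      V_op (Suc m) (zvar_pow (Suc m) (- 1) * (zpows (Suc m) (- int k) * chain_prod (Suc m))) F"
    by (rule N_op_last) simp
  have "V_op (Suc m) (zpows (Suc m) (- int k) * chain_prod (Suc m) *
      (zvar_pow (Suc m) (- 1) * (zsq - zpq * zratio 1 2 - zratio (Suc m) m))) F = 0"
    using assms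
  proof (elim insertE emptyE)
    assume "m = 1" then show ?thesis using vanish_2[of "- int k" F] by (simp add: numeral_2_eq_2)
  next
    assume "m = 2" then show ?thesis using vanish_3_last[of "- int k" F] by simp
  next
    assume "m = 3" then show ?thesis using vanish_4_last[of "- int k" F] by simp
  qed
  then show "op_commutator (N_op m (m * k + 1)) (D_op (int k)) F - scal MM * N_op (Suc m) (Suc m * k + 1) F = 0"
    unfolding N N' commutator_last[OF m] .
qed

lemma N_op_commutator_first:
  assumes "m \<in> {2, 3}"
  shows "scal (1 / MM) * op_commutator (D_op (int (k + 1))) (N_op m (m * k + (m - 1))) F =
    N_op (Suc m) (Suc m * k + m) F"
proof (rule scal_MM_cancel)
  have m: "m \<ge> 1" using assms by auto
  have N: "N_op m (m * k + (m - 1)) = V_op m (zvar_pow 1 1 * (zpows m (- int (k + 1)) * chain_prod m))"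
    using m by (intro ext N_op_first)
  have N': "N_op (Suc m) (Suc m * k + m) F =
      V_op (Suc m) (zvar_pow 1 1 * (zpows (Suc m) (- int (k + 1)) * chain_prod (Suc m))) F"
    using N_op_first[of "Suc m" k F] by simp
  have "V_op (Suc m) (zpows (Suc m) (- int (k + 1)) * chain_prod (Suc m) *
      (zvar_pow 1 1 * (zsq - zpq * zratio m (Suc m) - zratio 2 1))) F = 0"
    using assms
  proof (elim insertE emptyE)
    assume "m = 2" then show ?thesis using vanish_3_first[of "- int (k + 1)" F] by simp
  next
    assume "m = 3" then show ?thesis using vanish_4_first[of "- int (k + 1)" F] by simp
  qed
  then show "op_commutator (D_op (int (k + 1))) (N_op m (m * k + (m - 1))) F -
      scal MM * N_op (Suc m) (Suc m * k + m) F = 0"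
    unfolding N N' commutator_first[OF m] .
qed

section \<open>The recursion for Q in the residue classes 1 and -1\<close>

lemma Q_op_split:
  assumes "coprime m n" "m > 0" "n > 0" "split_fst m n = (a, b)"
  shows "Q_op m n = (\<lambda>F. scal (1 / MM) * op_commutator (Q_op (m - a) (n - b)) (Q_op a b) F)"
  using assms by (subst Q_op.simps) simp

lemma split_fst_eqI:
  assumes "coprime m n" "m > 1" "n > 1" "1 \<le> a" "a \<le> m - 1" "1 \<le> b" "b \<le> n - 1" "m * b + 1 = n * a"
  shows "split_fst m n = (a, b)"
  using the1_equality[OF split_ex1[OF assms(1-3)], of "(a, b)"] assms by (simp add: split_fst_def)

text \<open>Induction along Split(1,n+1) = (1,n) + (0,1), where the commutator of -e_1 with D_n
  equals M D_(n+1) by \<open>D_op_e1\<close>.\<close>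

lemma Q_op_1: "Q_op 1 n = D_op (int n)"
proof (induction n)
  case 0
  show ?case by (subst Q_op.simps) simp
next
  case (Suc n)
  have "Q_op 0 1 = (\<lambda>F. - (e1 * F))" by (subst Q_op.simps) simp
  moreover have "Q_op 1 (Suc n) = (\<lambda>F. scal (1 / MM) * op_commutator (Q_op 0 1) (Q_op 1 n) F)"
    by (subst Q_op_split[of 1 "Suc n" 1 n]) (simp_all add: split_fst_def)
  ultimately have Q: "Q_op 1 (Suc n) = (\<lambda>F. scal (1 / MM) * op_commutator (\<lambda>F. - (e1 * F)) (D_op (int n)) F)"
    using Suc.IH by simp
  have neg: "D_op (int n) (- G) = - D_op (int n) G" for G
    using D_op_scal[of "int n" "- 1" G] by (simp add: scal_uminus)
  show ?case unfolding Q
  proof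
    fix F
    show "scal (1 / MM) * op_commutator (\<lambda>F. - (e1 * F)) (D_op (int n)) F = D_op (int (Suc n)) F"
      by (rule scal_MM_cancel) (simp add: op_commutator_def neg D_op_e1 add.commute)
  qed
qed

text \<open>The first summand of the split is (1,k), because (m+1)k + 1 = n * 1.\<close>

lemma Q_op_last:
  assumes "m \<ge> 1"
  shows "Q_op (Suc m) (Suc m * k + 1) F = scal (1 / MM) * op_commutator (Q_op m (m * k + 1)) (D_op (int k)) F"
proof -
  have c: "coprime (Suc m) (Suc m * k + 1)"
    by (metis coprime_1_right coprime_iff_gcd_eq_1 gcd_add_mult add.commute mult.commute)
  have "split_fst (Suc m) (Suc m * k + 1) = (1, k)"
  \<comment> \<open>For k = 0 the second entry is 1, and the separate clause for Split(m,1)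
    applies.\<close>
  proof (cases "k = 0")
    case True
    then show ?thesis using assms by (simp add: split_fst_def)
  next
    case False
    then show ?thesis using assms by (intro split_fst_eqI c) (auto simp: algebra_simps)
  qed
  then have "Q_op (Suc m) (Suc m * k + 1) =
      (\<lambda>F. scal (1 / MM) * op_commutator (Q_op (Suc m - 1) (Suc m * k + 1 - k)) (Q_op 1 k) F)"
    by (intro Q_op_split c) simp_all
  then show ?thesis by (simp add: Q_op_1[simplified])
qed

text \<open>Here (1,k+1) is the second summand, so its operator stands on the left in the
  commutator. The bound m >= 2 makes the second entry mk + m - 1 of the first summand
  positive.\<close>

lemma Q_op_first:
  assumes "m \<ge> 2"
  shows "Q_op (Suc m) (Suc m * k + m) F =
    scal (1 / MM) * op_commutator (D_op (int (k + 1))) (Q_op m (m * k + (m - 1))) F"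
proof -
  have "coprime (Suc m) m" by simp
  then have c: "coprime (Suc m) (Suc m * k + m)"
    by (metis coprime_iff_gcd_eq_1 gcd_add_mult add.commute mult.commute)
  have "Suc m * (m * k + (m - 1)) + 1 = (Suc m * k + m) * m"
    using assms by (cases m) (simp_all add: algebra_simps)
  moreover have "m * k + (m - 1) \<le> Suc m * k + m - 1" using assms by simp
  ultimately have "split_fst (Suc m) (Suc m * k + m) = (m, m * k + (m - 1))"
    using assms by (intro split_fst_eqI c) simp_all
  then have "Q_op (Suc m) (Suc m * k + m) = (\<lambda>F. scal (1 / MM) *
      op_commutator (Q_op (Suc m - m) (Suc m * k + m - (m * k + (m - 1)))) (Q_op m (m * k + (m - 1))) F)"
    using assms by (intro Q_op_split c) simp_all
  moreover have "Suc m - m = 1" "Suc m * k + m - (m * k + (m - 1)) = k + 1" using assms by auto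
  ultimately show ?thesis by (simp only: Q_op_1)
qed

lemma Q_op_eq_N_op_last:
  assumes "m \<in> {1, 2, 3, 4}" shows "Q_op m (m * k + 1) = N_op m (m * k + 1)"
proof -
  have 1: "Q_op 1 (1 * k + 1) = N_op 1 (1 * k + 1)" by (simp only: Q_op_1 N_op_1)
  have step: "Q_op (Suc m) (Suc m * k + 1) = N_op (Suc m) (Suc m * k + 1)"
    if "m \<in> {1, 2, 3}" "Q_op m (m * k + 1) = N_op m (m * k + 1)" for m
    using that N_op_commutator_last[OF that(1), of k] by (intro ext) (subst Q_op_last; auto)
  have 2: "Q_op 2 (2 * k + 1) = N_op 2 (2 * k + 1)" using step[OF _ 1] by (simp add: numeral_2_eq_2)
  have 3: "Q_op 3 (3 * k + 1) = N_op 3 (3 * k + 1)" using step[OF _ 2] by (simp add: numeral_3_eq_3)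
  have 4: "Q_op 4 (4 * k + 1) = N_op 4 (4 * k + 1)" using step[OF _ 3] by simp
  show ?thesis using assms 1 2 3 4 by auto
qed

lemma Q_op_eq_N_op_first:
  assumes "m \<in> {2, 3, 4}" shows "Q_op m (m * k + (m - 1)) = N_op m (m * k + (m - 1))"
proof -
  have 2: "Q_op 2 (2 * k + (2 - 1)) = N_op 2 (2 * k + (2 - 1))"
    using Q_op_eq_N_op_last[of 2 k] by simp
  have step: "Q_op (Suc m) (Suc m * k + m) = N_op (Suc m) (Suc m * k + m)"
    if "m \<in> {2, 3}" "Q_op m (m * k + (m - 1)) = N_op m (m * k + (m - 1))" for m
    using that N_op_commutator_first[OF that(1), of k] by (intro ext) (subst Q_op_first; auto)
  have 3: "Q_op 3 (3 * k + (3 - 1)) = N_op 3 (3 * k + (3 - 1))" using step[OF _ 2] by simp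
  have 4: "Q_op 4 (4 * k + (4 - 1)) = N_op 4 (4 * k + (4 - 1))" using step[OF _ 3] by simp
  show ?thesis using assms 2 3 4 by auto
qed

theorem theorem3p2:
  fixes m n :: nat
  assumes "m \<ge> 1" and "n \<ge> 1" and "coprime m n" and "m \<le> 4"
  shows "Q_op m n = N_op m n"
proof -
  define k where "k = n div m"
  have n: "n = m * k + n mod m" by (simp add: k_def)
  have "m = 1 \<or> m = 2 \<or> m = 3 \<or> m = 4" using assms(1,4) by auto
  \<comment> \<open>For m <= 4 the residues coprime to m are 1 and m - 1; for m = 2 they coincide
    and the first class takes the case.\<close>
  then consider "m = 1" | "m \<in> {2, 3, 4}" "n mod m = 1" | "m \<in> {3, 4}" "n mod m = m - 1"
  proof (elim disjE)
    assume m: "m = 2"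
    then have "n mod 2 = 1" using assms(3) by (metis coprime_left_2_iff_odd odd_iff_mod_2_eq_one)
    with m that(2) show ?thesis by simp
  next
    assume m: "m = 3"
    have "n mod 3 \<noteq> 0"
    proof
      assume "n mod 3 = 0"
      then have "3 dvd n" by auto
      then show False using coprime_common_divisor[of 3 n 3] assms(3) m by simp
    qed
    then have "n mod 3 = 1 \<or> n mod 3 = 2" by linarith
    with m that(2,3) show ?thesis by auto
  next
    assume m: "m = 4"
    have "odd n" using assms(3) m by (metis coprime_common_divisor dvd_def even_numeral odd_one)
    then have "n mod 4 = 1 \<or> n mod 4 = 3" by presburger
    with m that(2,3) show ?thesis by auto
  qed (use that(1) in blast)
  then show ?thesis
  proof cases
    case 1
    then show ?thesis by (simp only: Q_op_1 N_op_1)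
  next
    case 2
    then show ?thesis using n Q_op_eq_N_op_last[of m k] by auto
  next
    case 3
    then show ?thesis using n Q_op_eq_N_op_first[of m k] by auto
  qed
qed

end
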